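(* Let $m\ge0$ be an integer, $\alpha\in(0,1)$, and let $H,S\in C^{m,\alpha}(\partial\Delta,\mathbb C^{n\times n})$ be such that $H(\zeta)$ is Hermitian, $S(\zeta)$ is symmetric, and $v^tH(\zeta)\bar v>|v^tS(\zeta)v|$ for all $\zeta\in\partial\Delta$ and $v\in\mathbb C^n\setminus\{0\}$. Then for every $f\in C^{m,\alpha}(\partial\Delta,\mathbb C^n)$ and all $(\zeta_0,z_0),(\xi_0,w_0)\in\overline\Delta\times\mathbb C^n$ with $\zeta_0\ne\xi_0$ there exists a unique $g\in\mathcal O^{m,\alpha}(\partial\Delta,\mathbb C^n)$ such that $g(\zeta_0)=z_0$, $g(\xi_0)=w_0$, and $$H\,\overline{(g/\mathrm{Id}_{\partial\Delta})}+S\,g/\mathrm{Id}_{\partial\Delta}+f\in\mathcal O^{m,\alpha}(\partial\Delta,\mathbb C^n).$$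
   Context: $\Delta$ is the open unit disc in $\mathbb C$, $\mathrm{Id}_{\partial\Delta}$ is the function $\zeta\mapsto\zeta$ on $\partial\Delta$, and $C^{m,\alpha}(\partial\Delta,\cdot)$ denotes Hölder spaces on the circle ($C^{0,\alpha}$ meaning $\alpha$-Hölder continuous). $\mathcal O^{m,\alpha}(\partial\Delta,\mathbb C^n)$ is the subspace of $C^{m,\alpha}(\partial\Delta,\mathbb C^n)$ consisting of maps that extend holomorphically to $\Delta$ (continuously up to the boundary); such a map is identified with its holomorphic extension, so $g(\zeta_0)$ makes sense for $\zeta_0\in\overline\Delta$. *)

theory Defs
  imports "HOL-Analysis.Analysis"
begin

text \<open>Functions on the unit circle are represented as functions on the whole complex
plane of which only the values on the unit circle matter.  Hoelder class C^{m,alpha}: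
the function t |-> F (cis t) on the real line is m times differentiable and its m-th
derivative is alpha-Hoelder continuous.\<close>

definition holder_circle :: "nat \<Rightarrow> real \<Rightarrow> (complex \<Rightarrow> 'a::real_normed_vector) \<Rightarrow> bool" where
  "holder_circle m \<alpha> F \<longleftrightarrow>
     (\<exists>D :: nat \<Rightarrow> real \<Rightarrow> 'a.
        D 0 = (\<lambda>t. F (cis t)) \<and>
        (\<forall>k<m. \<forall>t. (D k has_vector_derivative D (Suc k) t) (at t)) \<and>
        (\<exists>C. \<forall>s t. norm (D m s - D m t) \<le> C * \<bar>s - t\<bar> powr \<alpha>))"

definition holo_disc :: "(complex \<Rightarrow> complex ^ 'n) \<Rightarrow> bool" where
  "holo_disc G \<longleftrightarrow> continuous_on (cball 0 1) G \<and>
     (\<forall>i. (\<lambda>z. G z $ i) holomorphic_on ball 0 1)"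

definition in_O :: "nat \<Rightarrow> real \<Rightarrow> (complex \<Rightarrow> complex ^ 'n) \<Rightarrow> bool" where
  "in_O m \<alpha> F \<longleftrightarrow> holder_circle m \<alpha> F \<and>
     (\<exists>G. holo_disc G \<and> (\<forall>\<zeta>\<in>sphere 0 1. G \<zeta> = F \<zeta>))"

definition vcnj :: "complex ^ 'n \<Rightarrow> complex ^ 'n" where
  "vcnj v = (\<chi> i. cnj (v $ i))"

end

theory Submission
  imports Defs "HOL-Complex_Analysis.Conformal_Mappings"
begin

text \<open>Write \<open>g = a + b \<zeta> + \<zeta> v\<close> with \<open>v 0 = 0\<close>.  The condition becomes \<open>H (cnj v) + S v + F \<in> O\<close> with a
  known \<open>F\<close>.  Multiplying by \<open>v\<close> and integrating over the circle removes the holomorphic right-hand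
  side, so the pointwise inequality for \<open>H\<close> and \<open>S\<close> bounds the mean of \<open>\<bar>v\<bar>\<close> by the size of \<open>F\<close>.  On the other hand,
  freezing the coefficients at a boundary point \<open>z\<close> and multiplying by the inverse of \<open>H z\<close> shows that
  \<open>cnj v\<close> is, up to an error of order \<open>\<bar>\<zeta> - z\<bar>\<^sup>\<alpha>\<close>, the boundary value of a holomorphic function;
  since Cauchy's formula for \<open>v'\<close> does not see such functions, \<open>v'\<close> is controlled as in the
  Hardy-Littlewood characterisation of Hoelder functions.  The two bounds combine to an a priori
  Hoelder estimate, and the method of continuity, starting from \<open>H = 1\<close> and \<open>S = 0\<close>, solves the
  equation for every \<open>F\<close>.  Higher regularity follows by comparing the difference quotients of \<open>v\<close> along the circle
  with the solution of the differentiated equation.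

  For \<open>f = 0\<close> the solutions thus form a real vector space parametrised by \<open>(a, b)\<close>, and it remains to see that
  a solution with two distinct zeros vanishes: evaluation at the two points is then an injective, hence
  bijective, linear map.\<close>

section \<open>Means over the circle and the Cauchy kernel\<close>

text \<open>The splitting is dictated by the pairing: \<open>v 0 = 0\<close> makes the mean of
  \<open>bdot v p\<close>, its value at 0, vanish, while the Taylor coefficients split off in
  \<open>(a, b)\<close> have together as many real dimensions as the two prescribed values.
  Conjugation leaves linearity over the reals only. The obstacle to the a priori estimate is that
  freezing the coefficients costs an error proportional to the supremum of \<open>v\<close> itself.
  It is absorbed at a maximum point on the circle: at depth \<delta> below it the mean bound
  controls \<open>v\<close>, and the Hoelder increment in between is only a small multiple of the
  supremum if \<delta> is small. The constant depends on the coefficients only through their Hoelder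
  bound and ellipticity constant, hence one step length serves the whole path of the continuity
  method. For two zeros, the obstacle is a zero on the circle: every integral with such a pole has a
  numerator vanishing there to order \<alpha>, and is reached as a limit from poles moved off the
  closed disc.\<close>

definition cmean :: "(complex \<Rightarrow> 'a::banach) \<Rightarrow> 'a" where
  "cmean f = integral {0..1} (\<lambda>t. f (cis (2 * pi * t)))"

definition cint :: "(complex \<Rightarrow> 'a::banach) \<Rightarrow> bool" where
  "cint f \<longleftrightarrow> (\<lambda>t. f (cis (2 * pi * t))) integrable_on {0..1}"

lemma cis_in_sphere [simp]: "cis t \<in> sphere 0 1"
  by simp

lemma sphere_cisE:
  assumes "z \<in> sphere 0 (1::real)"
  obtains s where "s \<in> {0..1}" "z = cis (2 * pi * s)"
proof -
  have "cmod z = 1" using assms by simp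
  then obtain t where t: "0 \<le> t" "t < 2 * pi" "z = Complex (cos t) (sin t)"
    using complex_unimodular_polar by metis
  show ?thesis
    by (rule that[of "t / (2 * pi)"]) (use t in \<open>auto simp: field_simps complex_eq_iff\<close>)
qed

lemma cint_continuous:
  assumes "continuous_on (sphere 0 1) f"
  shows "cint f"
  unfolding cint_def
  by (intro integrable_continuous_interval continuous_on_compose2[OF assms] continuous_intros) auto

lemma cmean_cong:
  assumes "\<And>z. z \<in> sphere 0 1 \<Longrightarrow> f z = g z"
  shows "cmean f = cmean g"
  unfolding cmean_def using assms by (intro integral_cong) simp

lemma cint_cong:
  assumes "\<And>z. z \<in> sphere 0 1 \<Longrightarrow> f z = g z"
  shows "cint f \<longleftrightarrow> cint g"
  unfolding cint_def using assms by (intro integrable_cong) simp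

lemma cmean_add: "cint f \<Longrightarrow> cint g \<Longrightarrow> cmean (\<lambda>z. f z + g z) = cmean f + cmean g"
  unfolding cint_def cmean_def by (rule integral_add)

lemma cmean_diff: "cint f \<Longrightarrow> cint g \<Longrightarrow> cmean (\<lambda>z. f z - g z) = cmean f - cmean g"
  unfolding cint_def cmean_def by (rule integral_diff)

lemma cmean_linear: "bounded_linear h \<Longrightarrow> cint f \<Longrightarrow> cmean (\<lambda>z. h (f z)) = h (cmean f)"
  unfolding cint_def cmean_def using integral_linear[of _ "{0..1}" h] by (simp add: o_def)

lemma cint_linear: "bounded_linear h \<Longrightarrow> cint f \<Longrightarrow> cint (\<lambda>z. h (f z))"
  unfolding cint_def using integrable_linear[of _ "{0..1}" h] by (simp add: o_def)

lemma cmean_const [simp]: "cmean (\<lambda>z. c) = c"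
  unfolding cmean_def by simp

lemma cint_diff: "cint f \<Longrightarrow> cint g \<Longrightarrow> cint (\<lambda>z. f z - g z)"
  unfolding cint_def by (rule integrable_diff)

lemma cmean_norm_le:
  assumes "cint f" "cint g" "\<And>z. z \<in> sphere 0 1 \<Longrightarrow> norm (f z) \<le> g z"
  shows "norm (cmean f) \<le> cmean g"
  unfolding cmean_def using assms unfolding cint_def by (intro integral_norm_bound_integral) auto

lemma cmean_mono:
  assumes "cint f" "cint g" "\<And>z. z \<in> sphere 0 1 \<Longrightarrow> f z \<le> (g z :: real)"
  shows "cmean f \<le> cmean g"
  unfolding cmean_def using assms unfolding cint_def by (intro integral_le) auto

text \<open>On the unit circle \<open>dz\<close> equals \<open>2 * pi * \<i> * z\<close> times
  normalised arc length, which accounts for the factor \<open>z\<close> in all Cauchy kernels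
  below.\<close>

lemma has_contour_integral_cmean:
  assumes "(f has_contour_integral I) (circlepath 0 1)"
  shows "cint (\<lambda>z. z * f z)" "cmean (\<lambda>z. z * f z) = I / (2 * pi * \<i>)"
proof -
  have e: "exp (2 * of_real pi * \<i> * of_real t) = cis (2 * pi * t)" for t
    by (simp add: cis_conv_exp algebra_simps)
  have "((\<lambda>t. f (cis (2*pi*t)) * (2 * of_real pi * \<i> * cis (2*pi*t))) has_integral I) {0..1}"
    using assms unfolding has_contour_integral_def
  proof (rule has_integral_eq[rotated])
    fix t :: real assume "t \<in> {0..1}"
    then show "f (circlepath 0 1 t) * vector_derivative (circlepath 0 1) (at t within {0..1})
        = f (cis (2*pi*t)) * (2 * of_real pi * \<i> * cis (2*pi*t))"
      using vector_derivative_circlepath01[of t 0 1] by (simp add: circlepath[of 0 1] e)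
  qed
  from has_integral_mult_right[OF this, of "1 / (2 * pi * \<i>)"]
  have "((\<lambda>t. cis (2*pi*t) * f (cis (2*pi*t))) has_integral I / (2 * pi * \<i>)) {0..1}"
    by (simp add: field_simps)
  then show "cint (\<lambda>z. z * f z)" "cmean (\<lambda>z. z * f z) = I / (2 * pi * \<i>)"
    unfolding cint_def cmean_def by (auto simp: has_integral_iff)
qed

lemma cmean_Cauchy:
  assumes "continuous_on (cball 0 1) f" "f holomorphic_on ball 0 1" "cmod w < 1"
  shows "cmean (\<lambda>z. z * f z / (z - w)) = f w"
  using has_contour_integral_cmean(2)[OF Cauchy_integral_circlepath[of 0 1 f w]] assms by simp

lemma cmean_value:
  assumes "continuous_on (cball 0 1) f" "f holomorphic_on ball 0 1"
  shows "cmean f = f 0"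
  using cmean_Cauchy[OF assms, of 0] by (subst cmean_cong[of f "\<lambda>z. z * f z / (z - 0)"]) auto

text \<open>Differentiation under the integral for a density that is only continuous on the circle;
  it is applied to Hoelder data that need not extend holomorphically.\<close>

lemma Cauchy_transform_deriv:
  assumes f: "continuous_on (sphere 0 1) f" and w: "cmod w < 1"
  shows "((\<lambda>w. cmean (\<lambda>z. z * f z / (z - w))) has_field_derivative
           cmean (\<lambda>z. z * f z / (z - w)\<^sup>2)) (at w)"
proof -
  let ?g = "\<lambda>w. contour_integral (circlepath 0 1) (\<lambda>u. f u / (u - w))"
  have int: "((\<lambda>u. f u / (u - w)) has_contour_integral ?g w) (circlepath 0 1)" if "cmod w < 1" for w
    by (rule has_contour_integral_integral, rule contour_integrable_continuous_circlepath)
       (use that in \<open>auto intro!: continuous_intros f\<close>)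
  have d: "(?g has_field_derivative contour_integral (circlepath 0 1) (\<lambda>u. f u / (u - w)^2)) (at w)"
    using Cauchy_next_derivative_circlepath(2)[of 0 1 f 1 ?g w] f w int
    by (simp add: power2_eq_square)
  have i2: "((\<lambda>u. f u / (u - w)^2) has_contour_integral
       contour_integral (circlepath 0 1) (\<lambda>u. f u / (u - w)^2)) (circlepath 0 1)"
    by (rule has_contour_integral_integral, rule contour_integrable_continuous_circlepath)
       (use w in \<open>auto intro!: continuous_intros f\<close>)
  have "((\<lambda>w. ?g w / (2 * pi * \<i>)) has_field_derivative
     contour_integral (circlepath 0 1) (\<lambda>u. f u / (u - w)^2) / (2 * pi * \<i>)) (at w)"
    by (rule DERIV_cdivide[OF d])
  moreover have "contour_integral (circlepath 0 1) (\<lambda>u. f u / (u - w)^2) / (2 * pi * \<i>)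
      = cmean (\<lambda>z. z * f z / (z - w)\<^sup>2)"
    using has_contour_integral_cmean(2)[OF i2] by simp
  moreover have "?g x / (2 * pi * \<i>) = cmean (\<lambda>z. z * f z / (z - x))" if "x \<in> ball 0 1" for x
    using has_contour_integral_cmean(2)[OF int[of x]] that by simp
  ultimately show ?thesis
    using has_field_derivative_transform_within_open[of _ _ w "ball 0 1"] w by simp
qed

section \<open>Chord against arc, and the singular integrals behind the Cauchy kernel\<close>

lemma sin_ge_half: "0 \<le> x \<Longrightarrow> x \<le> pi / 2 \<Longrightarrow> x / 2 \<le> sin (x::real)"
proof -
  assume x: "0 \<le> x" "x \<le> pi / 2"
  have "convex_on {0..pi} (\<lambda>x. - sin x)"
    by (rule f''_ge0_imp_convex[where f'="\<lambda>x. - cos x" and f''=sin])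
       (auto intro!: derivative_eq_intros sin_ge_zero)
  then have "- sin ((1 - 2*x/pi) * 0 + (2*x/pi) * (pi/2)) \<le> (1 - 2*x/pi) * (- sin 0) + (2*x/pi) * (- sin (pi/2))"
    using x convex_onD[of "{0..pi}" "\<lambda>x. - sin x" "2*x/pi" 0 "pi/2"] by (simp add: field_simps)
  then have "2*x/pi \<le> sin x" by simp
  \<comment> \<open>Jordan's constant \<open>2 / pi\<close>, which concavity gives, is weakened to
    \<open>1 / 2\<close> through \<open>pi < 4\<close>.\<close>
  moreover have "x / 2 \<le> 2*x/pi" using x pi_less_4 mult_right_mono[of pi 4 x] by (simp add: field_simps)
  ultimately show ?thesis by linarith
qed

lemma norm_cis_diff: "cmod (cis a - cis b) = 2 * \<bar>sin ((a - b) / 2)\<bar>"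
proof -
  have "cis a - cis b = cis b * (cis (a - b) - 1)" by (simp add: algebra_simps cis_mult)
  then have "cmod (cis a - cis b) = cmod (exp (\<i> * (a - b)) - 1)"
    by (simp add: norm_mult cis_conv_exp)
  also have "\<dots> = dist (exp (\<i> * of_real (a - b))) (exp (\<i> * of_real 0))" by (simp add: dist_norm)
  also have "\<dots> = 2 * \<bar>sin ((a - b) / 2)\<bar>"
    using dist_exp_i_1[of "a-b"] by (simp add: dist_norm)
  finally show ?thesis .
qed

lemma norm_cis_diff_le: "cmod (cis a - cis b) \<le> \<bar>a - b\<bar>"
  unfolding norm_cis_diff using abs_sin_x_le_abs_x[of "(a-b)/2"] by simp

lemma norm_cis_diff_ge:
  assumes "\<bar>a - b\<bar> \<le> pi" shows "\<bar>a - b\<bar> \<le> 2 * cmod (cis a - cis b)"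
proof -
  have "\<bar>a - b\<bar> / 2 / 2 \<le> sin (\<bar>a - b\<bar> / 2)" by (rule sin_ge_half) (use assms in auto)
  moreover have "\<bar>sin ((a - b)/2)\<bar> \<ge> sin (\<bar>a - b\<bar> / 2)"
    using sin_minus[of "(b - a)/2"] by (cases "a \<ge> b") (auto simp del: sin_minus simp: minus_divide_left abs_if)
  ultimately have "\<bar>a - b\<bar> / 2 / 2 \<le> \<bar>sin ((a - b)/2)\<bar>" by (rule order_trans)
  then show ?thesis unfolding norm_cis_diff by simp
qed

text \<open>The ends of the parameter interval are glued on the circle, so the nearest parameter of
  the second point may lie one period away. The three shifts recur wherever a kernel on the circle
  is compared with one on the line.\<close>

lemma sphere_dist_ge:
  assumes "s \<in> {0..1}" "t \<in> {0..1}"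
  obtains a where "a \<in> {s, s - 1, s + 1}" "\<bar>t - a\<bar> \<le> cmod (cis (2 * pi * t) - cis (2 * pi * s))"
proof -
  define a where "a = (if \<bar>t - s\<bar> \<le> 1/2 then s else if t > s then s + 1 else s - 1)"
  have a: "a \<in> {s, s - 1, s + 1}" "\<bar>t - a\<bar> \<le> 1/2"
    using assms by (auto simp: a_def split: if_splits)
  have c: "cis (2 * pi * a) = cis (2 * pi * s)"
    using a(1) by (auto simp: right_diff_distrib distrib_left cis_mult[symmetric] cis_divide[symmetric])
  have "\<bar>2 * pi * t - 2 * pi * a\<bar> = 2 * pi * \<bar>t - a\<bar>" by (simp add: abs_mult right_diff_distrib[symmetric])
  also have "\<dots> \<le> pi" using a(2) by (simp add: field_simps)
  finally have "2 * pi * \<bar>t - a\<bar> \<le> 2 * cmod (cis (2 * pi * t) - cis (2 * pi * a))"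
    using norm_cis_diff_ge[of "2*pi*t" "2*pi*a"] by (simp add: abs_mult right_diff_distrib[symmetric])
  moreover have "\<bar>t - a\<bar> \<le> pi * \<bar>t - a\<bar>" using pi_ge_two mult_right_mono[of 1 pi "\<bar>t - a\<bar>"] by simp
  ultimately show ?thesis using that[OF a(1)] c by auto
qed

text \<open>The antiderivative \<open>sgn (t - a) * (k \<bar>t - a\<bar> - k 0)\<close> is
  continuous at \<open>a\<close> because \<open>k 0\<close> is subtracted, so the fundamental
  theorem applies with \<open>a\<close> as the single exceptional point, even if \<open>k'\<close>
  blows up there.\<close>

lemma has_integral_abs_shift:
  fixes k k' :: "real \<Rightarrow> real"
  assumes k: "\<And>x. 0 < x \<Longrightarrow> (k has_real_derivative k' x) (at x)"
    and lim: "(k \<longlongrightarrow> k 0) (at_right 0)"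
  shows "((\<lambda>t. k' \<bar>t - a\<bar>) has_integral
    sgn (1 - a) * (k \<bar>1 - a\<bar> - k 0) - sgn (0 - a) * (k \<bar>0 - a\<bar> - k 0)) {0..1}"
proof -
  define A where "A t = sgn (t - a) * (k \<bar>t - a\<bar> - k 0)" for t
  have A: "(A has_vector_derivative k' \<bar>t - a\<bar>) (at t)" if "t \<noteq> a" for t
  proof (cases "t > a")
    case True
    have "((\<lambda>t. k (t - a) - k 0) has_real_derivative k' (t - a)) (at t)"
      using True by (auto intro!: derivative_eq_intros DERIV_chain2[OF k])
    then have "(A has_real_derivative k' (t - a)) (at t)"
      by (rule has_field_derivative_transform_within_open[of _ _ _ "{a<..}"]) (use True in \<open>auto simp: A_def\<close>)
    then show ?thesis using True by (simp add: has_real_derivative_iff_has_vector_derivative)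
  next
    case False
    then have l: "t < a" using that by simp
    have "((\<lambda>t. k 0 - k (a - t)) has_real_derivative k' (a - t)) (at t)"
      using l by (auto intro!: derivative_eq_intros DERIV_chain2[OF k])
    then have "(A has_real_derivative k' (a - t)) (at t)"
      by (rule has_field_derivative_transform_within_open[of _ _ _ "{..<a}"]) (use l in \<open>auto simp: A_def\<close>)
    then show ?thesis using l by (simp add: has_real_derivative_iff_has_vector_derivative)
  qed
  have "isCont A t" for t
  proof (cases "t = a")
    case False
    then show ?thesis using A has_vector_derivative_continuous by blast
  next
    case True
    have "((\<lambda>t. \<bar>t - a\<bar>) \<longlongrightarrow> \<bar>a - a\<bar>) (at a)" by (intro tendsto_intros)
    then have "filterlim (\<lambda>t. \<bar>t - a\<bar>) (at_right 0) (at a)"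
      by (simp add: filterlim_at eventually_at_filter)
    from filterlim_compose[OF lim this]
    have 1: "((\<lambda>t. k \<bar>t - a\<bar> - k 0) \<longlongrightarrow> 0) (at a)" by (rule LIM_zero)
    have "(A \<longlongrightarrow> 0) (at a)"
      by (rule Lim_null_comparison[OF _ tendsto_rabs_zero[OF 1]])
         (auto simp: A_def abs_mult sgn_real_def intro!: always_eventually)
    then show ?thesis unfolding True isCont_def by (simp add: A_def)
  qed
  then have "continuous_on {0..1} A" by (simp add: continuous_at_imp_continuous_on)
  then have "((\<lambda>t. k' \<bar>t - a\<bar>) has_integral (A 1 - A 0)) {0..1}"
    by (intro fundamental_theorem_of_calculus_interior_strong[of "{a}"]) (use A in auto)
  then show ?thesis unfolding A_def .
qed

text \<open>Uniform in \<open>a\<close>: either end of the interval contributes at most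
  \<open>\<delta> powr (\<alpha> - 1) / (1 - \<alpha>)\<close>.\<close>

lemma integral_shifted_powr:
  fixes \<delta> a \<alpha> :: real
  assumes "0 < \<delta>" "0 < \<alpha>" "\<alpha> < 1"
  shows "(\<lambda>t. (\<delta> + \<bar>t - a\<bar>) powr (\<alpha> - 2)) integrable_on {0..1}"
    "integral {0..1} (\<lambda>t. (\<delta> + \<bar>t - a\<bar>) powr (\<alpha> - 2)) \<le> 2 * \<delta> powr (\<alpha> - 1) / (1 - \<alpha>)"
proof -
  define k where "k x = - ((\<delta> + x) powr (\<alpha> - 1)) / (1 - \<alpha>)" for x
  have dk: "(k has_real_derivative (\<delta> + x) powr (\<alpha> - 2)) (at x)" if "0 < x" for x
    unfolding k_def using that assms
    by (auto intro!: derivative_eq_intros simp: divide_simps) (simp add: algebra_simps)?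
  have "isCont k 0" unfolding k_def using assms by (intro continuous_intros) auto
  then have "(k \<longlongrightarrow> k 0) (at_right 0)" by (simp add: isCont_def filterlim_at_split)
  note I = has_integral_abs_shift[OF dk this, of a]
  then show "(\<lambda>t. (\<delta> + \<bar>t - a\<bar>) powr (\<alpha> - 2)) integrable_on {0..1}" by blast
  have bA: "\<bar>sgn s * (k \<bar>s\<bar> - k 0)\<bar> \<le> \<delta> powr (\<alpha> - 1) / (1 - \<alpha>)" for s
  proof -
    have "(\<delta> + \<bar>s\<bar>) powr (\<alpha> - 1) \<le> \<delta> powr (\<alpha> - 1)"
      by (rule powr_mono2') (use assms in auto)
    then have "\<bar>\<delta> powr (\<alpha> - 1) - (\<delta> + \<bar>s\<bar>) powr (\<alpha> - 1)\<bar> \<le> \<delta> powr (\<alpha> - 1)" by auto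
    moreover have "k \<bar>s\<bar> - k 0 = (\<delta> powr (\<alpha> - 1) - (\<delta> + \<bar>s\<bar>) powr (\<alpha> - 1)) / (1 - \<alpha>)"
      by (simp add: k_def diff_divide_distrib)
    ultimately show ?thesis
      using assms by (auto simp: abs_mult sgn_real_def divide_right_mono)
  qed
  show "integral {0..1} (\<lambda>t. (\<delta> + \<bar>t - a\<bar>) powr (\<alpha> - 2)) \<le> 2 * \<delta> powr (\<alpha> - 1) / (1 - \<alpha>)"
    using integral_unique[OF I] bA[of "1 - a"] bA[of "0 - a"] by simp
qed

lemma integrable_abs_powr:
  fixes a \<alpha> :: real
  assumes "0 < \<alpha>"
  shows "(\<lambda>t. \<bar>t - a\<bar> powr (\<alpha> - 1)) integrable_on {0..1}"
proof -
  have dk: "((\<lambda>x. x powr \<alpha> / \<alpha>) has_real_derivative x powr (\<alpha> - 1)) (at x)" if "0 < x" for x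
    using that assms by (auto intro!: derivative_eq_intros)
  have lim: "((\<lambda>x. x powr \<alpha> / \<alpha>) \<longlongrightarrow> 0 powr \<alpha> / \<alpha>) (at_right 0)"
    using assms by (intro tendsto_intros tendsto_powr') (auto simp: eventually_at_filter)
  from has_integral_abs_shift[of "\<lambda>x. x powr \<alpha> / \<alpha>", OF dk lim, of a]
  show ?thesis by (rule has_integral_integrable)
qed

text \<open>Both \<open>1 - r\<close> and half of \<open>cmod (x - z)\<close> are at most
  \<open>cmod (x - r z)\<close>; since the chord bounds a shifted parameter distance, the kernel
  compares with \<open>(\<delta> + \<bar>t - a\<bar>) powr (\<alpha> - 2)\<close>. The constant is
  \<open>2 * 9\<close>, from \<open>2 powr \<alpha>\<close> and
  \<open>3 powr (2 - \<alpha>)\<close>, times three shifts, times the 2 of the line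
  integral.\<close>

lemma kernel_bound:
  assumes "0 < \<alpha>" "\<alpha> < 1" "z \<in> sphere 0 1" "0 \<le> r" "r < 1"
  shows "cmean (\<lambda>x. cmod (x - z) powr \<alpha> / (cmod (x - of_real r * z))\<^sup>2) \<le> 108 / (1 - \<alpha>) * (1 - r) powr (\<alpha> - 1)"
proof -
  obtain s where s: "s \<in> {0..1}" "z = cis (2 * pi * s)" using assms sphere_cisE by metis
  define \<delta> where "\<delta> = 1 - r"
  have d: "\<delta> > 0" using assms by (simp add: \<delta>_def)
  let ?k = "\<lambda>a t. (\<delta> + \<bar>t - a\<bar>) powr (\<alpha> - 2)"
  have pw: "cmod (x - z) powr \<alpha> / (cmod (x - of_real r * z))\<^sup>2 \<le> 18 * (?k s t + ?k (s-1) t + ?k (s+1) t)"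
    if t: "t \<in> {0..1}" "x = cis (2 * pi * t)" for t x
  proof -
    let ?w = "cmod (x - of_real r * z)"
    have nz: "cmod z = 1" "cmod x = 1" using assms t by auto
    have w1: "\<delta> \<le> ?w"
      using norm_triangle_ineq2[of x "of_real r * z"] nz assms by (simp add: norm_mult \<delta>_def)
    have "cmod (x - z) \<le> ?w + cmod (of_real r * z - z)" by (rule norm_triangle_sub[of "x - z" "x - of_real r * z", simplified] order_trans[OF _ norm_triangle_ineq, simplified])
    also have "of_real r * z - z = - (of_real (1 - r) * z)" by (simp add: algebra_simps)
    also have "cmod \<dots> = \<delta>" using nz assms by (simp only: norm_minus_cancel norm_mult norm_of_real \<delta>_def) auto
    finally have w2: "cmod (x - z) \<le> 2 * ?w" using w1 by simp
    have wp: "?w > 0" using d w1 by linarith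
    obtain a where a: "a \<in> {s, s - 1, s + 1}" "\<bar>t - a\<bar> \<le> cmod (x - z)"
      using sphere_dist_ge[OF s(1) t(1)] s(2) t(2) by metis
    have w3: "(\<delta> + \<bar>t - a\<bar>) / 3 \<le> ?w" using w1 order_trans[OF a(2) w2] by simp
    have "cmod (x - z) powr \<alpha> / ?w\<^sup>2 \<le> (2 * ?w) powr \<alpha> / ?w\<^sup>2"
      using w2 assms by (intro divide_right_mono powr_mono2) auto
    also have "\<dots> = 2 powr \<alpha> * ?w powr (\<alpha> - 2)"
      using wp by (simp add: powr_mult powr_diff powr_numeral)
    also have "\<dots> \<le> 2 * ((\<delta> + \<bar>t - a\<bar>) / 3) powr (\<alpha> - 2)"
    proof (intro mult_mono powr_mono2')
      show "2 powr \<alpha> \<le> (2::real)" using powr_mono[of \<alpha> 1 2] assms by simp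
    qed (use assms d w3 in auto)
    also have "\<dots> = 2 * 3 powr (2 - \<alpha>) * ?k a t"
      using d by (simp add: powr_divide powr_diff field_simps)
    also have "\<dots> \<le> 2 * 9 * ?k a t"
    proof (intro mult_right_mono mult_left_mono)
      show "3 powr (2 - \<alpha>) \<le> (9::real)" using powr_mono[of "2-\<alpha>" 2 3] assms by (simp add: powr_numeral)
    qed auto
    also have "\<dots> \<le> 18 * (?k s t + ?k (s-1) t + ?k (s+1) t)" using a(1) by (auto simp: add_increasing add_increasing2)
    finally show ?thesis .
  qed
  have int: "?k a integrable_on {0..1}" "integral {0..1} (?k a) \<le> 2 * \<delta> powr (\<alpha> - 1) / (1 - \<alpha>)" for a
    using integral_shifted_powr[OF d assms(1,2)] by auto
  have ne: "cmod x = 1 \<Longrightarrow> x \<noteq> of_real r * z" for x using assms by (auto simp: norm_mult)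
  have "cint (\<lambda>x. cmod (x - z) powr \<alpha> / (cmod (x - of_real r * z))\<^sup>2)"
    by (rule cint_continuous) (use ne assms in \<open>auto intro!: continuous_intros continuous_on_powr'\<close>)
  then have "cmean (\<lambda>x. cmod (x - z) powr \<alpha> / (cmod (x - of_real r * z))\<^sup>2)
    \<le> integral {0..1} (\<lambda>t. 18 * (?k s t + ?k (s-1) t + ?k (s+1) t))"
    unfolding cmean_def cint_def
    by (intro integral_le pw integrable_on_mult_right integrable_add int) auto
  also have "\<dots> = 18 * (integral {0..1} (?k s) + integral {0..1} (?k (s-1)) + integral {0..1} (?k (s+1)))"
    by (simp add: integral_add int integrable_add)
  also have "\<dots> \<le> 18 * (6 * \<delta> powr (\<alpha> - 1) / (1 - \<alpha>))"
  proof -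
    have *: "18 * (A + B + C) \<le> 18 * (3 * X)" if "A \<le> X" "B \<le> X" "C \<le> X" for A B C X :: real
      using that by simp
    show ?thesis using *[OF int(2)[of s] int(2)[of "s-1"] int(2)[of "s+1"]] by (simp add: mult_ac)
  qed
  finally show ?thesis by (simp add: \<delta>_def)
qed

section \<open>Hoelder estimates for Cauchy integrals\<close>

lemma radial_limit:
  assumes "continuous_on (cball 0 1) g" "a \<in> cball 0 (1::real)"
  shows "((\<lambda>r. g (of_real r * a :: complex)) \<longlongrightarrow> g a) (at_left 1)"
proof -
  have "continuous_on {0..1::real} (\<lambda>r. g (of_real r * a))"
    by (rule continuous_on_compose2[OF assms(1)])
       (use assms(2) in \<open>auto intro!: continuous_intros mult_le_one simp: norm_mult\<close>)
  then have "((\<lambda>r. g (of_real r * a)) \<longlongrightarrow> g (of_real 1 * a)) (at 1 within {0..1::real})"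
    unfolding continuous_on_def by (metis atLeastAtMost_iff order_refl zero_le_one)
  then show ?thesis by (simp add: at_within_Icc_at_left)
qed

lemma cmean_cnj: "cint f \<Longrightarrow> cmean (\<lambda>z. cnj (f z)) = cnj (cmean f)"
  by (rule cmean_linear[OF bounded_linear_cnj])

lemma eventually_at_left_1: "\<forall>\<^sub>F r in at_left (1::real). 0 < r \<and> r < 1"
  using eventually_at_left_real[of 0 "1::real"] by simp

text \<open>Go from \<open>a\<close> radially inwards by the factor \<open>1 - d\<close>, across,
  and out again to \<open>b\<close>, where \<open>d\<close> is the distance of the points. A radial
  piece costs the integral of \<open>M * (1 - s) powr (\<alpha> - 1)\<close>, that is
  \<open>M * d powr \<alpha> / \<alpha>\<close>; across, the derivative is at most
  \<open>M * d powr (\<alpha> - 1)\<close> on a length at most \<open>d\<close>.\<close>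

lemma hardy_littlewood:
  fixes f f' :: "complex \<Rightarrow> complex"
  assumes \<alpha>: "0 < \<alpha>" "\<alpha> < 1" and M: "0 \<le> M"
    and df: "\<And>z. z \<in> ball 0 1 \<Longrightarrow> (f has_field_derivative f' z) (at z)"
    and bd: "\<And>z. z \<in> ball 0 1 \<Longrightarrow> cmod (f' z) \<le> M * (1 - cmod z) powr (\<alpha> - 1)"
    and ab: "a \<in> ball 0 1" "b \<in> ball 0 1"
  shows "cmod (f a - f b) \<le> (2 / \<alpha> + 1) * M * cmod (a - b) powr \<alpha>"
proof -
  have radial: "cmod (f a - f (of_real (1 - d) * a)) \<le> M * d powr \<alpha> / \<alpha>"
    if a: "a \<in> ball 0 1" and d: "0 < d" "d \<le> 1" for a d
  proof -
    have in_ball: "of_real s * a \<in> ball 0 1" if "1 - d \<le> s" "s \<le> 1" for s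
    proof -
      have "\<bar>s\<bar> * cmod a \<le> 1 * cmod a" using that d by (intro mult_right_mono) auto
      then show ?thesis using a by (simp add: norm_mult)
    qed
    have "continuous_on (ball 0 1) f"
      using df by (meson DERIV_continuous continuous_at_imp_continuous_on)
    then have c1: "continuous_on {1 - d..1} (\<lambda>s. f (of_real s * a))"
      by (rule continuous_on_compose2) (use in_ball in \<open>auto intro!: continuous_intros\<close>)
    have c2: "continuous_on {1 - d..1} (\<lambda>s. - M * (1 - s) powr \<alpha> / \<alpha>)"
      using \<alpha> by (auto intro!: continuous_intros continuous_on_powr')
    have "norm (f (of_real 1 * a) - f (of_real (1 - d) * a))
        \<le> (- M * (1 - 1) powr \<alpha> / \<alpha>) - (- M * (1 - (1 - d)) powr \<alpha> / \<alpha>)"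
    proof (rule differentiable_bound_general[OF _ c1 c2, where f' = "\<lambda>s. a * f' (of_real s * a)"
          and \<phi>' = "\<lambda>s. M * (1 - s) powr (\<alpha> - 1)"])
      fix s assume s: "1 - d < s" "s < 1"
      have "((\<lambda>s. of_real s * a) has_vector_derivative a) (at s)"
        by (auto intro!: derivative_eq_intros)
      from field_vector_diff_chain_at[OF this df[OF in_ball]] s
      show "((\<lambda>s. f (of_real s * a)) has_vector_derivative a * f' (of_real s * a)) (at s)"
        by (simp add: o_def)
      have "((\<lambda>s. - M * (1 - s) powr \<alpha> / \<alpha>) has_real_derivative M * (1 - s) powr (\<alpha> - 1)) (at s)"
        using s \<alpha> by (auto intro!: derivative_eq_intros simp: field_simps)
      then show "((\<lambda>s. - M * (1 - s) powr \<alpha> / \<alpha>) has_vector_derivative M * (1 - s) powr (\<alpha> - 1)) (at s)"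
        by (simp add: has_real_derivative_iff_has_vector_derivative)
      have "cmod (of_real s * a) \<le> s"
        using s d a mult_left_mono[of "cmod a" 1 s] by (simp add: norm_mult)
      then have "(1 - cmod (of_real s * a)) powr (\<alpha> - 1) \<le> (1 - s) powr (\<alpha> - 1)"
        using s \<alpha> by (intro powr_mono2') auto
      then have "cmod (f' (of_real s * a)) \<le> M * (1 - s) powr (\<alpha> - 1)"
        using bd[OF in_ball[of s]] s M by (meson less_imp_le mult_left_mono order_trans)
      then show "norm (a * f' (of_real s * a)) \<le> M * (1 - s) powr (\<alpha> - 1)"
        using a mult_mono[of "cmod a" 1 "cmod (f' (of_real s * a))" "M * (1 - s) powr (\<alpha> - 1)"]
        by (simp add: norm_mult)
    qed (use d in auto)
    then show ?thesis by simp
  qed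
  \<comment> \<open>Truncation at 1 keeps the factor \<open>1 - d\<close> nonnegative; for points
    far apart both inner points are 0 and the crossing costs nothing.\<close>
  define d where "d = min (cmod (a - b)) 1"
  show ?thesis
  proof (cases "a = b")
    case False
    then have d: "0 < d" "d \<le> 1" "d \<le> cmod (a - b)" by (auto simp: d_def)
    have dp: "d powr \<alpha> \<le> cmod (a - b) powr \<alpha>" using d \<alpha> by (intro powr_mono2) auto
    have mid: "cmod (f (of_real (1 - d) * a) - f (of_real (1 - d) * b)) \<le> M * cmod (a - b) powr \<alpha>"
    proof (cases "d = 1")
      case True then show ?thesis using M by simp
    next
      case False
      then have dd: "d = cmod (a - b)" "d < 1" by (auto simp: d_def)
      have sc: "of_real (1 - d) * c \<in> cball 0 (1 - d)" if "c \<in> ball 0 1" for c :: complex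
        using that dd mult_left_mono[of "cmod c" 1 "1 - d"] d
        by (simp add: norm_mult del: of_real_diff)
      have "cmod (f (of_real (1 - d) * a) - f (of_real (1 - d) * b))
          \<le> (M * d powr (\<alpha> - 1)) * cmod (of_real (1 - d) * a - of_real (1 - d) * b)"
      proof (rule field_differentiable_bound[of "cball 0 (1 - d)" f f'])
        fix z :: complex assume z: "z \<in> cball 0 (1 - d)"
        show "(f has_field_derivative f' z) (at z within cball 0 (1 - d))"
          using df[of z] z d by (auto intro: DERIV_subset)
        have "(1 - cmod z) powr (\<alpha> - 1) \<le> d powr (\<alpha> - 1)"
          using z d \<alpha> by (intro powr_mono2') auto
        then show "cmod (f' z) \<le> M * d powr (\<alpha> - 1)"
          using bd[of z] z d M by (simp, meson mult_left_mono order_trans)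
      qed (use sc ab in auto)
      also have "cmod (of_real (1 - d) * a - of_real (1 - d) * b) \<le> d"
        using dd d mult_right_mono[of "1-d" 1 d]
        by (simp add: right_diff_distrib[symmetric] norm_mult del: of_real_diff)
      also have "M * d powr (\<alpha> - 1) * d = M * d powr \<alpha>"
        using d by (simp add: powr_diff)
      finally show ?thesis using M dd by (simp add: mult_left_mono)
    qed
    have "cmod (f a - f b) \<le> cmod (f a - f (of_real (1 - d) * a)) +
        cmod (f (of_real (1 - d) * a) - f (of_real (1 - d) * b)) + cmod (f b - f (of_real (1 - d) * b))"
    proof -
      have "cmod (p - q) \<le> cmod (p - p') + cmod (p' - q') + cmod (q - q')" for p q p' q' :: complex
        using norm_triangle_ineq[of "p - p'" "p' - q"] norm_triangle_ineq[of "p' - q'" "q' - q"]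
        by (simp add: norm_minus_commute)
      then show ?thesis .
    qed
    also have "\<dots> \<le> M * d powr \<alpha> / \<alpha> + M * cmod (a - b) powr \<alpha> + M * d powr \<alpha> / \<alpha>"
      by (intro add_mono mid radial ab d)
    also have "\<dots> \<le> M * cmod (a - b) powr \<alpha> / \<alpha> + M * cmod (a - b) powr \<alpha> + M * cmod (a - b) powr \<alpha> / \<alpha>"
      using dp M \<alpha> by (intro add_mono divide_right_mono mult_left_mono) auto
    also have "\<dots> = (2 / \<alpha> + 1) * M * cmod (a - b) powr \<alpha>" by (simp add: algebra_simps add_divide_distrib)
    finally show ?thesis .
  qed simp
qed

lemma holder_continuous_on:
  fixes f :: "'a::real_normed_vector \<Rightarrow> 'b::real_normed_vector"
  assumes "0 < \<alpha>" "\<And>x y. x \<in> S \<Longrightarrow> y \<in> S \<Longrightarrow> norm (f x - f y) \<le> K * norm (x - y) powr \<alpha>"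
  shows "uniformly_continuous_on S f"
proof -
  have "uniformly_continuous_on S f" if K: "K > 0"
    and f: "\<And>x y. x \<in> S \<Longrightarrow> y \<in> S \<Longrightarrow> norm (f x - f y) \<le> K * norm (x - y) powr \<alpha>" for K
    unfolding uniformly_continuous_on_def
  proof (intro allI impI)
    fix e :: real assume e: "0 < e"
    show "\<exists>d>0. \<forall>x\<in>S. \<forall>x'\<in>S. dist x' x < d \<longrightarrow> dist (f x') (f x) < e"
    proof (intro exI[of _ "(e / K) powr (1 / \<alpha>)"] conjI ballI impI)
      fix x x' assume x: "x \<in> S" "x' \<in> S" "dist x' x < (e / K) powr (1 / \<alpha>)"
      have "norm (x' - x) powr \<alpha> < ((e / K) powr (1 / \<alpha>)) powr \<alpha>"
        using x assms(1) by (intro powr_less_mono2) (auto simp: dist_norm)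
      also have "\<dots> = e / K" using e K assms(1) by (simp add: powr_powr)
      finally have "K * norm (x' - x) powr \<alpha> < e" using K by (simp add: field_simps)
      then show "dist (f x') (f x) < e" using f[of x' x] x by (simp add: dist_norm)
    qed (use e K in auto)
  qed
  \<comment> \<open>\<open>K\<close> may fail to be positive, whereas the modulus of continuity
    divides by it.\<close>
  moreover have "norm (f x - f y) \<le> max K 1 * norm (x - y) powr \<alpha>" if "x \<in> S" "y \<in> S" for x y
    using assms(2)[OF that] by (rule order_trans) (intro mult_right_mono; simp)
  ultimately show ?thesis using less_max_iff_disj[of 0 K 1] zero_less_one by blast
qed

lemma holder_cball:
  fixes g :: "complex \<Rightarrow> 'b::real_normed_vector"
  assumes "0 < \<alpha>" "0 \<le> K" and c: "continuous_on (cball 0 1) g"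
    and h: "\<And>x y. x \<in> ball 0 1 \<Longrightarrow> y \<in> ball 0 1 \<Longrightarrow> norm (g x - g y) \<le> K * norm (x - y) powr \<alpha>"
    and x: "x \<in> cball 0 1" "y \<in> cball 0 1"
  shows "norm (g x - g y) \<le> K * norm (x - y) powr \<alpha>"
proof (rule tendsto_upperbound)
  show "((\<lambda>r. norm (g (of_real r * x) - g (of_real r * y))) \<longlongrightarrow> norm (g x - g y)) (at_left 1)"
    by (intro tendsto_intros radial_limit c x)
  show "\<forall>\<^sub>F r in at_left (1::real). norm (g (of_real r * x) - g (of_real r * y)) \<le> K * norm (x - y) powr \<alpha>"
    using eventually_at_left_1
  proof eventually_elim
    case (elim r)
    have sc: "of_real r * u \<in> ball 0 1" if "u \<in> cball 0 1" for u :: complex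
    proof -
      have "r * cmod u \<le> r" using that elim by (simp add: mult_left_le)
      then have "r * cmod u < 1" using elim by linarith
      then show ?thesis using elim by (simp add: norm_mult)
    qed
    have "norm (g (of_real r * x) - g (of_real r * y)) \<le> K * norm (of_real r * x - of_real r * y) powr \<alpha>"
      by (intro h sc x)
    also have "\<dots> \<le> K * norm (x - y) powr \<alpha>"
      using elim assms(1,2)
      by (intro mult_left_mono powr_mono2)
         (simp_all add: right_diff_distrib[symmetric] norm_mult mult_left_le_one_le)
    finally show ?case .
  qed
qed simp

text \<open>The kernel of the differentiated Cauchy formula annihilates \<open>cnj k\<close>: on the
  circle \<open>x * cnj (k x) / (x - w)\<^sup>2\<close> is the conjugate of a function holomorphic
  in the disc and vanishing at 0. So \<open>f\<close> may be replaced by \<open>f - cnj k\<close>,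
  which is small where the kernel concentrates, and \<open>k\<close> may change with
  \<open>z\<close>.\<close>

lemma cauchy_deriv_bound:
  assumes \<alpha>: "0 < \<alpha>" "\<alpha> < 1" and f: "continuous_on (sphere 0 1) f"
    and z: "z \<in> sphere 0 1" and r: "0 \<le> r" "r < 1"
    and k: "continuous_on (cball 0 1) k" "k holomorphic_on ball 0 1"
    and bd: "\<And>x. x \<in> sphere 0 1 \<Longrightarrow> cmod (f x - cnj (k x)) \<le> M * cmod (x - z) powr \<alpha>"
  shows "cmod (cmean (\<lambda>x. x * f x / (x - of_real r * z)\<^sup>2)) \<le> 108 / (1 - \<alpha>) * M * (1 - r) powr (\<alpha> - 1)"
proof -
  let ?w = "of_real r * z"
  have M: "M \<ge> 0"
  proof -
    \<comment> \<open>The antipode of \<open>z\<close> lies at positive distance, so the hypothesis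
      itself forces the sign of \<open>M\<close>.\<close>
    have "0 \<le> M * cmod (-z - z) powr \<alpha>" using bd[of "-z"] z by (simp add: order_trans[OF norm_ge_zero])
    moreover have "-z - z \<noteq> 0" using z by auto
    ultimately show ?thesis by (simp add: zero_le_mult_iff)
  qed
  have ne: "x \<noteq> ?w" if "cmod x = 1" for x using that z r by (auto simp: norm_mult)
  have ks: "continuous_on (sphere 0 1) k" using k(1) by (rule continuous_on_subset) auto
  have ne1: "1 - cnj ?w * x \<noteq> 0" if "cmod x \<le> 1" for x
  proof
    assume "1 - cnj ?w * x = 0"
    then have "cmod (cnj ?w * x) = 1" by simp
    moreover have "cmod (cnj ?w * x) \<le> r * 1" using that z r by (simp add: norm_mult mult_left_le)
    ultimately show False using r by simp
  qed
  have zero: "cmean (\<lambda>x. x * cnj (k x) / (x - ?w)\<^sup>2) = 0"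
  proof -
    have "cmean (\<lambda>x. x * k x / (1 - cnj ?w * x)\<^sup>2) = 0 * k 0 / (1 - cnj ?w * 0)\<^sup>2"
      by (rule cmean_value)
         (use ne1 k in \<open>auto intro!: continuous_intros holomorphic_intros simp del: complex_cnj_mult\<close>)
    then have "cmean (\<lambda>x. cnj (x * k x / (1 - cnj ?w * x)\<^sup>2)) = 0"
      by (subst cmean_linear[OF bounded_linear_cnj])
         (use ne1 ks in \<open>auto intro!: continuous_intros cint_continuous simp del: complex_cnj_mult\<close>)
    also have "cmean (\<lambda>x. cnj (x * k x / (1 - cnj ?w * x)\<^sup>2)) = cmean (\<lambda>x. x * cnj (k x) / (x - ?w)\<^sup>2)"
    proof (rule cmean_cong)
      fix x :: complex assume "x \<in> sphere 0 1"
      then have n: "cmod x = 1" by simp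
      have xx: "x * cnj x = 1" using n by (simp add: complex_norm_square[symmetric])
      have "x - ?w = x * (1 - ?w * cnj x)" using xx by (simp add: algebra_simps)
      then have "x * cnj (k x) / (x - ?w)\<^sup>2 = (x * cnj (k x)) / (x\<^sup>2 * (1 - ?w * cnj x)\<^sup>2)"
        by (simp add: power_mult_distrib)
      also have "\<dots> = cnj x * cnj (k x) / (1 - ?w * cnj x)\<^sup>2"
      proof -
        have "x \<noteq> 0" "cnj x = 1 / x" using n xx by (auto simp: eq_divide_eq mult.commute)
        then show ?thesis by (simp add: power2_eq_square)
      qed
      finally show "cnj (x * k x / (1 - cnj ?w * x)\<^sup>2) = x * cnj (k x) / (x - ?w)\<^sup>2" by simp
    qed
    finally show ?thesis .
  qed
  have i1: "cint (\<lambda>x. x * f x / (x - ?w)\<^sup>2)"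
    by (rule cint_continuous) (use ne f in \<open>auto intro!: continuous_intros\<close>)
  have i2: "cint (\<lambda>x. x * cnj (k x) / (x - ?w)\<^sup>2)"
    by (rule cint_continuous) (use ne ks in \<open>auto intro!: continuous_intros\<close>)
  have "cmean (\<lambda>x. x * f x / (x - ?w)\<^sup>2) = cmean (\<lambda>x. x * f x / (x - ?w)\<^sup>2 - x * cnj (k x) / (x - ?w)\<^sup>2)"
    using cmean_diff[OF i1 i2] zero by simp
  also have "cmod \<dots> \<le> cmean (\<lambda>x. M * (cmod (x - z) powr \<alpha> / (cmod (x - ?w))\<^sup>2))"
  proof (rule cmean_norm_le)
    show "cint (\<lambda>x. x * f x / (x - ?w)\<^sup>2 - x * cnj (k x) / (x - ?w)\<^sup>2)" using i1 i2 by (rule cint_diff)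
    show "cint (\<lambda>x. M * (cmod (x - z) powr \<alpha> / (cmod (x - ?w))\<^sup>2))"
      by (rule cint_continuous) (use ne \<alpha> in \<open>auto intro!: continuous_intros continuous_on_powr'\<close>)
    fix x :: complex assume x: "x \<in> sphere 0 1"
    have "x * f x / (x - ?w)\<^sup>2 - x * cnj (k x) / (x - ?w)\<^sup>2 = x * (f x - cnj (k x)) / (x - ?w)\<^sup>2"
      by (simp add: right_diff_distrib diff_divide_distrib)
    also have "cmod \<dots> = cmod (f x - cnj (k x)) / (cmod (x - ?w))\<^sup>2"
      using x by (simp add: norm_mult norm_divide norm_power)
    also have "\<dots> \<le> (M * cmod (x - z) powr \<alpha>) / (cmod (x - ?w))\<^sup>2"
      using bd[OF x] by (rule divide_right_mono) simp
    finally show "cmod (x * f x / (x - ?w)\<^sup>2 - x * cnj (k x) / (x - ?w)\<^sup>2)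
       \<le> M * (cmod (x - z) powr \<alpha> / (cmod (x - ?w))\<^sup>2)" by simp
  qed
  also have "\<dots> = M * cmean (\<lambda>x. cmod (x - z) powr \<alpha> / (cmod (x - ?w))\<^sup>2)"
    by (rule cmean_linear[OF bounded_linear_mult_right])
       (rule cint_continuous, use ne \<alpha> in \<open>auto intro!: continuous_intros continuous_on_powr'\<close>)
  also have "\<dots> \<le> M * (108 / (1 - \<alpha>) * (1 - r) powr (\<alpha> - 1))"
    using kernel_bound[OF \<alpha> z r] M by (rule mult_left_mono)
  finally show ?thesis by (simp add: mult_ac)
qed

lemma ball_polarE:
  assumes "w \<in> ball 0 (1::real)"
  obtains r z where "z \<in> sphere 0 1" "0 \<le> r" "r < 1" "(w::complex) = of_real r * z" "cmod w = r"
proof (cases "w = 0")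
  case True then show ?thesis using that[of 1 0] by simp
next
  case False
  then show ?thesis using that[of "sgn w" "cmod w"] assms
    by (auto simp: norm_sgn) (simp add: sgn_div_norm scaleR_conv_of_real divide_inverse)
qed

lemma cauchy_holder_ball:
  assumes \<alpha>: "0 < \<alpha>" "\<alpha> < 1" and f: "continuous_on (sphere 0 1) f" and M: "0 \<le> M"
    and bd: "\<And>z r. z \<in> sphere 0 1 \<Longrightarrow> 0 \<le> r \<Longrightarrow> r < 1 \<Longrightarrow>
       cmod (cmean (\<lambda>x. x * f x / (x - of_real r * z)\<^sup>2)) \<le> M * (1 - r) powr (\<alpha> - 1)"
    and ab: "a \<in> ball 0 1" "b \<in> ball 0 1"
  shows "cmod (cmean (\<lambda>x. x * f x / (x - a)) - cmean (\<lambda>x. x * f x / (x - b)))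
    \<le> (2 / \<alpha> + 1) * M * cmod (a - b) powr \<alpha>"
proof (rule hardy_littlewood[OF \<alpha> M _ _ ab])
  fix w :: complex assume w: "w \<in> ball 0 1"
  then show "((\<lambda>a. cmean (\<lambda>x. x * f x / (x - a))) has_field_derivative cmean (\<lambda>x. x * f x / (x - w)\<^sup>2)) (at w)"
    by (intro Cauchy_transform_deriv f) auto
  from w obtain r z where "z \<in> sphere 0 1" "0 \<le> r" "r < 1" "w = of_real r * z" "cmod w = r"
    by (rule ball_polarE)
  then show "cmod (cmean (\<lambda>x. x * f x / (x - w)\<^sup>2)) \<le> M * (1 - cmod w) powr (\<alpha> - 1)"
    using bd[of z r] by simp
qed

lemma holomorphic_holder_cball:
  assumes \<alpha>: "0 < \<alpha>" "\<alpha> < 1" and M: "0 \<le> M"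
    and f: "continuous_on (cball 0 1) f" "f holomorphic_on ball 0 1"
    and bd: "\<And>z r. z \<in> sphere 0 1 \<Longrightarrow> 0 \<le> r \<Longrightarrow> r < 1 \<Longrightarrow>
       cmod (cmean (\<lambda>x. x * f x / (x - of_real r * z)\<^sup>2)) \<le> M * (1 - r) powr (\<alpha> - 1)"
    and ab: "a \<in> cball 0 1" "b \<in> cball 0 1"
  shows "cmod (f a - f b) \<le> (2 / \<alpha> + 1) * M * cmod (a - b) powr \<alpha>"
proof (rule holder_cball[OF \<alpha>(1) _ f(1) _ ab])
  fix x y :: complex assume xy: "x \<in> ball 0 1" "y \<in> ball 0 1"
  have fs: "continuous_on (sphere 0 1) f" using f(1) by (rule continuous_on_subset) auto
  show "cmod (f x - f y) \<le> (2 / \<alpha> + 1) * M * cmod (x - y) powr \<alpha>"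
    using cauchy_holder_ball[OF \<alpha> fs M bd xy] cmean_Cauchy[OF f] xy by simp
qed (use \<alpha> M in simp)

text \<open>With the constant \<open>cnj (f z)\<close> as comparison function, the Hoelder condition
  on \<open>f\<close> makes the Cauchy transform Hoelder in the open disc; uniform continuity
  extends it to the closed disc. Its boundary values are a projection of \<open>f\<close>, in
  general not \<open>f\<close>.\<close>

lemma cauchy_extend:
  assumes \<alpha>: "0 < \<alpha>" "\<alpha> < 1" and K: "0 \<le> K"
    and f: "\<And>x y. x \<in> sphere 0 1 \<Longrightarrow> y \<in> sphere 0 1 \<Longrightarrow> cmod (f x - f y) \<le> K * cmod (x - y) powr \<alpha>"
  obtains g where "continuous_on (cball 0 1) g" "g holomorphic_on ball 0 1"
    "\<And>w. w \<in> ball 0 1 \<Longrightarrow> g w = cmean (\<lambda>x. x * f x / (x - w))"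
proof -
  have fs: "continuous_on (sphere 0 1) f"
    by (rule uniformly_continuous_imp_continuous, rule holder_continuous_on[OF \<alpha>(1) f])
  let ?g = "\<lambda>w. cmean (\<lambda>x. x * f x / (x - w))"
  define M where "M = 108 / (1 - \<alpha>) * K"
  have "cmod (?g a - ?g b) \<le> (2 / \<alpha> + 1) * M * cmod (a - b) powr \<alpha>" if "a \<in> ball 0 1" "b \<in> ball 0 1" for a b
    unfolding M_def
    by (rule cauchy_holder_ball[OF \<alpha> fs _ _ that], use \<alpha> K in simp)
       (rule cauchy_deriv_bound[OF \<alpha> fs, where k="\<lambda>x. cnj (f z)" for z], use f in auto)
  then have "uniformly_continuous_on (ball 0 1) ?g" by (rule holder_continuous_on[OF \<alpha>(1)])
  then obtain g where "uniformly_continuous_on (closure (ball 0 1)) g"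
      and g2: "\<And>x. x \<in> ball 0 1 \<Longrightarrow> ?g x = g x"
    by (rule uniformly_continuous_on_extension_on_closure) blast
  then have g: "uniformly_continuous_on (cball 0 1) g" "\<And>x. x \<in> ball 0 1 \<Longrightarrow> ?g x = g x"
    by auto
  have "?g holomorphic_on ball 0 1"
    unfolding holomorphic_on_open[OF open_ball]
    by (intro ballI exI, rule Cauchy_transform_deriv[OF fs]) simp
  then have "g holomorphic_on ball 0 1" using holomorphic_transform g(2) by blast
  then show ?thesis using that[of g] g uniformly_continuous_imp_continuous by auto
qed

section \<open>Splitting Hoelder data into holomorphic and antiholomorphic boundary values\<close>

lemma poisson_kernel_eq:
  assumes "cmod x = 1" "cmod w = r" "x \<noteq> w"
  shows "x / (x - w) + cnj x / (cnj x - cnj w) - 1 = of_real ((1 - r\<^sup>2) / (cmod (x - w))\<^sup>2)"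
proof -
  have xx: "x * cnj x = 1" using assms by (simp add: complex_norm_square[symmetric])
  have ww: "w * cnj w = of_real (r\<^sup>2)" using assms(2) by (metis complex_norm_square)
  have n1: "x - w \<noteq> 0" "cnj x - cnj w \<noteq> 0" using assms(3) by auto
  have "x / (x - w) + cnj x / (cnj x - cnj w) - 1
      = (x * (cnj x - cnj w) + cnj x * (x - w) - (x - w) * (cnj x - cnj w)) / ((x - w) * (cnj x - cnj w))"
    using n1 by (simp add: divide_simps)
  also have "x * (cnj x - cnj w) + cnj x * (x - w) - (x - w) * (cnj x - cnj w) = x * cnj x - w * cnj w"
    by (simp add: algebra_simps)
  also have "\<dots> = of_real (1 - r\<^sup>2)" using xx ww by simp
  also have "(x - w) * (cnj x - cnj w) = of_real ((cmod (x - w))\<^sup>2)"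
    by (metis complex_cnj_diff complex_norm_square)
  finally show ?thesis by simp
qed

text \<open>\<open>p\<close> and \<open>q\<close> are the Cauchy transforms of \<open>F\<close> and
  of its conjugate, the constant term being removed from \<open>q\<close> since it would occur
  twice. In the disc \<open>p + cnj q\<close> is the Poisson integral of \<open>F\<close>, because
  the Poisson kernel is the Cauchy kernel plus its conjugate minus 1; the boundary identity follows
  as \<open>r\<close> tends to 1.\<close>

lemma holder_decomposition:
  assumes \<alpha>: "0 < \<alpha>" "\<alpha> < 1" and K: "0 \<le> K"
    and F: "\<And>x y. x \<in> sphere 0 1 \<Longrightarrow> y \<in> sphere 0 1 \<Longrightarrow> cmod (F x - F y) \<le> K * cmod (x - y) powr \<alpha>"
  obtains p q where "continuous_on (cball 0 1) p" "p holomorphic_on ball 0 1"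
    "continuous_on (cball 0 1) q" "q holomorphic_on ball 0 1" "q 0 = 0"
    "\<And>x. x \<in> sphere 0 1 \<Longrightarrow> F x = p x + cnj (q x)"
proof -
  have Fs: "continuous_on (sphere 0 1) F"
    by (rule uniformly_continuous_imp_continuous, rule holder_continuous_on[of \<alpha> _ F K, OF \<alpha>(1) F])
  obtain p where p: "continuous_on (cball 0 1) p" "p holomorphic_on ball 0 1"
    "\<And>w. w \<in> ball 0 1 \<Longrightarrow> p w = cmean (\<lambda>x. x * F x / (x - w))"
    using cauchy_extend[of \<alpha> K F, OF \<alpha> K F] by auto
  have F': "cmod (cnj (F x) - cnj (F y)) \<le> K * cmod (x - y) powr \<alpha>" if "x \<in> sphere 0 1" "y \<in> sphere 0 1" for x y
    using F[OF that] by (metis complex_cnj_diff complex_mod_cnj)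
  obtain q0 where q0: "continuous_on (cball 0 1) q0" "q0 holomorphic_on ball 0 1"
    "\<And>w. w \<in> ball 0 1 \<Longrightarrow> q0 w = cmean (\<lambda>x. x * cnj (F x) / (x - w))"
    using cauchy_extend[of \<alpha> K "\<lambda>x. cnj (F x)", OF \<alpha> K F'] by auto
  define q where "q = (\<lambda>w. q0 w - cmean (\<lambda>x. cnj (F x)))"
  have q: "continuous_on (cball 0 1) q" "q holomorphic_on ball 0 1" "q 0 = 0"
  proof -
    have "cmean (\<lambda>x. x * cnj (F x) / (x - 0)) = cmean (\<lambda>x. cnj (F x))"
      by (rule cmean_cong) auto
    then show "q 0 = 0" using q0(3)[of 0] by (simp add: q_def)
  qed (use q0 in \<open>auto simp: q_def intro!: continuous_intros holomorphic_intros\<close>)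
  have main: "F z = p z + cnj (q z)" if z: "z \<in> sphere 0 1" for z
  proof -
    \<comment> \<open>Constants are reproduced, so \<open>F z\<close> can be subtracted. The Poisson
      kernel then meets a density of size \<open>cmod (x - z) powr \<alpha>\<close>, and
      \<open>1 - r\<^sup>2 \<le> 2 * (1 - r)\<close> doubles 108 to 216.\<close>
    define G where "G x = F x - F z" for x
    have Gs: "continuous_on (sphere 0 1) G" unfolding G_def by (intro continuous_intros Fs)
    have est: "cmod (p (of_real r * z) + cnj (q (of_real r * z)) - F z) \<le> 216 / (1 - \<alpha>) * K * (1 - r) powr \<alpha>"
      if r: "0 < r" "r < 1" for r
    proof -
      let ?w = "of_real r * z"
      have wb: "?w \<in> ball 0 1" using z r by (simp add: norm_mult)
      have ne: "x \<noteq> ?w" if "cmod x = 1" for x using that z r by (auto simp: norm_mult)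
      have nec: "cnj x \<noteq> of_real r * cnj z" if "cmod x = 1" for x
        using ne[OF that] by (metis complex_cnj_cancel_iff complex_cnj_complex_of_real complex_cnj_mult)
      have c1: "cmean (\<lambda>x. x * c / (x - ?w)) = c" for c
        using cmean_Cauchy[of "\<lambda>x. c" ?w] wb by simp
      have ci: "cint (\<lambda>x. x * h x / (x - ?w))" if "continuous_on (sphere 0 1) h" for h
        by (rule cint_continuous) (use that ne in \<open>auto intro!: continuous_intros\<close>)
      have pG: "p ?w = cmean (\<lambda>x. x * G x / (x - ?w)) + F z"
      proof -
        have "cmean (\<lambda>x. x * G x / (x - ?w)) = cmean (\<lambda>x. x * F x / (x - ?w) - x * F z / (x - ?w))"
          by (rule cmean_cong) (simp add: G_def algebra_simps diff_divide_distrib)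
        also have "\<dots> = p ?w - F z"
          using p(3)[OF wb] c1 cmean_diff[OF ci[OF Fs] ci[OF continuous_on_const]] by simp
        finally show ?thesis by simp
      qed
      have qG: "q ?w = cmean (\<lambda>x. x * cnj (G x) / (x - ?w)) - cmean (\<lambda>x. cnj (G x))"
      proof -
        have "cmean (\<lambda>x. x * cnj (G x) / (x - ?w)) = cmean (\<lambda>x. x * cnj (F x) / (x - ?w) - x * cnj (F z) / (x - ?w))"
          by (rule cmean_cong) (simp add: G_def algebra_simps diff_divide_distrib)
        also have "\<dots> = q0 ?w - cnj (F z)"
          using q0(3)[OF wb] c1
            cmean_diff[OF ci[OF continuous_on_cnj[OF Fs]] ci[OF continuous_on_const]] by simp
        finally have 1: "cmean (\<lambda>x. x * cnj (G x) / (x - ?w)) = q0 ?w - cnj (F z)" .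
        have "cmean (\<lambda>x. cnj (G x)) = cmean (\<lambda>x. cnj (F x) - cnj (F z))" by (simp add: G_def)
        also have "\<dots> = cmean (\<lambda>x. cnj (F x)) - cnj (F z)"
          using cmean_diff[OF cint_continuous[OF continuous_on_cnj[OF Fs]] cint_continuous[OF continuous_on_const]]
          by simp
        finally show ?thesis using 1 by (simp add: q_def)
      qed
      have "cnj (q ?w) = cmean (\<lambda>x. cnj (x * cnj (G x) / (x - ?w))) - cmean (\<lambda>x. G x)"
        using cmean_cnj[OF ci[OF continuous_on_cnj[OF Gs]]]
          cmean_cnj[OF cint_continuous[OF continuous_on_cnj[OF Gs]]]
        unfolding qG complex_cnj_diff by simp
      then have "p ?w + cnj (q ?w) - F z =
          cmean (\<lambda>x. x * G x / (x - ?w)) + cmean (\<lambda>x. cnj (x * cnj (G x) / (x - ?w))) - cmean (\<lambda>x. G x)"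
        using pG by simp
      also have "\<dots> = cmean (\<lambda>x. x * G x / (x - ?w) + cnj (x * cnj (G x) / (x - ?w)) - G x)"
      proof -
        have i: "cint (\<lambda>x. x * G x / (x - ?w))" "cint (\<lambda>x. cnj (x * cnj (G x) / (x - ?w)))" "cint G"
          "cint (\<lambda>x. x * G x / (x - ?w) + cnj (x * cnj (G x) / (x - ?w)))"
          using ne nec by (auto intro!: cint_continuous continuous_intros Gs)
        show ?thesis using cmean_add[OF i(1,2)] cmean_diff[OF i(4,3)] by simp
      qed
      also have "cmod \<dots> \<le> cmean (\<lambda>x. 2 * (1 - r) * K * (cmod (x - z) powr \<alpha> / (cmod (x - ?w))\<^sup>2))"
      proof (rule cmean_norm_le)
        show "cint (\<lambda>x. x * G x / (x - ?w) + cnj (x * cnj (G x) / (x - ?w)) - G x)"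
          using ne nec by (auto intro!: cint_continuous continuous_intros Gs)
        show "cint (\<lambda>x. 2 * (1 - r) * K * (cmod (x - z) powr \<alpha> / (cmod (x - ?w))\<^sup>2))"
          using ne \<alpha> by (auto intro!: cint_continuous continuous_intros continuous_on_powr')
        fix x :: complex assume x: "x \<in> sphere 0 1"
        have wr: "cmod ?w = r" using z r by (simp add: norm_mult)
        have "x * G x / (x - ?w) + cnj (x * cnj (G x) / (x - ?w)) - G x
            = x * G x / (x - ?w) + cnj x * G x / (cnj x - cnj ?w) - G x"
          by simp
        also have "\<dots> = G x * (x / (x - ?w) + cnj x / (cnj x - cnj ?w) - 1)"
          by (simp add: distrib_left right_diff_distrib mult_ac)
        also have "\<dots> = G x * of_real ((1 - r\<^sup>2) / (cmod (x - ?w))\<^sup>2)"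
          using poisson_kernel_eq[OF _ wr ne] x by simp
        finally have "cmod (x * G x / (x - ?w) + cnj (x * cnj (G x) / (x - ?w)) - G x)
            = cmod (G x) * \<bar>(1 - r\<^sup>2) / (cmod (x - ?w))\<^sup>2\<bar>"
          by (simp only: norm_mult norm_of_real)
        also have "\<bar>(1 - r\<^sup>2) / (cmod (x - ?w))\<^sup>2\<bar> = (1 - r\<^sup>2) / (cmod (x - ?w))\<^sup>2"
          using r by (intro abs_of_nonneg divide_nonneg_nonneg) (simp_all add: power_le_one)
        also have "cmod (G x) * ((1 - r\<^sup>2) / (cmod (x - ?w))\<^sup>2)
            \<le> (K * cmod (x - z) powr \<alpha>) * ((2 * (1 - r)) / (cmod (x - ?w))\<^sup>2)"
        proof (intro mult_mono divide_right_mono)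
          have "1 - r^2 = (1 + r) * (1 - r)" by (simp add: algebra_simps power2_eq_square)
          also have "\<dots> \<le> 2 * (1 - r)" using r by (intro mult_right_mono) auto
          finally show "1 - r^2 \<le> 2 * (1 - r)" .
          show "0 \<le> (1 - r^2) / (cmod (x - ?w))\<^sup>2" using r by (simp add: power_le_one)
        qed (use F[OF x z] K in \<open>auto simp: G_def\<close>)
        finally show "cmod (x * G x / (x - ?w) + cnj (x * cnj (G x) / (x - ?w)) - G x)
           \<le> 2 * (1 - r) * K * (cmod (x - z) powr \<alpha> / (cmod (x - ?w))\<^sup>2)" by (simp add: mult_ac)
      qed
      also have "\<dots> = 2 * (1 - r) * K * cmean (\<lambda>x. cmod (x - z) powr \<alpha> / (cmod (x - ?w))\<^sup>2)"
        by (rule cmean_linear[OF bounded_linear_mult_right])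
           (rule cint_continuous, use ne \<alpha> in \<open>auto intro!: continuous_intros continuous_on_powr'\<close>)
      also have "\<dots> \<le> 2 * (1 - r) * K * (108 / (1 - \<alpha>) * (1 - r) powr (\<alpha> - 1))"
        using kernel_bound[OF \<alpha> z, of r] r K by (intro mult_left_mono) auto
      also have "\<dots> = 216 / (1 - \<alpha>) * K * ((1 - r) * (1 - r) powr (\<alpha> - 1))" by simp
      also have "(1 - r) * (1 - r) powr (\<alpha> - 1) = (1 - r) powr \<alpha>" using r by (simp add: powr_diff)
      finally show ?thesis .
    qed
    have lim: "((\<lambda>r. cmod (p (of_real r * z) + cnj (q (of_real r * z)) - F z)) \<longlongrightarrow> cmod (p z + cnj (q z) - F z)) (at_left 1)"
      using z by (intro tendsto_intros radial_limit p q) auto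
    have lim0: "((\<lambda>r. 216 / (1 - \<alpha>) * K * (1 - r) powr \<alpha>) \<longlongrightarrow> 216 / (1 - \<alpha>) * K * (1 - 1) powr \<alpha>) (at_left 1)"
      using \<alpha> by (intro tendsto_intros tendsto_powr') (auto simp: eventually_at_filter)
    have "cmod (p z + cnj (q z) - F z) \<le> 216 / (1 - \<alpha>) * K * (1 - 1) powr \<alpha>"
      by (rule tendsto_le[OF _ lim0 lim]) (use eventually_mono[OF eventually_at_left_1] est in auto)
    then show ?thesis by simp
  qed
  show ?thesis using that[OF p(1,2) q main] .
qed

section \<open>The a priori estimate\<close>

text \<open>One constant for supremum and seminorm, the latter in chordal distance: this is the ball
  of radius \<open>K\<close> for the larger of the two.\<close>

definition holder_bound :: "real \<Rightarrow> real \<Rightarrow> (complex \<Rightarrow> 'a::real_normed_vector) \<Rightarrow> bool" where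
  "holder_bound \<alpha> K F \<longleftrightarrow> (\<forall>x\<in>sphere 0 1. norm (F x) \<le> K) \<and>
     (\<forall>x\<in>sphere 0 1. \<forall>y\<in>sphere 0 1. norm (F x - F y) \<le> K * norm (x - y) powr \<alpha>)"

text \<open>Bilinear, without conjugation, so that pairing two holomorphic maps gives a holomorphic
  function.\<close>

definition bdot :: "complex ^ 'n \<Rightarrow> complex ^ 'n \<Rightarrow> complex" where
  "bdot v w = (\<Sum>i\<in>UNIV. v $ i * w $ i)"

lemma norm_bdot_le: "norm (bdot v w) \<le> norm v * norm w"
proof -
  have "norm (bdot v w) \<le> (\<Sum>i\<in>UNIV. \<bar>norm (v $ i)\<bar> * \<bar>norm (w $ i)\<bar>)"
    unfolding bdot_def by (rule order_trans[OF norm_sum]) (simp add: norm_mult)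
  also have "\<dots> \<le> norm v * norm w" unfolding norm_vec_def by (rule L2_set_mult_ineq)
  finally show ?thesis .
qed

lemma bounded_bilinear_bdot: "bounded_bilinear (bdot :: complex ^ 'n \<Rightarrow> _)"
proof
  show "\<exists>K. \<forall>a b :: complex ^ 'n. norm (bdot a b) \<le> norm a * norm b * K"
    by (rule exI[of _ 1]) (simp add: norm_bdot_le)
qed (auto simp: bdot_def algebra_simps sum.distrib scaleR_sum_right)

lemma norm_matrix_vector_le: "norm ((A :: complex ^ 'n ^ 'm) *v x) \<le> norm A * norm x"
proof -
  have "norm (A *v x) = L2_set (\<lambda>i. norm (bdot (A $ i) x)) UNIV"
    unfolding norm_vec_def[of "A *v x"] by (simp add: matrix_vector_mult_def bdot_def)
  also have "\<dots> \<le> L2_set (\<lambda>i. norm (A $ i) * norm x) UNIV"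
    by (rule L2_set_mono) (auto simp: norm_bdot_le)
  also have "\<dots> = norm A * norm x"
    unfolding norm_vec_def[of A] by (rule L2_set_left_distrib[symmetric]) simp
  finally show ?thesis .
qed

lemma bounded_bilinear_matrix_vector:
  "bounded_bilinear ((*v) :: complex ^ 'n ^ 'm \<Rightarrow> complex ^ 'n \<Rightarrow> complex ^ 'm)"
proof
  show "\<exists>K. \<forall>(a :: complex ^ 'n ^ 'm) b. norm (a *v b) \<le> norm a * norm b * K"
    by (rule exI[of _ 1]) (simp add: norm_matrix_vector_le)
qed (auto simp: algebra_simps matrix_vector_mult_def vec_eq_iff scaleR_sum_right sum.distrib)

lemma vcnj_simps [simp]: "vcnj v $ i = cnj (v $ i)" "vcnj (vcnj v) = v" "vcnj 0 = 0"
  "vcnj (v + w) = vcnj v + vcnj w" "vcnj (v - w) = vcnj v - vcnj w" "vcnj (r *\<^sub>R v) = r *\<^sub>R vcnj v"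
  by (simp_all add: vcnj_def vec_eq_iff)

lemma norm_vcnj [simp]: "norm (vcnj v) = norm v"
  by (simp add: norm_vec_def)

lemma bounded_linear_vcnj: "bounded_linear vcnj"
  by (rule bounded_linear_intro[where K = 1]) auto

lemmas continuous_on_matrix_vector [continuous_intros] =
  bounded_bilinear.continuous_on[OF bounded_bilinear_matrix_vector]
lemmas continuous_on_bdot [continuous_intros] =
  bounded_bilinear.continuous_on[OF bounded_bilinear_bdot]
lemmas continuous_on_vcnj [continuous_intros] =
  bounded_linear.continuous_on[OF bounded_linear_vcnj]

lemma norm_vec_le_sum: "norm (v :: 'a::real_normed_vector ^ 'n) \<le> (\<Sum>i\<in>UNIV. norm (v $ i))"
  unfolding norm_vec_def by (rule L2_set_le_sum) simp

lemma norm_vec_le_card: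
  assumes "\<And>i. norm ((v :: 'a::real_normed_vector ^ 'n) $ i) \<le> B"
  shows "norm v \<le> real CARD('n) * B"
  using norm_vec_le_sum[of v] sum_bounded_above[of UNIV "\<lambda>i. norm (v $ i)" B] assms by simp

lemma holder_bound_continuous:
  assumes "0 < \<alpha>" "holder_bound \<alpha> K F" shows "continuous_on (sphere 0 1) F"
  using assms unfolding holder_bound_def
  by (intro uniformly_continuous_imp_continuous holder_continuous_on[of \<alpha> _ F K]) auto

lemma holder_bound_nonneg: "holder_bound \<alpha> K F \<Longrightarrow> 0 \<le> K"
  unfolding holder_bound_def by (meson cis_in_sphere norm_ge_zero order_trans)

lemma holder_bound_mono:
  assumes "holder_bound \<alpha> K F" "K \<le> L" shows "holder_bound \<alpha> L F"
  using assms unfolding holder_bound_def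
  by (meson mult_right_mono order_trans powr_ge_zero)

lemma holder_bound_add:
  assumes "holder_bound \<alpha> K F" "holder_bound \<alpha> L G"
  shows "holder_bound \<alpha> (K + L) (\<lambda>x. F x + G x)"
proof -
  have "norm (a + b - (c + d)) \<le> (K + L) * u"
    if "norm (a - c) \<le> K * u" "norm (b - d) \<le> L * u" for a b c d :: 'a and u
    using norm_triangle_ineq[of "a - c" "b - d"] that by (simp add: algebra_simps)
  then show ?thesis using assms unfolding holder_bound_def by (auto intro: norm_triangle_mono)
qed

lemma holder_bound_linear:
  assumes "holder_bound \<alpha> K F" "bounded_linear h" "\<And>x. norm (h x) \<le> B * norm x" "0 \<le> B"
  shows "holder_bound \<alpha> (B * K) (\<lambda>x. h (F x))"
proof -
  interpret h: bounded_linear h by fact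
  have "norm (h a) \<le> B * L" if "norm a \<le> L" for a L
    using assms(3)[of a] that assms(4) by (meson mult_left_mono order_trans)
  then show ?thesis using assms(1) unfolding holder_bound_def by (auto simp: mult.assoc simp flip: h.diff)
qed

lemma holder_bound_bilinear:
  assumes b: "bounded_bilinear b" "\<And>x y. norm (b x y) \<le> norm x * norm y"
    and F: "holder_bound \<alpha> K F" and G: "holder_bound \<alpha> L G"
  shows "holder_bound \<alpha> (2 * K * L) (\<lambda>x. b (F x) (G x))"
proof -
  interpret b: bounded_bilinear b by fact
  note nn = holder_bound_nonneg[OF F] holder_bound_nonneg[OF G]
  have bn: "norm (b x y) \<le> k * l" if "norm x \<le> k" "norm y \<le> l" for x y k l
    using b(2)[of x y] that by (meson mult_mono norm_ge_zero order_trans)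
  have "norm (b (F x) (G x)) \<le> 2 * K * L" if "x \<in> sphere 0 1" for x
  proof -
    have "norm (b (F x) (G x)) \<le> K * L" using F G that unfolding holder_bound_def by (intro bn) auto
    also have "\<dots> \<le> 2 * (K * L)" using nn by simp
    finally show ?thesis by simp
  qed
  moreover have "norm (b (F x) (G x) - b (F y) (G y)) \<le> 2 * K * L * norm (x - y) powr \<alpha>"
    if x: "x \<in> sphere 0 1" "y \<in> sphere 0 1" for x y
  proof -
    let ?u = "norm (x - y) powr \<alpha>"
    have "b (F x) (G x) - b (F y) (G y) = b (F x - F y) (G x) + b (F y) (G x - G y)"
      by (simp add: b.diff_left b.diff_right)
    also have "norm \<dots> \<le> (K * ?u) * L + K * (L * ?u)"
      using F G x unfolding holder_bound_def by (intro norm_triangle_mono bn) auto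
    finally show ?thesis by (simp add: algebra_simps)
  qed
  ultimately show ?thesis unfolding holder_bound_def by blast
qed

text \<open>The modulus of the \<open>S\<close> term is controlled as well: replacing
  \<open>v\<close> by \<open>c *s v\<close> with \<open>cmod c = 1\<close> fixes the
  \<open>H\<close> term and rotates the \<open>S\<close> term. Being linear in \<open>H\<close> and
  \<open>S\<close>, the condition survives convex combinations.\<close>

definition energy :: "real \<Rightarrow> (complex \<Rightarrow> complex ^ 'n ^ 'n) \<Rightarrow> (complex \<Rightarrow> complex ^ 'n ^ 'n) \<Rightarrow> bool" where
  "energy \<epsilon> H S \<longleftrightarrow> (\<forall>x\<in>sphere 0 1. \<forall>v. \<epsilon> * (norm v)\<^sup>2 \<le> Re (bdot v (H x *v vcnj v + S x *v v)))"

lemma bdot_add_right: "bdot v (w + u) = bdot v w + bdot v u"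
  by (simp add: bdot_def algebra_simps sum.distrib)

lemma bdot_diff_right: "bdot v (w - u) = bdot v w - bdot v u"
  by (simp add: bdot_def algebra_simps sum_subtractf)

lemma bdot_scale: "bdot (c *s v) w = c * bdot v w" "bdot v (c *s w) = c * bdot v w"
  by (simp_all add: bdot_def sum_distrib_left mult_ac)

lemma energy_inverse:
  fixes H S :: "complex \<Rightarrow> complex ^ 'n ^ 'n"
  assumes e: "energy \<epsilon> H S" "0 < \<epsilon>" and x: "x \<in> sphere 0 1"
  obtains A where "\<And>w. A *v (H x *v w) = w" "\<And>w. norm (A *v w) \<le> norm w / \<epsilon>"
proof -
  have lower: "\<epsilon> * norm w \<le> norm (H x *v w)" for w
  proof (cases "w = 0")
    case False
    define v where "v = vcnj w"
    have w: "w = vcnj v" by (simp add: v_def)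
    have "\<epsilon> * (norm v)\<^sup>2 \<le> Re (bdot v (H x *v vcnj v + S x *v v))"
      using e x unfolding energy_def by blast
    \<comment> \<open>Multiplying \<open>v\<close> by \<open>\<i>\<close> changes the sign of the
      \<open>S\<close> term only. The average of the two inequalities makes \<open>H x\<close> alone
      coercive, hence invertible with inverse of norm at most \<open>1 / \<epsilon>\<close>.\<close>
    moreover have "\<epsilon> * (norm v)\<^sup>2 \<le> Re (bdot v (H x *v vcnj v) - bdot v (S x *v v))"
    proof -
      have c: "vcnj (\<i> *s v) = (- \<i>) *s vcnj v" by (simp add: vec_eq_iff)
      have "bdot (\<i> *s v) (H x *v vcnj (\<i> *s v) + S x *v (\<i> *s v)) = bdot v (H x *v vcnj v) - bdot v (S x *v v)"
        unfolding c vector_scalar_commute bdot_add_right bdot_scale by simp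
      moreover have "norm (\<i> *s v) = norm v" by (simp add: norm_vec_def norm_mult)
      moreover have "\<epsilon> * (norm (\<i> *s v))\<^sup>2 \<le> Re (bdot (\<i> *s v) (H x *v vcnj (\<i> *s v) + S x *v (\<i> *s v)))"
        using e x unfolding energy_def by blast
      ultimately show ?thesis by simp
    qed
    ultimately have "\<epsilon> * (norm v)\<^sup>2 \<le> Re (bdot v (H x *v vcnj v))"
      by (simp add: bdot_add_right)
    also have "\<dots> \<le> norm v * norm (H x *v w)"
      using complex_Re_le_cmod norm_bdot_le order_trans unfolding w by blast
    finally have "norm w * (\<epsilon> * norm w) \<le> norm w * norm (H x *v w)"
      by (simp add: w power2_eq_square mult_ac)
    then show ?thesis using False by simp
  qed simp
  have "inj ((*v) (H x))"
  proof (rule injI)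
    fix u w assume "H x *v u = H x *v w"
    then have "\<epsilon> * norm (u - w) \<le> 0" using lower[of "u - w"] by (simp add: matrix_vector_mult_diff_distrib)
    then show "u = w" using e(2) by (simp add: mult_le_0_iff)
  qed
  then obtain A where A: "A ** H x = mat 1" using matrix_left_invertible_injective[of "H x"] by blast
  then have A': "H x ** A = mat 1" using matrix_left_right_inverse by blast
  show ?thesis
  proof (rule that[of A])
    show "A *v (H x *v w) = w" for w by (simp add: matrix_vector_mul_assoc A)
    show "norm (A *v w) \<le> norm w / \<epsilon>" for w
      using lower[of "A *v w"] e(2) by (simp add: matrix_vector_mul_assoc A' field_simps)
  qed
qed

lemma holo_disc_component:
  assumes "holo_disc G"
  shows "continuous_on (cball 0 1) (\<lambda>z. G z $ i)" "(\<lambda>z. G z $ i) holomorphic_on ball 0 1"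
  using assms unfolding holo_disc_def by (auto intro: continuous_intros)

lemma holo_discI:
  assumes "\<And>i. continuous_on (cball 0 1) (\<lambda>z. G z $ i)" "\<And>i. (\<lambda>z. G z $ i) holomorphic_on ball 0 1"
  shows "holo_disc G"
proof -
  have "continuous_on (cball 0 1) (\<lambda>z. \<chi> i. G z $ i)" by (rule continuous_on_vec_lambda[OF assms(1)])
  then show ?thesis using assms(2) unfolding holo_disc_def by simp
qed

lemma holo_disc_sphere: "holo_disc G \<Longrightarrow> continuous_on (sphere 0 1) G"
  unfolding holo_disc_def by (auto elim: continuous_on_subset)

lemma holo_bdot:
  assumes "holo_disc v" "holo_disc w"
  shows "continuous_on (cball 0 1) (\<lambda>z. bdot (v z) (w z))" "(\<lambda>z. bdot (v z) (w z)) holomorphic_on ball 0 1"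
  using assms unfolding bdot_def holo_disc_def
  by (auto intro!: continuous_intros holomorphic_intros)

text \<open>Pairing with \<open>v\<close> kills \<open>p\<close>, because \<open>bdot v p\<close>
  vanishes at 0. What remains is that \<epsilon> times the mean of the squared norm of
  \<open>v\<close> is at most \<open>K\<close> times the mean of the norm, and Young's inequality
  with parameter \<mu> turns this into a bound of the latter by \<mu>.\<close>

lemma mean_estimate:
  fixes H S :: "complex \<Rightarrow> complex ^ 'n ^ 'n"
  assumes e: "energy \<epsilon> H S" "0 < \<epsilon>" and v: "holo_disc v" "v 0 = 0" and p: "holo_disc p"
    and F: "continuous_on (sphere 0 1) F" "\<And>x. x \<in> sphere 0 1 \<Longrightarrow> norm (F x) \<le> K"
    and eq: "\<And>x. x \<in> sphere 0 1 \<Longrightarrow> H x *v vcnj (v x) + S x *v v x + F x = p x"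
  shows "cmean (\<lambda>x. norm (v x)) \<le> K / \<epsilon>"
proof (rule field_le_epsilon)
  fix \<eta> :: real assume \<eta>: "\<eta> > 0"
  have K: "K \<ge> 0" using F(2)[of 1] by (simp add: order_trans[OF norm_ge_zero])
  \<comment> \<open>The summand \<eta> keeps \<mu> positive, so that it can be divided by even when
    \<open>K = 0\<close>.\<close>
  define \<mu> where "\<mu> = K / \<epsilon> + \<eta>"
  have \<mu>: "\<mu> > 0" "K / \<epsilon> \<le> \<mu>" using K e(2) \<eta> by (auto simp: \<mu>_def add_nonneg_pos)
  note vs = holo_disc_sphere[OF v(1)] and ps = holo_disc_sphere[OF p]
  have mp: "cmean (\<lambda>x. bdot (v x) (p x)) = 0"
    using cmean_value[OF holo_bdot[OF v(1) p]] v(2) by (simp add: bdot_def)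
  have i1: "cint (\<lambda>x. norm (v x))" and i2: "cint (\<lambda>x. (norm (v x))\<^sup>2)" and i3: "cint (\<lambda>x. bdot (v x) (p x))"
    by (intro cint_continuous continuous_intros vs ps)+
  have m3: "cmean (\<lambda>x. Re (bdot (v x) (p x))) = 0"
    using cmean_linear[OF bounded_linear_Re i3] mp by simp
  have i4: "cint (\<lambda>x. Re (bdot (v x) (p x)))" "cint (\<lambda>x. Re (bdot (v x) (p x)) + K * norm (v x))"
    by (intro cint_continuous continuous_intros vs ps)+
  have i5: "cint (\<lambda>x. K * norm (v x))" "cint (\<lambda>x. \<epsilon> * (norm (v x))\<^sup>2)"
     "cint (\<lambda>x. \<mu> / 2 + (norm (v x))\<^sup>2 / (2 * \<mu>))" "cint (\<lambda>x. (norm (v x))\<^sup>2 / (2 * \<mu>))" "cint (\<lambda>x::complex. \<mu> / 2)"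
    using \<mu> by (auto intro!: cint_continuous continuous_intros vs)
  have "\<epsilon> * cmean (\<lambda>x. (norm (v x))\<^sup>2) = cmean (\<lambda>x. \<epsilon> * (norm (v x))\<^sup>2)"
    by (rule cmean_linear[OF bounded_linear_mult_right i2, symmetric])
  also have "\<dots> \<le> cmean (\<lambda>x. Re (bdot (v x) (p x)) + K * norm (v x))"
  proof (rule cmean_mono[OF i5(2) i4(2)])
    fix x :: complex assume x: "x \<in> sphere 0 1"
    have "\<epsilon> * (norm (v x))\<^sup>2 \<le> Re (bdot (v x) (H x *v vcnj (v x) + S x *v v x))"
      using e x unfolding energy_def by blast
    also have "H x *v vcnj (v x) + S x *v v x = p x - F x" using eq[OF x] by (simp add: eq_diff_eq)
    also have "Re (bdot (v x) (p x - F x)) = Re (bdot (v x) (p x)) - Re (bdot (v x) (F x))"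
      by (simp add: bdot_diff_right)
    also have "\<dots> \<le> Re (bdot (v x) (p x)) + norm (v x) * norm (F x)"
      using abs_Re_le_cmod[of "bdot (v x) (F x)"] norm_bdot_le[of "v x" "F x"] by linarith
    also have "norm (v x) * norm (F x) \<le> K * norm (v x)"
      using mult_left_mono[OF F(2)[OF x], of "norm (v x)"] by (simp add: mult.commute)
    finally show "\<epsilon> * (norm (v x))\<^sup>2 \<le> Re (bdot (v x) (p x)) + K * norm (v x)" by simp
  qed
  also have "\<dots> = K * cmean (\<lambda>x. norm (v x))"
    using cmean_add[OF i4(1) i5(1)] m3 cmean_linear[OF bounded_linear_mult_right[of K] i1] by simp
  finally have 1: "\<epsilon> * cmean (\<lambda>x. (norm (v x))\<^sup>2) \<le> K * cmean (\<lambda>x. norm (v x))" .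
  have "cmean (\<lambda>x. norm (v x)) \<le> cmean (\<lambda>x. \<mu> / 2 + (norm (v x))\<^sup>2 / (2 * \<mu>))"
  proof (rule cmean_mono[OF i1 i5(3)])
    fix x :: complex
    have "0 \<le> (norm (v x) - \<mu>)\<^sup>2" by simp
    then have "2 * \<mu> * norm (v x) \<le> \<mu>\<^sup>2 + (norm (v x))\<^sup>2" by (simp add: power2_diff algebra_simps)
    then show "norm (v x) \<le> \<mu> / 2 + (norm (v x))\<^sup>2 / (2 * \<mu>)"
      using \<mu>(1) by (simp add: field_simps power2_eq_square)
  qed
  also have "\<dots> = \<mu> / 2 + cmean (\<lambda>x. (norm (v x))\<^sup>2) / (2 * \<mu>)"
    using cmean_add[OF i5(5,4)] cmean_linear[OF bounded_linear_divide[of "2 * \<mu>"] i2] by simp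
  also have "\<dots> \<le> \<mu> / 2 + (\<mu> * cmean (\<lambda>x. norm (v x))) / (2 * \<mu>)"
  proof -
    have m1: "0 \<le> cmean (\<lambda>x. norm (v x))" using cmean_mono[of "\<lambda>x. 0" "\<lambda>x. norm (v x)"] i1
      by (simp add: cint_continuous)
    have "cmean (\<lambda>x. (norm (v x))\<^sup>2) \<le> K / \<epsilon> * cmean (\<lambda>x. norm (v x))"
      using 1 e(2) by (simp add: field_simps)
    also have "\<dots> \<le> \<mu> * cmean (\<lambda>x. norm (v x))" using \<mu>(2) m1 by (rule mult_right_mono)
    finally show ?thesis using \<mu>(1) by (intro add_left_mono divide_right_mono) auto
  qed
  also have "\<dots> = \<mu> / 2 + cmean (\<lambda>x. norm (v x)) / 2" using \<mu>(1) by simp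
  finally have "cmean (\<lambda>x. norm (v x)) \<le> \<mu>" by simp
  then show "cmean (\<lambda>x. norm (v x)) \<le> K / \<epsilon> + \<eta>" unfolding \<mu>_def .
qed

lemma holo_disc_interior_bound:
  assumes "holo_disc d" "cmean (\<lambda>x. norm (d x)) \<le> E" "cmod z < 1"
  shows "norm (d z :: complex ^ 'n) \<le> real CARD('n) * (E / (1 - cmod z))"
proof (rule norm_vec_le_card)
  fix i
  note ds = holo_disc_sphere[OF assms(1)]
  have ge: "1 - cmod z \<le> cmod (x - z)" if "cmod x = 1" for x
    using norm_triangle_ineq2[of x z] that by simp
  have "d z $ i = cmean (\<lambda>x. x * d x $ i / (x - z))"
    using cmean_Cauchy[OF holo_disc_component[OF assms(1), of i] assms(3)] by simp
  also have "cmod \<dots> \<le> cmean (\<lambda>x. norm (d x) / (1 - cmod z))"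
  proof (rule cmean_norm_le)
    have "x \<noteq> z" if "cmod x = 1" for x using that assms(3) by auto
    then show "cint (\<lambda>x. x * d x $ i / (x - z))"
      by (intro cint_continuous) (auto intro!: continuous_intros ds)
    show "cint (\<lambda>x. norm (d x) / (1 - cmod z))"
      using assms(3) by (intro cint_continuous continuous_intros ds) auto
    fix x :: complex assume x: "x \<in> sphere 0 1"
    have "cmod (x * d x $ i / (x - z)) = cmod (d x $ i) / cmod (x - z)" using x by (simp add: norm_mult norm_divide)
    also have "\<dots> \<le> norm (d x) / (1 - cmod z)"
      using assms(3) ge[of x] x by (intro frac_le Finite_Cartesian_Product.norm_nth_le) auto
    finally show "cmod (x * d x $ i / (x - z)) \<le> norm (d x) / (1 - cmod z)" .
  qed
  also have "\<dots> = cmean (\<lambda>x. norm (d x)) / (1 - cmod z)"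
    by (rule cmean_linear[OF bounded_linear_divide]) (intro cint_continuous continuous_intros ds)
  also have "\<dots> \<le> E / (1 - cmod z)" using assms by (intro divide_right_mono) auto
  finally show "cmod (d z $ i) \<le> E / (1 - cmod z)" .
qed

lemma apriori_estimate:
  fixes \<alpha> \<epsilon> L :: real
  assumes \<alpha>: "0 < \<alpha>" "\<alpha> < 1" and \<epsilon>: "0 < \<epsilon>" and L: "0 \<le> L"
  obtains C where "0 < C"
    "\<And>(H :: complex \<Rightarrow> complex ^ 'n ^ 'n) S F v p K.
      \<lbrakk>holder_bound \<alpha> L H; holder_bound \<alpha> L S; energy \<epsilon> H S; holo_disc v; v 0 = 0; holo_disc p;
       holder_bound \<alpha> K F; \<And>x. x \<in> sphere 0 1 \<Longrightarrow> H x *v vcnj (v x) + S x *v v x + F x = p x\<rbrakk>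
      \<Longrightarrow> holder_bound \<alpha> (C * K) v"
proof -
  define n where "n = real CARD('n)"
  have n: "n \<ge> 1" unfolding n_def using zero_less_card_finite[where 'a='n] by simp
  define c where "c = n * ((2 / \<alpha> + 1) * (108 / (1 - \<alpha>))) / \<epsilon>"
  have c: "c > 0" unfolding c_def using n \<alpha> \<epsilon>
    by (intro divide_pos_pos mult_pos_pos add_pos_pos) auto
  \<comment> \<open>Makes \<open>2 * c * L * \<delta> powr \<alpha>\<close>, the factor in front of
    the supremum below, at most \<open>1 / 2\<close>; \<open>L + 1\<close> avoids dividing by
    0.\<close>
  define \<delta> where "\<delta> = min 1 ((1 / (4 * c * (L + 1))) powr (1 / \<alpha>))"
  have d: "0 < \<delta>" "\<delta> \<le> 1" using c L by (auto simp: \<delta>_def)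
  have dc: "2 * c * L * \<delta> powr \<alpha> \<le> 1 / 2"
  proof -
    have "\<delta> powr \<alpha> \<le> ((1 / (4 * c * (L + 1))) powr (1 / \<alpha>)) powr \<alpha>"
      using d \<alpha> by (intro powr_mono2) (auto simp: \<delta>_def)
    also have "\<dots> = 1 / (4 * c * (L + 1))" using \<alpha> c L by (simp add: powr_powr)
    finally have "2 * c * L * \<delta> powr \<alpha> \<le> 2 * c * L * (1 / (4 * c * (L + 1)))"
      using c L by (intro mult_left_mono) auto
    also have "\<dots> = L / (2 * (L + 1))" using c L by (simp add: divide_simps)
    also have "\<dots> \<le> 1 / 2" using L by (simp add: divide_simps)
    finally show ?thesis .
  qed
  \<comment> \<open>\<open>C1\<close> bounds the supremum once half of it has been absorbed;
    \<open>C\<close> also covers the seminorm, whose bound contains the supremum.\<close>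
  define C1 where "C1 = 2 * (c + n / (\<epsilon> * \<delta>))"
  define C where "C = C1 + c * (2 * L * C1 + 1)"
  have C1: "C1 > 0" unfolding C1_def using c n \<epsilon> d by (simp add: add_pos_pos)
  have C: "C > 0" "C1 \<le> C" "c * (2 * L * C1 + 1) \<le> C"
    unfolding C_def using C1 c L by (auto intro!: add_pos_pos mult_pos_pos add_nonneg_pos)
  have "holder_bound \<alpha> (C * K) v"
    if H: "holder_bound \<alpha> L H" and S: "holder_bound \<alpha> L S" and e: "energy \<epsilon> H S"
      and v: "holo_disc v" "v 0 = 0" and p: "holo_disc p" and F: "holder_bound \<alpha> K F"
      and eq: "\<And>x. x \<in> sphere 0 1 \<Longrightarrow> H x *v vcnj (v x) + S x *v v x + F x = p x"
    for H S :: "complex \<Rightarrow> complex ^ 'n ^ 'n" and F v p K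
  proof -
    note K = holder_bound_nonneg[OF F]
    note vs = holo_disc_sphere[OF v(1)]
    have "compact (sphere 0 (1::real) :: complex set)" "sphere 0 (1::real) \<noteq> ({} :: complex set)" by auto
    from continuous_attains_sup[OF this continuous_on_norm[OF vs]]
    obtain x0 where x0: "x0 \<in> sphere 0 1" "\<And>x. x \<in> sphere 0 1 \<Longrightarrow> norm (v x) \<le> norm (v x0)" by blast
    define V where "V = norm (v x0)"
    have V: "V \<ge> 0" "\<And>x. x \<in> sphere 0 1 \<Longrightarrow> norm (v x) \<le> V" using x0 by (auto simp: V_def)
    define M where "M = (2 * L * V + K) / \<epsilon>"
    have M: "M \<ge> 0" unfolding M_def using L V K \<epsilon> by simp
    \<comment> \<open>With \<open>A\<close> the inverse of \<open>H z\<close>, the map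
      \<open>A *v (p - S z *v v - F z)\<close> has constant coefficients, so it is holomorphic. By
      the equation, its distance from \<open>vcnj v\<close> involves only increments of
      \<open>H\<close>, \<open>S\<close> and \<open>F\<close> between \<open>x\<close> and
      \<open>z\<close>.\<close>
    have frozen: "\<exists>k. holo_disc k \<and> (\<forall>x\<in>sphere 0 1. norm (vcnj (v x) - k x) \<le> M * norm (x - z) powr \<alpha>)"
      if z: "z \<in> sphere 0 1" for z
    proof -
      obtain A where A: "\<And>w. A *v (H z *v w) = w" "\<And>w. norm (A *v w) \<le> norm w / \<epsilon>"
        using energy_inverse[OF e \<epsilon> z] by blast
      define k where "k = (\<lambda>x. A *v (p x - S z *v v x - F z))"
      have "holo_disc k"
        unfolding k_def matrix_vector_mult_def
        by (rule holo_discI)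
           (auto intro!: continuous_intros holomorphic_intros holo_disc_component[OF p] holo_disc_component[OF v(1)])
      moreover have "norm (vcnj (v x) - k x) \<le> M * norm (x - z) powr \<alpha>" if x: "x \<in> sphere 0 1" for x
      proof -
        let ?u = "norm (x - z) powr \<alpha>"
        have hz: "norm (G z - G x) \<le> B * ?u" if "holder_bound \<alpha> B G" for B and G :: "complex \<Rightarrow> 'b::real_normed_vector"
          using that x z unfolding holder_bound_def by (metis norm_minus_commute)
        have "vcnj (v x) - k x = A *v (H z *v vcnj (v x) - (p x - S z *v v x - F z))"
          by (simp add: k_def A(1) matrix_vector_mult_diff_distrib)
        also have "H z *v vcnj (v x) - (p x - S z *v v x - F z)
            = (H z - H x) *v vcnj (v x) + (S z - S x) *v v x + (F z - F x)"
          by (simp add: eq[OF x, symmetric] algebra_simps)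
        also have "norm (A *v \<dots>) \<le> norm \<dots> / \<epsilon>" by (rule A(2))
        also have "\<dots> \<le> (L * ?u * V + L * ?u * V + K * ?u) / \<epsilon>"
        proof (intro divide_right_mono norm_triangle_mono)
          show "norm ((H z - H x) *v vcnj (v x)) \<le> L * ?u * V"
            by (rule order_trans[OF norm_matrix_vector_le]) (intro mult_mono hz[OF H], use V x L in auto)
          show "norm ((S z - S x) *v v x) \<le> L * ?u * V"
            by (rule order_trans[OF norm_matrix_vector_le]) (intro mult_mono hz[OF S], use V x L in auto)
        qed (use hz[OF F] \<epsilon> in auto)
        also have "\<dots> = M * ?u" by (simp add: M_def field_simps)
        finally show ?thesis .
      qed
      ultimately show ?thesis by blast
    qed
    have comp: "cmod (v a $ i - v b $ i) \<le> (2 / \<alpha> + 1) * (108 / (1 - \<alpha>) * M) * cmod (a - b) powr \<alpha>"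
      if ab: "a \<in> cball 0 1" "b \<in> cball 0 1" for a b i
    proof (rule holomorphic_holder_cball[OF \<alpha> _ holo_disc_component[OF v(1)] _ ab])
      fix z :: complex and r :: real assume z: "z \<in> sphere 0 1" "0 \<le> r" "r < 1"
      obtain k where k: "holo_disc k" "\<And>x. x \<in> sphere 0 1 \<Longrightarrow> norm (vcnj (v x) - k x) \<le> M * norm (x - z) powr \<alpha>"
        using frozen[OF z(1)] by blast
      show "cmod (cmean (\<lambda>x. x * v x $ i / (x - of_real r * z)\<^sup>2)) \<le> 108 / (1 - \<alpha>) * M * (1 - r) powr (\<alpha> - 1)"
      proof (rule cauchy_deriv_bound[OF \<alpha> _ z holo_disc_component[OF k(1), of i]])
        show "continuous_on (sphere 0 1) (\<lambda>x. v x $ i)" by (intro continuous_intros vs)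
        fix x :: complex assume x: "x \<in> sphere 0 1"
        have "cmod (v x $ i - cnj (k x $ i)) = cmod ((vcnj (v x) - k x) $ i)"
          by (metis complex_cnj_cnj complex_cnj_diff complex_mod_cnj vcnj_simps(1) vector_minus_component)
        also have "\<dots> \<le> norm (vcnj (v x) - k x)" by (rule Finite_Cartesian_Product.norm_nth_le)
        finally show "cmod (v x $ i - cnj (k x $ i)) \<le> M * cmod (x - z) powr \<alpha>" using k(2)[OF x] by simp
      qed
    qed (use M \<alpha> in simp)
    have hol: "norm (v a - v b) \<le> c * (2 * L * V + K) * norm (a - b) powr \<alpha>"
      if ab: "a \<in> cball 0 1" "b \<in> cball 0 1" for a b
    proof -
      have "norm (v a - v b) \<le> n * ((2 / \<alpha> + 1) * (108 / (1 - \<alpha>) * M) * cmod (a - b) powr \<alpha>)"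
        unfolding n_def by (rule norm_vec_le_card) (use comp[OF ab] in simp)
      also have "n * (a' * (b' * (s / \<epsilon>)) * u) = n * (a' * b') / \<epsilon> * s * u" for a' b' s u :: real
        by simp
      then have "n * ((2 / \<alpha> + 1) * (108 / (1 - \<alpha>) * M) * cmod (a - b) powr \<alpha>)
          = c * (2 * L * V + K) * norm (a - b) powr \<alpha>"
        unfolding c_def M_def .
      finally show ?thesis .
    qed
    have VK: "V \<le> C1 * K"
    proof -
      \<comment> \<open>The point at depth \<delta> below the maximum: its value is controlled by
        the mean, at the price of a factor \<open>1 / \<delta>\<close>.\<close>
      define w where "w = of_real (1 - \<delta>) * x0"
      have nx: "cmod x0 = 1" using x0 by simp
      have w: "cmod w = 1 - \<delta>" unfolding w_def norm_mult nx using d by (simp del: of_real_diff)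
      have xw: "x0 - w = of_real \<delta> * x0" by (simp add: w_def algebra_simps)
      have nxw: "cmod (x0 - w) = \<delta>" unfolding xw norm_mult nx using d by simp
      have m: "cmean (\<lambda>x. norm (v x)) \<le> K / \<epsilon>"
        by (rule mean_estimate[OF e \<epsilon> v p holder_bound_continuous[OF \<alpha>(1) F] _ eq])
           (use F in \<open>auto simp: holder_bound_def\<close>)
      have 1: "norm (v w) \<le> n * (K / \<epsilon> / \<delta>)"
        unfolding n_def using holo_disc_interior_bound[OF v(1) m, of w] w d by simp
      have "norm (v x0 - v w) \<le> c * (2 * L * V + K) * \<delta> powr \<alpha>"
        using hol[of x0 w] x0(1) w d nxw by simp
      also have "\<dots> = (2 * c * L * \<delta> powr \<alpha>) * V + c * K * \<delta> powr \<alpha>" by (simp add: algebra_simps)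
      also have "\<dots> \<le> 1 / 2 * V + c * K * 1"
        using dc V(1) c K d \<alpha> powr_mono2[of \<alpha> \<delta> 1] by (intro add_mono mult_right_mono mult_left_mono) auto
      finally have "V \<le> 1 / 2 * V + c * K + n * (K / \<epsilon> / \<delta>)"
        using 1 norm_triangle_sub[of "v x0" "v w"] unfolding V_def by linarith
      then have "V \<le> 2 * (c * K + n * (K / \<epsilon> / \<delta>))" by simp
      also have "\<dots> = C1 * K" by (simp add: C1_def algebra_simps)
      finally show ?thesis .
    qed
    have "c * (2 * L * V + K) \<le> c * (2 * L * (C1 * K) + K)"
      using c L VK by (intro mult_left_mono add_right_mono) auto
    also have "\<dots> = c * (2 * L * C1 + 1) * K" by (simp add: algebra_simps)
    also have "\<dots> \<le> C * K" using C(3) K by (rule mult_right_mono)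
    finally have CK: "c * (2 * L * V + K) \<le> C * K" .
    show "holder_bound \<alpha> (C * K) v"
      unfolding holder_bound_def
    proof (intro conjI ballI)
      fix x :: complex assume x: "x \<in> sphere 0 1"
      have "V \<le> C * K" using VK mult_right_mono[OF C(2) K] by linarith
      then show "norm (v x) \<le> C * K" using V(2)[OF x] by linarith
      fix y :: complex assume y: "y \<in> sphere 0 1"
      have "norm (v x - v y) \<le> c * (2 * L * V + K) * norm (x - y) powr \<alpha>" using hol x y by simp
      also have "\<dots> \<le> C * K * norm (x - y) powr \<alpha>" using CK by (rule mult_right_mono) simp
      finally show "norm (v x - v y) \<le> C * K * norm (x - y) powr \<alpha>" .
    qed
  qed
  with C(1) show ?thesis by (rule that)
qed

section \<open>The method of continuity\<close>

text \<open>Only continuity up to the circle is asked of \<open>v\<close>; its Hoelder bound is a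
  consequence of \<open>apriori_estimate\<close>.\<close>

definition solvable :: "real \<Rightarrow> (complex \<Rightarrow> complex ^ 'n ^ 'n) \<Rightarrow> (complex \<Rightarrow> complex ^ 'n ^ 'n) \<Rightarrow> bool" where
  "solvable \<alpha> H S \<longleftrightarrow> (\<forall>F K. holder_bound \<alpha> K F \<longrightarrow>
     (\<exists>v p. holo_disc v \<and> holo_disc p \<and> v 0 = 0 \<and>
        (\<forall>x\<in>sphere 0 1. H x *v vcnj (v x) + S x *v v x + F x = p x)))"

text \<open>If \<open>F = p + cnj q\<close> with \<open>q 0 = 0\<close>, then \<open>v = - q\<close>
  solves the equation with right-hand side \<open>p\<close>.\<close>

lemma solvable_identity:
  assumes \<alpha>: "0 < \<alpha>" "\<alpha> < 1"
  shows "solvable \<alpha> (\<lambda>x. mat 1 :: complex ^ 'n ^ 'n) (\<lambda>x. 0)"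
  unfolding solvable_def
proof (intro allI impI)
  fix F :: "complex \<Rightarrow> complex ^ 'n" and K assume F: "holder_bound \<alpha> K F"
  have "\<forall>i. \<exists>pq. continuous_on (cball 0 1) (fst pq) \<and> fst pq holomorphic_on ball 0 1 \<and>
    continuous_on (cball 0 1) (snd pq) \<and> snd pq holomorphic_on ball 0 1 \<and> snd pq 0 = 0 \<and>
    (\<forall>x\<in>sphere 0 1. F x $ i = fst pq x + cnj (snd pq x))"
  proof
    fix i
    have "cmod (F x $ i - F y $ i) \<le> K * cmod (x - y) powr \<alpha>"
      if "x \<in> sphere 0 1" "y \<in> sphere 0 1" for x y
    proof -
      have "cmod ((F x - F y) $ i) \<le> K * cmod (x - y) powr \<alpha>"
        by (rule order_trans[OF Finite_Cartesian_Product.norm_nth_le])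
           (use F that in \<open>auto simp: holder_bound_def\<close>)
      then show ?thesis by simp
    qed
    then obtain p q where "continuous_on (cball 0 1) p" "p holomorphic_on ball 0 1"
      "continuous_on (cball 0 1) q" "q holomorphic_on ball 0 1" "q 0 = 0"
      "\<And>x. x \<in> sphere 0 1 \<Longrightarrow> F x $ i = p x + cnj (q x)"
      by (rule holder_decomposition[of \<alpha> K "\<lambda>x. F x $ i", OF \<alpha> holder_bound_nonneg[OF F]]) (assumption | rule that)+
    then show "\<exists>pq. continuous_on (cball 0 1) (fst pq) \<and> fst pq holomorphic_on ball 0 1 \<and>
      continuous_on (cball 0 1) (snd pq) \<and> snd pq holomorphic_on ball 0 1 \<and> snd pq 0 = 0 \<and>
      (\<forall>x\<in>sphere 0 1. F x $ i = fst pq x + cnj (snd pq x))"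
      by (intro exI[of _ "(p, q)"]) simp
  qed
  from choice[OF this] obtain pq where pq: "\<And>i. continuous_on (cball 0 1) (fst (pq i))"
    "\<And>i. fst (pq i) holomorphic_on ball 0 1" "\<And>i. continuous_on (cball 0 1) (snd (pq i))"
    "\<And>i. snd (pq i) holomorphic_on ball 0 1" "\<And>i. snd (pq i) 0 = 0"
    "\<And>i x. x \<in> sphere 0 1 \<Longrightarrow> F x $ i = fst (pq i) x + cnj (snd (pq i) x)"
    by blast
  show "\<exists>v p. holo_disc v \<and> holo_disc p \<and> v 0 = 0 \<and>
        (\<forall>x\<in>sphere 0 1. mat 1 *v vcnj (v x) + 0 *v v x + F x = p x)"
  proof (intro exI conjI)
    show "holo_disc (\<lambda>z. \<chi> i. - snd (pq i) z)" "holo_disc (\<lambda>z. \<chi> i. fst (pq i) z)"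
      using pq by (auto intro!: holo_discI continuous_intros holomorphic_intros)
  qed (use pq in \<open>auto simp: vec_eq_iff matrix_vector_mul_lid\<close>)
qed

lemma holo_disc_max:
  assumes "holo_disc g" "\<And>x. x \<in> sphere 0 1 \<Longrightarrow> norm (g x) \<le> B" "x \<in> cball 0 1"
  shows "norm (g x :: complex ^ 'n) \<le> real CARD('n) * B"
proof (rule norm_vec_le_card)
  show "cmod (g x $ i) \<le> B" for i
    by (rule maximum_modulus_frontier[of "\<lambda>z. g z $ i" "cball 0 1"])
       (use assms holo_disc_component[OF assms(1)] in \<open>auto intro: order_trans[OF Finite_Cartesian_Product.norm_nth_le]\<close>)
qed

lemma holo_disc_diff: "holo_disc v \<Longrightarrow> holo_disc w \<Longrightarrow> holo_disc (\<lambda>z. v z - w z)"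
  unfolding holo_disc_def by (auto intro!: continuous_intros holomorphic_intros)

text \<open>The maximum principle carries geometric decay from the circle to the closed
  disc.\<close>

lemma holo_disc_limit:
  fixes v :: "nat \<Rightarrow> complex \<Rightarrow> complex ^ 'n"
  assumes v: "\<And>k. holo_disc (v k)"
    and D: "\<And>k x. x \<in> sphere 0 1 \<Longrightarrow> norm (v (Suc k) x - v k x) \<le> D / 2 ^ k"
  obtains w where "holo_disc w" "\<And>x. x \<in> cball 0 1 \<Longrightarrow> (\<lambda>k. v k x) \<longlonglongrightarrow> w x"
proof -
  define f where "f = (\<lambda>k x. v (Suc k) x - v k x)"
  have "uniform_limit (cball 0 1) (\<lambda>n x. \<Sum>i<n. f i x) (\<lambda>x. suminf (\<lambda>i. f i x)) sequentially"
  proof (rule Weierstrass_m_test)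
    show "norm (f k x) \<le> real CARD('n) * (D / 2 ^ k)" if "x \<in> cball 0 1" for k x
      unfolding f_def by (rule holo_disc_max[OF holo_disc_diff[OF v v] D that])
    show "summable (\<lambda>k. real CARD('n) * (D / 2 ^ k))"
    proof -
      have "(\<lambda>k. real CARD('n) * (D / 2 ^ k)) = (\<lambda>k. (real CARD('n) * D) * (1 / 2) ^ k)"
        by (simp add: power_divide)
      then show ?thesis by (simp only:) (intro summable_mult summable_geometric, simp)
    qed
  qed
  then have u: "uniform_limit (cball 0 1) (\<lambda>n x. v 0 x + (\<Sum>i<n. f i x)) (\<lambda>x. v 0 x + suminf (\<lambda>i. f i x)) sequentially"
    by (intro uniform_limit_intros)
  define w where "w = (\<lambda>x. v 0 x + suminf (\<lambda>i. f i x))"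
  have "v 0 x + (\<Sum>i<n. f i x) = v n x" for n x
    unfolding f_def using sum_lessThan_telescope[of "\<lambda>i. v i x" n] by simp
  then have u: "uniform_limit (cball 0 1) v w sequentially" using u unfolding w_def by simp
  have ui: "uniform_limit (cball 0 1) (\<lambda>n x. v n x $ i) (\<lambda>x. w x $ i) sequentially" for i
    by (rule bounded_linear.uniform_limit[OF bounded_linear_vec_nth u])
  have "holo_disc w"
  proof (rule holo_discI)
    fix i
    obtain "continuous_on (cball 0 1) (\<lambda>x. w x $ i)" "(\<lambda>x. w x $ i) holomorphic_on ball 0 1"
      by (rule holomorphic_uniform_limit[OF _ ui])
         (use holo_disc_component[OF v] in auto)
    then show "continuous_on (cball 0 1) (\<lambda>x. w x $ i)" "(\<lambda>x. w x $ i) holomorphic_on ball 0 1" .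
  qed
  moreover have "(\<lambda>k. v k x) \<longlonglongrightarrow> w x" if "x \<in> cball 0 1" for x
    by (rule tendsto_uniform_limitI[OF u that])
  ultimately show ?thesis by (rule that)
qed

lemma holder_bound_mv:
  fixes A :: "complex \<Rightarrow> complex ^ 'n ^ 'm"
  assumes "holder_bound \<alpha> B A" "holder_bound \<alpha> K w"
  shows "holder_bound \<alpha> (2 * B * K) (\<lambda>x. A x *v w x)"
  by (rule holder_bound_bilinear[OF bounded_bilinear_matrix_vector _ assms]) (rule norm_matrix_vector_le)

lemma holder_bound_vcnj: "holder_bound \<alpha> K w \<Longrightarrow> holder_bound \<alpha> K (\<lambda>x. vcnj (w x))"
  using holder_bound_linear[OF _ bounded_linear_vcnj, of \<alpha> K w 1] by simp

lemma holder_bound_diff: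
  assumes "holder_bound \<alpha> K F" "holder_bound \<alpha> L G"
  shows "holder_bound \<alpha> (K + L) (\<lambda>x. F x - G x)"
  using holder_bound_add[OF assms(1) holder_bound_linear[OF assms(2) bounded_linear_minus[OF bounded_linear_ident], of 1]]
  by simp

text \<open>Picard iteration for \<open>v = T (F + R v)\<close>, with \<open>T\<close> choosing
  solutions for \<open>(H, S)\<close>. In the Hoelder norm \<open>R\<close> is bounded by
  \<open>4 * B\<close>, and solutions by \<open>C\<close> times the data, so
  \<open>4 * B * C \<le> 1 / 2\<close> halves each increment.\<close>

lemma solvable_perturb:
  fixes H S A1 A2 :: "complex \<Rightarrow> complex ^ 'n ^ 'n"
  assumes sol: "solvable \<alpha> H S" and C: "0 < C" and B: "4 * B * C \<le> 1 / 2"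
    and H: "holder_bound \<alpha> L H" and S: "holder_bound \<alpha> L S"
    and A1: "holder_bound \<alpha> B A1" and A2: "holder_bound \<alpha> B A2"
    and ap: "\<And>F v p K. \<lbrakk>holo_disc v; v 0 = 0; holo_disc p; holder_bound \<alpha> K F;
       \<And>x. x \<in> sphere 0 1 \<Longrightarrow> H x *v vcnj (v x) + S x *v v x + F x = p x\<rbrakk> \<Longrightarrow> holder_bound \<alpha> (C * K) v"
  shows "solvable \<alpha> (\<lambda>x. H x + A1 x) (\<lambda>x. S x + A2 x)"
  unfolding solvable_def
proof (intro allI impI)
  fix F :: "complex \<Rightarrow> complex ^ 'n" and KF assume F: "holder_bound \<alpha> KF F"
  have B0: "0 \<le> B" by (rule holder_bound_nonneg[OF A1])
  have L0: "0 \<le> L" by (rule holder_bound_nonneg[OF H])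
  have "\<forall>G\<in>{G. \<exists>K. holder_bound \<alpha> K G}. \<exists>v p. holo_disc v \<and> holo_disc p \<and> v 0 = 0 \<and>
        (\<forall>x\<in>sphere 0 1. H x *v vcnj (v x) + S x *v v x + G x = p x)"
    using sol unfolding solvable_def by blast
  from bchoice[OF this] obtain T where "\<forall>G\<in>{G. \<exists>K. holder_bound \<alpha> K G}. \<exists>p. holo_disc (T G) \<and> holo_disc p \<and> T G 0 = 0 \<and>
        (\<forall>x\<in>sphere 0 1. H x *v vcnj (T G x) + S x *v T G x + G x = p x)" ..
  from bchoice[OF this] obtain Q where Q: "\<forall>G\<in>{G. \<exists>K. holder_bound \<alpha> K G}. holo_disc (T G) \<and> holo_disc (Q G) \<and> T G 0 = 0 \<and>
        (\<forall>x\<in>sphere 0 1. H x *v vcnj (T G x) + S x *v T G x + G x = Q G x)" ..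
  have TQ: "holo_disc (T G)" "holo_disc (Q G)" "T G 0 = 0"
    "\<And>x. x \<in> sphere 0 1 \<Longrightarrow> H x *v vcnj (T G x) + S x *v T G x + G x = Q G x"
    if "holder_bound \<alpha> K G" for G K
    using bspec[OF Q, of G] that by blast+
  define R where "R = (\<lambda>w x. A1 x *v vcnj (w x) + A2 x *v w x :: complex ^ 'n)"
  have R: "holder_bound \<alpha> (4 * B * K) (R w)" if "holder_bound \<alpha> K w" for K w
    using holder_bound_add[OF holder_bound_mv[OF A1 holder_bound_vcnj[OF that]] holder_bound_mv[OF A2 that]]
    unfolding R_def by (simp add: algebra_simps)
  define step where "step = (\<lambda>w x. F x + R w x)"
  define v where "v = rec_nat (\<lambda>x. 0) (\<lambda>k w. T (step w))"
  have v_simps: "v 0 = (\<lambda>x. 0)" "\<And>k. v (Suc k) = T (step (v k))" by (simp_all add: v_def)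
  have step: "\<exists>K. holder_bound \<alpha> K (step w)" if "\<exists>K. holder_bound \<alpha> K w" for w
    unfolding step_def using holder_bound_add[OF F R] that by blast
  have Tb: "\<exists>K. holder_bound \<alpha> K (T G)" if "\<exists>K. holder_bound \<alpha> K G" for G
  proof -
    obtain K where K: "holder_bound \<alpha> K G" using \<open>\<exists>K. holder_bound \<alpha> K G\<close> ..
    have "holder_bound \<alpha> (C * K) (T G)"
      by (rule ap[OF TQ(1)[OF K] TQ(3)[OF K] TQ(2)[OF K] K TQ(4)[OF K]])
    then show ?thesis by blast
  qed
  have vb: "\<exists>K. holder_bound \<alpha> K (v k)" for k
  proof (induction k)
    case 0 show ?case by (rule exI[of _ 0]) (simp add: v_simps holder_bound_def)
  next
    case (Suc k) then show ?case unfolding v_simps by (intro Tb step)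
  qed
  define p where "p k = Q (step (v k))" for k
  have vS: "holo_disc (v (Suc k))" "holo_disc (p k)" "v (Suc k) 0 = 0"
    "\<And>x. x \<in> sphere 0 1 \<Longrightarrow> H x *v vcnj (v (Suc k) x) + S x *v v (Suc k) x + (F x + R (v k) x) = p k x" for k
  proof -
    obtain K where "holder_bound \<alpha> K (step (v k))" using step[OF vb] by blast
    from TQ[OF this] show "holo_disc (v (Suc k))" "holo_disc (p k)" "v (Suc k) 0 = 0"
      "\<And>x. x \<in> sphere 0 1 \<Longrightarrow> H x *v vcnj (v (Suc k) x) + S x *v v (Suc k) x + (F x + R (v k) x) = p k x"
      unfolding v_simps p_def step_def by auto
  qed
  have vh: "holo_disc (v k)" for k
  proof (cases k)
    case 0 then show ?thesis by (simp add: v_simps(1) holo_disc_def)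
  next
    case (Suc j) then show ?thesis using vS(1)[of j] by simp
  qed
  \<comment> \<open>\<open>T\<close> is a mere choice of solutions and need not be linear. The
    increments solve the unperturbed equation themselves, so the estimate applies to them
    directly.\<close>
  define d where "d k = (\<lambda>x. v (Suc k) x - v k x)" for k
  have dR: "R (v (Suc k)) x - R (v k) x = R (d k) x" for k x
    by (simp add: R_def d_def algebra_simps)
  have deq: "H x *v vcnj (d (Suc k) x) + S x *v d (Suc k) x + R (d k) x = p (Suc k) x - p k x"
    if "x \<in> sphere 0 1" for k x
    unfolding vS(4)[OF that, symmetric] dR[symmetric] by (simp add: d_def algebra_simps)
  obtain D where D: "holder_bound \<alpha> D (d 0)"
  proof -
    obtain a b where "holder_bound \<alpha> a (v (Suc 0))" "holder_bound \<alpha> b (v 0)" using vb by blast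
    from holder_bound_diff[OF this] show ?thesis using that unfolding d_def by blast
  qed
  have D0: "0 \<le> D" by (rule holder_bound_nonneg[OF D])
  have db: "holder_bound \<alpha> (D / 2 ^ k) (d k)" for k
  proof (induction k)
    case 0 then show ?case using D by simp
  next
    case (Suc k)
    have "holder_bound \<alpha> (C * (4 * B * (D / 2 ^ k))) (d (Suc k))"
    proof (rule ap[OF _ _ _ R[OF Suc] deq])
      show "holo_disc (d (Suc k))" "holo_disc (\<lambda>x. p (Suc k) x - p k x)"
        unfolding d_def by (intro holo_disc_diff vS)+
      show "d (Suc k) 0 = 0" unfolding d_def by (simp add: vS(3))
    qed
    moreover have "C * (4 * B * (D / 2 ^ k)) \<le> D / 2 ^ Suc k"
      using mult_right_mono[OF B, of "D / 2 ^ k"] D0 by (simp add: mult_ac)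
    ultimately show ?case by (rule holder_bound_mono)
  qed
  have dn: "norm (d k x) \<le> D / 2 ^ k" if "x \<in> sphere 0 1" for k x
    using db[of k] that unfolding holder_bound_def by blast
  obtain w where w: "holo_disc w" "\<And>x. x \<in> cball 0 1 \<Longrightarrow> (\<lambda>k. v k x) \<longlonglongrightarrow> w x"
    by (rule holo_disc_limit[of v D, OF vh]) (use dn in \<open>auto simp: d_def\<close>)
  \<comment> \<open>The right-hand sides must converge uniformly as well, for the limit equation to
    have a holomorphic one.\<close>
  have pd: "norm (p (Suc k) x - p k x) \<le> (L * D + 4 * B * D) / 2 ^ k" if x: "x \<in> sphere 0 1" for k x
  proof -
    have "norm (H x) \<le> L" "norm (S x) \<le> L" using H S x unfolding holder_bound_def by auto
    then have hs: "norm (A *v u) \<le> L * (D / 2 ^ Suc k)" if "norm u \<le> D / 2 ^ Suc k" "A = H x \<or> A = S x"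
      for A :: "complex ^ 'n ^ 'n" and u
      using that(2) by (intro order_trans[OF norm_matrix_vector_le] mult_mono that(1) L0 norm_ge_zero) auto
    have "norm (H x *v vcnj (d (Suc k) x)) \<le> L * (D / 2 ^ Suc k)"
      by (rule hs) (use dn[OF x, of "Suc k"] in \<open>simp_all del: power_Suc\<close>)
    moreover have "norm (S x *v d (Suc k) x) \<le> L * (D / 2 ^ Suc k)"
      by (rule hs) (use dn[OF x, of "Suc k"] in \<open>simp_all del: power_Suc\<close>)
    moreover have "norm (R (d k) x) \<le> 4 * B * (D / 2 ^ k)"
      using R[OF db] x unfolding holder_bound_def by blast
    ultimately have "norm (p (Suc k) x - p k x) \<le> L * (D / 2 ^ Suc k) + L * (D / 2 ^ Suc k) + 4 * B * (D / 2 ^ k)"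
      unfolding deq[OF x, symmetric] by (intro norm_triangle_mono)
    then show ?thesis by (simp add: field_simps)
  qed
  obtain q where q: "holo_disc q" "\<And>x. x \<in> cball 0 1 \<Longrightarrow> (\<lambda>k. p k x) \<longlonglongrightarrow> q x"
    by (rule holo_disc_limit[of p "L * D + 4 * B * D", OF vS(2) pd]) (assumption | rule that)+
  show "\<exists>v p. holo_disc v \<and> holo_disc p \<and> v 0 = 0 \<and>
      (\<forall>x\<in>sphere 0 1. (H x + A1 x) *v vcnj (v x) + (S x + A2 x) *v v x + F x = p x)"
  proof (rule exI[of _ w], rule exI[of _ q], intro conjI ballI w(1) q(1))
    have "v k 0 = 0" for k by (cases k) (simp_all add: vS(3) v_simps(1))
    moreover have "(\<lambda>k. v k 0) \<longlonglongrightarrow> w 0" by (rule w(2)) simp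
    ultimately have "(\<lambda>k. 0) \<longlonglongrightarrow> w 0" by simp
    then show "w 0 = 0" by (rule LIMSEQ_unique[OF _ tendsto_const])
    fix x :: complex assume x: "x \<in> sphere 0 1"
    have l: "(\<lambda>k. v k x) \<longlonglongrightarrow> w x" using w(2) x by simp
    have tm: "(\<lambda>k. A *v u k) \<longlonglongrightarrow> A *v a" if "u \<longlonglongrightarrow> a" for A :: "complex ^ 'n ^ 'n" and u a
      by (rule bounded_bilinear.tendsto[OF bounded_bilinear_matrix_vector tendsto_const that])
    have tc: "(\<lambda>k. vcnj (u k)) \<longlonglongrightarrow> vcnj a" if "u \<longlonglongrightarrow> a" for u and a :: "complex ^ 'n"
      by (rule bounded_linear.tendsto[OF bounded_linear_vcnj that])
    have "(\<lambda>k. H x *v vcnj (v (Suc k) x) + S x *v v (Suc k) x + (F x + R (v k) x))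
        \<longlonglongrightarrow> H x *v vcnj (w x) + S x *v w x + (F x + R w x)"
      unfolding R_def by (intro tendsto_add tm tc tendsto_const l LIMSEQ_Suc)
    then have "(\<lambda>k. p k x) \<longlonglongrightarrow> H x *v vcnj (w x) + S x *v w x + (F x + R w x)"
      unfolding vS(4)[OF x] .
    moreover have "(\<lambda>k. p k x) \<longlonglongrightarrow> q x" by (rule q(2)) (use x in simp)
    ultimately have "H x *v vcnj (w x) + S x *v w x + (F x + R w x) = q x"
      by (rule LIMSEQ_unique)
    then show "(H x + A1 x) *v vcnj (w x) + (S x + A2 x) *v w x + F x = q x"
      by (simp add: R_def algebra_simps)
  qed
qed

text \<open>Along the segment from \<open>(1, 0)\<close> to \<open>(H, S)\<close> the ellipticity
  constant stays at least \<open>min \<epsilon> 1\<close> and the Hoelder bound at most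
  \<open>L1\<close>, so one constant \<open>C\<close> serves all parameters.\<close>

theorem solvable_energy:
  fixes H S :: "complex \<Rightarrow> complex ^ 'n ^ 'n"
  assumes \<alpha>: "0 < \<alpha>" "\<alpha> < 1" and \<epsilon>: "0 < \<epsilon>" and e: "energy \<epsilon> H S"
    and H: "holder_bound \<alpha> L H" and S: "holder_bound \<alpha> L S"
  shows "solvable \<alpha> H S"
proof -
  define m where "m = norm (mat 1 :: complex ^ 'n ^ 'n)"
  define L1 where "L1 = m + L"
  have L: "0 \<le> L" "0 \<le> m" "0 \<le> L1" using holder_bound_nonneg[OF H] by (auto simp: m_def L1_def)
  define Ht where "Ht t = (\<lambda>x. (1 - t) *\<^sub>R (mat 1 :: complex ^ 'n ^ 'n) + t *\<^sub>R H x)" for t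
  define St where "St t = (\<lambda>x. t *\<^sub>R S x)" for t
  interpret mv: bounded_bilinear "(*v) :: complex ^ 'n ^ 'n \<Rightarrow> complex ^ 'n \<Rightarrow> complex ^ 'n"
    by (rule bounded_bilinear_matrix_vector)
  interpret bd: bounded_bilinear "bdot :: complex ^ 'n \<Rightarrow> complex ^ 'n \<Rightarrow> complex"
    by (rule bounded_bilinear_bdot)
  have one: "holder_bound \<alpha> m (\<lambda>x. mat 1 :: complex ^ 'n ^ 'n)"
    unfolding holder_bound_def using L by (simp add: m_def)
  have sc: "holder_bound \<alpha> (\<bar>t\<bar> * K) (\<lambda>x. t *\<^sub>R G x)" if "holder_bound \<alpha> K G" for t K and G :: "complex \<Rightarrow> complex ^ 'n ^ 'n"
    by (rule holder_bound_linear[OF that bounded_linear_scaleR_right]) auto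
  have Htb: "holder_bound \<alpha> L1 (Ht t)" "holder_bound \<alpha> L1 (St t)" if t: "0 \<le> t" "t \<le> 1" for t
  proof -
    have "holder_bound \<alpha> (\<bar>1 - t\<bar> * m + \<bar>t\<bar> * L) (Ht t)"
      unfolding Ht_def by (intro holder_bound_add sc one H)
    moreover have "\<bar>1 - t\<bar> * m + \<bar>t\<bar> * L \<le> L1"
      unfolding L1_def using t L by (intro add_mono) (auto simp: mult_left_le_one_le)
    ultimately show "holder_bound \<alpha> L1 (Ht t)" by (rule holder_bound_mono)
    have "holder_bound \<alpha> (\<bar>t\<bar> * L) (St t)" unfolding St_def by (intro sc S)
    moreover have "\<bar>t\<bar> * L \<le> L1"
      unfolding L1_def using t L mult_left_le_one_le[of L t] by simp
    ultimately show "holder_bound \<alpha> L1 (St t)" by (rule holder_bound_mono)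
  qed
  have et: "energy (min \<epsilon> 1) (Ht t) (St t)" if t: "0 \<le> t" "t \<le> 1" for t
    unfolding energy_def
  proof (intro ballI allI)
    fix x :: complex and v :: "complex ^ 'n" assume x: "x \<in> sphere 0 1"
    have n: "bdot v (vcnj v) = of_real ((norm v)\<^sup>2)"
      by (simp add: bdot_def norm_vec_def L2_set_def sum_nonneg complex_norm_square[symmetric])
    have "min \<epsilon> 1 * (norm v)\<^sup>2 = (1 - t) * (min \<epsilon> 1 * (norm v)\<^sup>2) + t * (min \<epsilon> 1 * (norm v)\<^sup>2)"
      by (simp add: algebra_simps)
    also have "\<dots> \<le> (1 - t) * (norm v)\<^sup>2 + t * (\<epsilon> * (norm v)\<^sup>2)"
      using t by (intro add_mono mult_left_mono mult_right_mono mult_left_le_one_le) (use \<epsilon> in \<open>auto simp: mult_left_le_one_le\<close>)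
    also have "\<dots> \<le> (1 - t) * (norm v)\<^sup>2 + t * Re (bdot v (H x *v vcnj v + S x *v v))"
      using e x t unfolding energy_def by (intro add_left_mono mult_left_mono) auto
    also have "\<dots> = Re (bdot v (Ht t x *v vcnj v + St t x *v v))"
      unfolding Ht_def St_def mv.add_left mv.scaleR_left bd.add_right bd.scaleR_right matrix_vector_mul_lid n
      by (simp add: algebra_simps)
    finally show "min \<epsilon> 1 * (norm v)\<^sup>2 \<le> Re (bdot v (Ht t x *v vcnj v + St t x *v v))" .
  qed
  have e1: "0 < min \<epsilon> 1" using \<epsilon> by simp
  obtain C where C: "0 < C" and ap:
    "\<And>(H :: complex \<Rightarrow> complex ^ 'n ^ 'n) S F v p K.
      \<lbrakk>holder_bound \<alpha> L1 H; holder_bound \<alpha> L1 S; energy (min \<epsilon> 1) H S; holo_disc v; v 0 = 0; holo_disc p;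
       holder_bound \<alpha> K F; \<And>x. x \<in> sphere 0 1 \<Longrightarrow> H x *v vcnj (v x) + S x *v v x + F x = p x\<rbrakk>
      \<Longrightarrow> holder_bound \<alpha> (C * K) v"
    using apriori_estimate[OF \<alpha> e1 L(3), where 'n='n] by blast
  \<comment> \<open>Each coefficient moves by at most \<open>L1 / N\<close> per step, and the
    halving condition of \<open>solvable_perturb\<close> asks for
    \<open>8 * L1 * C \<le> N\<close>.\<close>
  obtain N :: nat where N: "8 * L1 * C < real N" using reals_Archimedean2 by blast
  have N0: "0 < N"
  proof -
    have "0 \<le> 8 * L1 * C" using L C by simp
    then show ?thesis using N by linarith
  qed
  have "k \<le> N \<Longrightarrow> solvable \<alpha> (Ht (real k / N)) (St (real k / N))" for k
  proof (induction k)
    case 0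
    show ?case using solvable_identity[OF \<alpha>, where 'n='n] by (simp add: Ht_def St_def)
  next
    case (Suc k)
    have t: "0 \<le> real k / N" "real k / N \<le> 1" using Suc.prems N0 by auto
    have "solvable \<alpha> (\<lambda>x. Ht (real k / N) x + (1 / N) *\<^sub>R (H x - mat 1)) (\<lambda>x. St (real k / N) x + (1 / N) *\<^sub>R S x)"
    proof (rule solvable_perturb[OF _ C _ Htb[OF t]])
      show "solvable \<alpha> (Ht (real k / N)) (St (real k / N))" using Suc by simp
      show "4 * (1 / N * L1) * C \<le> 1 / 2" using N N0 by (simp add: field_simps)
      have "holder_bound \<alpha> (L + m) (\<lambda>x. H x - mat 1)" by (rule holder_bound_diff[OF H one])
      then show "holder_bound \<alpha> (1 / N * L1) (\<lambda>x. (1 / N) *\<^sub>R (H x - mat 1))"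
        using sc[of "L + m" _ "1 / N"] by (simp add: L1_def add.commute)
      have "holder_bound \<alpha> L1 S" using S by (rule holder_bound_mono) (use L in \<open>simp add: L1_def\<close>)
      then show "holder_bound \<alpha> (1 / N * L1) (\<lambda>x. (1 / N) *\<^sub>R S x)"
        using sc[of L1 _ "1 / N"] by simp
    qed (rule ap[OF Htb[OF t] et[OF t]])
    moreover have "Ht (real k / N) x + (1 / N) *\<^sub>R (H x - mat 1) = Ht (real (Suc k) / N) x" for x
      by (simp add: Ht_def algebra_simps add_divide_distrib)
    moreover have "St (real k / N) x + (1 / N) *\<^sub>R S x = St (real (Suc k) / N) x" for x
      by (simp add: St_def algebra_simps add_divide_distrib)
    ultimately show ?case by (simp only:)
  qed
  from this[of N] show ?thesis using N0 by (simp add: Ht_def St_def)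
qed

section \<open>Solutions with two zeros\<close>

text \<open>The integrable majorant for poles tending to the circle: a sum over the three possible
  positions of the singularity on the parameter line.\<close>

lemma boundary_dominator:
  assumes \<alpha>: "0 < \<alpha>" "\<alpha> < 1" and a: "a \<in> sphere 0 1"
  obtains h where "h integrable_on {0..1::real}" "\<And>t. t \<in> {0..1} \<Longrightarrow> 0 \<le> h t"
    "\<And>t. t \<in> {0..1} \<Longrightarrow> cis (2 * pi * t) \<noteq> a \<Longrightarrow> cmod (cis (2 * pi * t) - a) powr (\<alpha> - 1) \<le> h t"
proof -
  obtain s where s: "s \<in> {0..1}" "a = cis (2 * pi * s)" using a by (rule sphere_cisE)
  define h where "h t = \<bar>t - s\<bar> powr (\<alpha> - 1) + \<bar>t - (s - 1)\<bar> powr (\<alpha> - 1) + \<bar>t - (s + 1)\<bar> powr (\<alpha> - 1)" for t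
  show ?thesis
  proof (rule that[of h])
    show "h integrable_on {0..1}"
      unfolding h_def by (intro integrable_add integrable_abs_powr \<alpha>)
    show "0 \<le> h t" for t unfolding h_def by simp
    fix t :: real assume t: "t \<in> {0..1}" "cis (2 * pi * t) \<noteq> a"
    obtain b where b: "b \<in> {s, s - 1, s + 1}" "\<bar>t - b\<bar> \<le> cmod (cis (2 * pi * t) - cis (2 * pi * s))"
      using s(1) t(1) by (rule sphere_dist_ge)
    have "cis (2 * pi * b) = a"
      using b(1) s(2) by (auto simp: right_diff_distrib distrib_left cis_mult[symmetric] cis_divide[symmetric])
    then have "t \<noteq> b" using t(2) by auto
    then have "cmod (cis (2 * pi * t) - a) powr (\<alpha> - 1) \<le> \<bar>t - b\<bar> powr (\<alpha> - 1)"
      using b(2) s(2) \<alpha> by (intro powr_mono2') auto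
    also have "\<dots> \<le> h t" using b(1) unfolding h_def by (auto intro: add_increasing add_increasing2)
    finally show "cmod (cis (2 * pi * t) - a) powr (\<alpha> - 1) \<le> h t" .
  qed
qed

lemma one_minus_cnj_nonzero:
  assumes "cmod a < 1" "cmod x \<le> 1" shows "1 - cnj a * x \<noteq> 0"
proof
  assume "1 - cnj a * x = 0"
  then have "cmod a * cmod x = 1" by (metis complex_mod_cnj eq_iff_diff_eq_0 norm_mult norm_one)
  moreover have "cmod a * cmod x \<le> cmod a * 1" using assms by (intro mult_left_mono) auto
  ultimately show False using assms by simp
qed

text \<open>For \<open>cmod a < 1\<close> this is the mean value property. For \<open>a\<close> on
  the circle, replace it by \<open>r * a\<close> and let \<open>r\<close> tend to 1: since
  \<open>cmod (x - a) \<le> 2 * cmod (1 - r * cnj a * x)\<close>, the decay of \<open>q\<close> at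
  \<open>a\<close> yields a majorant of order \<open>cmod (x - a) powr (\<alpha> - 1)\<close>
  independent of \<open>r\<close>.\<close>

lemma cmean_szego:
  assumes \<alpha>: "0 < \<alpha>" "\<alpha> < 1" and q: "continuous_on (cball 0 1) q" "q holomorphic_on ball 0 1"
    and a: "a \<in> cball 0 1"
    and b: "cmod a = 1 \<Longrightarrow> \<exists>C. \<forall>x\<in>sphere 0 1. cmod (q x) \<le> C * cmod (x - a) powr \<alpha>"
  shows "cint (\<lambda>x. q x / (1 - cnj a * x))" "cmean (\<lambda>x. q x / (1 - cnj a * x)) = q 0"
proof -
  have inside: "cint (\<lambda>x. q x / (1 - cnj b * x)) \<and> cmean (\<lambda>x. q x / (1 - cnj b * x)) = q 0" if "cmod b < 1" for b
  proof -
    have ne: "1 - cnj b * x \<noteq> 0" if "cmod x \<le> 1" for x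
      by (rule one_minus_cnj_nonzero) fact+
    have c: "continuous_on (cball 0 1) (\<lambda>x. q x / (1 - cnj b * x))"
      using ne by (intro continuous_intros q) auto
    have h: "(\<lambda>x. q x / (1 - cnj b * x)) holomorphic_on ball 0 1"
      using ne by (intro holomorphic_intros q) auto
    have "continuous_on (sphere 0 1) (\<lambda>x. q x / (1 - cnj b * x))"
      using c by (rule continuous_on_subset) auto
    then show ?thesis using cmean_value[OF c h] by (auto intro: cint_continuous)
  qed
  have "cint (\<lambda>x. q x / (1 - cnj a * x)) \<and> cmean (\<lambda>x. q x / (1 - cnj a * x)) = q 0"
  proof (cases "cmod a < 1")
    case True then show ?thesis by (rule inside)
  next
    case False
    then have na: "cmod a = 1" using a by simp
    have aa: "cnj a * a = 1" using na by (metis complex_norm_square mult.commute of_real_1 power_one)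
    obtain C where C: "\<And>x. x \<in> sphere 0 1 \<Longrightarrow> cmod (q x) \<le> C * cmod (x - a) powr \<alpha>" using b[OF na] by blast
    obtain h where h: "h integrable_on {0..1::real}" "\<And>t. t \<in> {0..1} \<Longrightarrow> 0 \<le> h t"
      "\<And>t. t \<in> {0..1} \<Longrightarrow> cis (2 * pi * t) \<noteq> a \<Longrightarrow> cmod (cis (2 * pi * t) - a) powr (\<alpha> - 1) \<le> h t"
      using boundary_dominator[of \<alpha> a] \<alpha> na by auto
    have C0: "C \<ge> 0"
    proof -
      have "0 \<le> C * cmod (- a - a) powr \<alpha>" using C[of "- a"] na by (simp add: order_trans[OF norm_ge_zero])
      moreover have "- a - a \<noteq> 0" using na by auto
      ultimately show ?thesis by (simp add: zero_le_mult_iff)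
    qed
    define r where "r k = 1 - 1 / real (Suc k)" for k
    have r: "0 \<le> r k" "r k < 1" for k by (auto simp: r_def)
    have rlim: "r \<longlonglongrightarrow> 1"
      unfolding r_def using tendsto_diff[OF tendsto_const LIMSEQ_inverse_real_of_nat, of 1] by (simp add: inverse_eq_divide)
    define f where "f k t = q (cis (2 * pi * t)) / (1 - cnj (of_real (r k) * a) * cis (2 * pi * t))" for k t
    have ins: "cint (\<lambda>x. q x / (1 - cnj (of_real (r k) * a) * x)) \<and> cmean (\<lambda>x. q x / (1 - cnj (of_real (r k) * a) * x)) = q 0" for k
      by (rule inside) (use r na in \<open>simp add: norm_mult\<close>)
    have fint: "f k integrable_on {0..1}" "integral {0..1} (f k) = q 0" for k
      using ins[of k] unfolding cint_def cmean_def f_def by auto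
    have D1: "(\<lambda>t. 2 * C * h t) integrable_on {0..1}" using integrable_on_mult_right[OF h(1)] by simp
    have D2: "norm (f k t) \<le> 2 * C * h t" if t: "t \<in> {0..1}" for k t
    proof -
      let ?x = "cis (2 * pi * t)"
      let ?w = "cmod (1 - cnj (of_real (r k) * a) * ?x)"
      show ?thesis
      proof (cases "?x = a")
        case True
        then have "q ?x = 0" using C[of a] na by simp
        then show ?thesis using h(2)[OF t] C0 by (simp add: f_def)
      next
        case False
        have e: "1 - cnj (of_real (r k) * a) * ?x = cnj a * (a - of_real (r k) * ?x)"
          using aa by (simp add: algebra_simps)
        have w: "?w = cmod (a - of_real (r k) * ?x)" unfolding e norm_mult using na by simp
        have "1 - r k \<le> ?w"
          unfolding w using norm_triangle_ineq2[of a "of_real (r k) * ?x"] na r[of k] by (simp add: norm_mult)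
        moreover have "cmod (?x - a) \<le> (1 - r k) + ?w"
        proof -
          have "?x - a = of_real (1 - r k) * ?x - (a - of_real (r k) * ?x)" by (simp add: algebra_simps)
          then have "cmod (?x - a) \<le> cmod (of_real (1 - r k) * ?x) + ?w" unfolding w by (metis norm_triangle_ineq4)
          also have "cmod (of_real (1 - r k) * ?x) = 1 - r k"
            unfolding norm_mult norm_of_real using r[of k] by simp
          finally show ?thesis .
        qed
        ultimately have w2: "cmod (?x - a) / 2 \<le> ?w" by simp
        have xp: "0 < cmod (?x - a)" using False by simp
        have "norm (f k t) = cmod (q ?x) / ?w" unfolding f_def by (rule norm_divide)
        also have "\<dots> \<le> (C * cmod (?x - a) powr \<alpha>) / (cmod (?x - a) / 2)"
          using w2 xp C[of ?x] C0 by (intro frac_le) auto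
        also have "\<dots> = 2 * C * cmod (?x - a) powr (\<alpha> - 1)" using xp by (simp add: powr_diff)
        also have "\<dots> \<le> 2 * C * h t" using h(3)[OF t False] C0 by (intro mult_left_mono) auto
        finally show ?thesis .
      qed
    qed
    have D3: "(\<lambda>k. f k t) \<longlonglongrightarrow> q (cis (2 * pi * t)) / (1 - cnj a * cis (2 * pi * t))" if "t \<in> {0..1}" for t
    proof (cases "cis (2 * pi * t) = a")
      \<comment> \<open>Decay forces \<open>q a = 0\<close>, so all terms vanish here, and so does
        the limit \<open>0 / 0\<close> by the convention for division.\<close>
      case True
      then have "q (cis (2 * pi * t)) = 0" using C[of a] na by simp
      then show ?thesis by (simp add: f_def)
    next
      case False
      have "1 - cnj a * cis (2 * pi * t) \<noteq> 0"
      proof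
        assume "1 - cnj a * cis (2 * pi * t) = 0"
        then have "a * (cnj a * cis (2 * pi * t)) = a" by simp
        then show False using aa False by (simp add: mult.assoc[symmetric] mult.commute[of a])
      qed
      then have "(\<lambda>k. q (cis (2 * pi * t)) / (1 - cnj (of_real (r k) * a) * cis (2 * pi * t)))
          \<longlonglongrightarrow> q (cis (2 * pi * t)) / (1 - cnj (of_real 1 * a) * cis (2 * pi * t))"
        by (intro tendsto_intros tendsto_of_real rlim) auto
      then show ?thesis unfolding f_def by simp
    qed
    note dc = dominated_convergence[OF fint(1) D1 D2 D3]
    have "integral {0..1} (\<lambda>t. q (cis (2 * pi * t)) / (1 - cnj a * cis (2 * pi * t))) = q 0"
      using dc(2) unfolding fint(2) by (simp add: LIMSEQ_const_iff)
    then show ?thesis using dc(1) unfolding cint_def cmean_def by simp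
  qed
  then show "cint (\<lambda>x. q x / (1 - cnj a * x))" "cmean (\<lambda>x. q x / (1 - cnj a * x)) = q 0" by auto
qed

text \<open>Inside the disc this is Cauchy's formula. On the circle
  \<open>1 - cnj a * x = - cnj a * (x - a)\<close> turns the kernel into the previous one, with a
  numerator that contains the factor \<open>x\<close> and so vanishes at 0.\<close>

lemma cmean_cauchy_zero:
  assumes \<alpha>: "0 < \<alpha>" "\<alpha> < 1" and q: "continuous_on (cball 0 1) q" "q holomorphic_on ball 0 1"
    and a: "a \<in> cball 0 1" "q a = 0"
    and b: "cmod a = 1 \<Longrightarrow> \<exists>C. \<forall>x\<in>sphere 0 1. cmod (q x) \<le> C * cmod (x - a) powr \<alpha>"
  shows "cint (\<lambda>x. x * q x / (x - a))" "cmean (\<lambda>x. x * q x / (x - a)) = 0"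
proof -
  have "cint (\<lambda>x. x * q x / (x - a)) \<and> cmean (\<lambda>x. x * q x / (x - a)) = 0"
  proof (cases "cmod a < 1")
    case True
    have "continuous_on (sphere 0 1) q" using q(1) by (rule continuous_on_subset) auto
    then have "cint (\<lambda>x. x * q x / (x - a))"
      using True by (intro cint_continuous) (auto intro!: continuous_intros)
    then show ?thesis using cmean_Cauchy[OF q True] a by simp
  next
    case False
    then have na: "cmod a = 1" using a by simp
    have aa: "cnj a * a = 1" using na by (metis complex_norm_square mult.commute of_real_1 power_one)
    have eq: "x * q x / (x - a) = (- cnj a * (x * q x)) / (1 - cnj a * x)" for x
    proof -
      have "1 - cnj a * x = (- cnj a) * (x - a)" using aa by (simp add: algebra_simps)
      moreover have "cnj a \<noteq> 0" using na by auto
      ultimately show ?thesis by simp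
    qed
    have c: "continuous_on (cball 0 1) (\<lambda>x. - cnj a * (x * q x))" by (intro continuous_intros q)
    have h: "(\<lambda>x. - cnj a * (x * q x)) holomorphic_on ball 0 1" by (intro holomorphic_intros q)
    have b': "\<exists>C. \<forall>x\<in>sphere 0 1. cmod (- cnj a * (x * q x)) \<le> C * cmod (x - a) powr \<alpha>"
      using b[OF na] na by (simp add: norm_mult)
    show ?thesis
      using cmean_szego[OF \<alpha> c h a(1) b'] unfolding eq by simp
  qed
  then show "cint (\<lambda>x. x * q x / (x - a))" "cmean (\<lambda>x. x * q x / (x - a)) = 0" by auto
qed

section \<open>Multiplication by complex functions, and Hoelder criteria\<close>

definition cscale :: "complex \<Rightarrow> complex ^ 'n ^ 'm \<Rightarrow> complex ^ 'n ^ 'm" where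
  "cscale c A = (\<chi> i. c *s A $ i)"

lemma norm_vector_scale: "norm (c *s (v :: complex ^ 'n)) = cmod c * norm v"
  unfolding norm_vec_def by (simp add: norm_mult L2_set_right_distrib)

lemma norm_cscale: "norm (cscale c A) = cmod c * norm A"
proof -
  have "norm (cscale c A) = L2_set (\<lambda>i. norm (cscale c A $ i)) UNIV" by (rule norm_vec_def)
  also have "\<dots> = L2_set (\<lambda>i. cmod c * norm (A $ i)) UNIV" by (simp add: cscale_def norm_vector_scale)
  also have "\<dots> = cmod c * norm A"
    unfolding norm_vec_def[of A] by (rule L2_set_right_distrib[symmetric]) simp
  finally show ?thesis .
qed

lemma cscale_mult: "cscale c A *v v = c *s (A *v v)"
  by (simp add: cscale_def matrix_vector_mult_def vec_eq_iff sum_distrib_left mult.assoc)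

lemma bounded_bilinear_cscale: "bounded_bilinear (cscale :: complex \<Rightarrow> complex ^ 'n ^ 'm \<Rightarrow> _)"
proof
  show "\<exists>K. \<forall>a (b :: complex ^ 'n ^ 'm). norm (cscale a b) \<le> norm a * norm b * K"
    by (rule exI[of _ 1]) (simp add: norm_cscale)
qed (auto simp: cscale_def vec_eq_iff algebra_simps)

lemma bounded_bilinear_vector_scale: "bounded_bilinear ((*s) :: complex \<Rightarrow> complex ^ 'n \<Rightarrow> _)"
proof
  show "\<exists>K. \<forall>a (b :: complex ^ 'n). norm (a *s b) \<le> norm a * norm b * K"
    by (rule exI[of _ 1]) (simp add: norm_vector_scale)
qed (auto simp: vec_eq_iff algebra_simps)

lemma holder_bound_exists:
  fixes F :: "complex \<Rightarrow> 'a::real_normed_vector"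
  assumes \<alpha>: "0 < \<alpha>" and M0: "0 \<le> M"
    and M: "\<And>x y. x \<in> sphere 0 1 \<Longrightarrow> y \<in> sphere 0 1 \<Longrightarrow> norm (F x - F y) \<le> M * norm (x - y) powr \<alpha>"
  shows "\<exists>K. holder_bound \<alpha> K F"
proof -
  have "holder_bound \<alpha> (norm (F 1) + M * 2 powr \<alpha> + M) F"
    unfolding holder_bound_def
  proof (intro conjI ballI)
    fix x :: complex assume x: "x \<in> sphere 0 1"
    have "norm (x - 1) \<le> 2" using norm_triangle_ineq4[of x 1] x by simp
    then have "M * norm (x - 1) powr \<alpha> \<le> M * 2 powr \<alpha>" using M0 \<alpha> by (intro mult_left_mono powr_mono2) auto
    then show "norm (F x) \<le> norm (F 1) + M * 2 powr \<alpha> + M"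
      using M[OF x, of 1] M0 norm_triangle_sub[of "F x" "F 1"] by simp
    fix y :: complex assume y: "y \<in> sphere 0 1"
    have "M * norm (x - y) powr \<alpha> \<le> (norm (F 1) + M * 2 powr \<alpha> + M) * norm (x - y) powr \<alpha>"
      using M0 by (intro mult_right_mono) auto
    then show "norm (F x - F y) \<le> (norm (F 1) + M * 2 powr \<alpha> + M) * norm (x - y) powr \<alpha>"
      using M[OF x y] by linarith
  qed
  then show ?thesis by blast
qed

lemma holder_bound_lipschitz:
  fixes g :: "complex \<Rightarrow> 'a::real_normed_vector"
  assumes \<alpha>: "0 < \<alpha>" "\<alpha> < 1" and M: "0 \<le> M"
    and l: "\<And>x y. x \<in> sphere 0 1 \<Longrightarrow> y \<in> sphere 0 1 \<Longrightarrow> norm (g x - g y) \<le> M * norm (x - y)"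
  shows "\<exists>K. holder_bound \<alpha> K g"
proof (rule holder_bound_exists[OF \<alpha>(1)])
  fix x y :: complex assume x: "x \<in> sphere 0 1" "y \<in> sphere 0 1"
  have "norm (x - y) \<le> 2 * norm (x - y) powr \<alpha>"
  proof (cases "x = y")
    case False
    have 2: "norm (x - y) \<le> 2" using norm_triangle_ineq4[of x y] x by simp
    have "norm (x - y) = norm (x - y) powr (1 - \<alpha>) * norm (x - y) powr \<alpha>"
      using False by (simp add: powr_add[symmetric])
    also have "\<dots> \<le> 2 powr 1 * norm (x - y) powr \<alpha>"
    proof (intro mult_right_mono)
      have "norm (x - y) powr (1 - \<alpha>) \<le> 2 powr (1 - \<alpha>)" using 2 \<alpha> by (intro powr_mono2) auto
      also have "\<dots> \<le> 2 powr 1" using \<alpha> by (intro powr_mono) auto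
      finally show "norm (x - y) powr (1 - \<alpha>) \<le> 2 powr 1" .
    qed simp
    finally show ?thesis by simp
  qed simp
  then have "M * norm (x - y) \<le> M * (2 * norm (x - y) powr \<alpha>)" using M by (rule mult_left_mono)
  then show "norm (g x - g y) \<le> 2 * M * norm (x - y) powr \<alpha>" using l[OF x] by simp
qed (use M in simp)

text \<open>The Blaschke factor at \<open>a\<close>, continued by its boundary value \<open>- a\<close> when \<open>\<bar>a\<bar> = 1\<close>.\<close>

definition blaschke :: "complex \<Rightarrow> complex \<Rightarrow> complex" where
  "blaschke a x = (if cmod a = 1 then - a else (x - a) / (1 - cnj a * x))"

text \<open>Separates the zero at \<open>a\<close> into a unimodular Hoelder function, to be moved
  into \<open>S\<close>, and \<open>1 - cnj a * x\<close>, whose reciprocal is holomorphic in the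
  open disc.\<close>

lemma blaschke_factor:
  assumes "a \<in> cball 0 1" "x \<in> sphere 0 1" shows "x - a = blaschke a x * (1 - cnj a * x)"
proof (cases "cmod a = 1")
  case True
  then have "a * cnj a = 1" by (simp add: complex_norm_square[symmetric])
  then show ?thesis using True by (simp add: blaschke_def algebra_simps)
next
  case False
  then show ?thesis using one_minus_cnj_nonzero[of a x] assms by (simp add: blaschke_def)
qed

lemma cnj_diff_sphere:
  assumes "x \<in> sphere 0 1" shows "cnj (x - a) = cnj x * (1 - cnj a * x)"
proof -
  have "cnj x * x = 1" using assms by (metis complex_norm_square mult.commute of_real_1 power_one mem_sphere_0)
  then show ?thesis by (simp add: algebra_simps)
qed

lemma norm_blaschke:
  assumes "a \<in> cball 0 1" "x \<in> sphere 0 1" shows "cmod (blaschke a x) = 1"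
proof (cases "cmod a = 1")
  case False
  then have "1 - cnj a * x \<noteq> 0" using assms by (intro one_minus_cnj_nonzero) auto
  moreover have "cmod (x - a) = cmod (1 - cnj a * x)"
    using arg_cong[OF cnj_diff_sphere[OF assms(2), of a], of cmod] assms(2)
    by (simp only: complex_mod_cnj norm_mult) simp
  ultimately show ?thesis using False by (simp add: blaschke_def norm_divide)
qed (simp add: blaschke_def)

lemma holder_blaschke:
  assumes \<alpha>: "0 < \<alpha>" "\<alpha> < 1" and a: "a \<in> cball 0 1"
  shows "\<exists>K. holder_bound \<alpha> K (blaschke a)"
proof (cases "cmod a = 1")
  case True
  then show ?thesis by (intro holder_bound_lipschitz[OF \<alpha>, of 0]) (auto simp: blaschke_def)
next
  case False
  then have a1: "cmod a < 1" using a by simp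
  define m where "m = 1 - cmod a"
  have m: "0 < m" "m \<le> 1" using a1 by (auto simp: m_def)
  have low: "m \<le> cmod (1 - cnj a * x)" if "x \<in> sphere 0 1" for x
    using norm_triangle_ineq2[of 1 "cnj a * x"] that by (simp add: norm_mult m_def)
  show ?thesis
  proof (rule holder_bound_lipschitz[OF \<alpha>])
    fix x y :: complex assume x: "x \<in> sphere 0 1" "y \<in> sphere 0 1"
    have ne: "1 - cnj a * x \<noteq> 0" "1 - cnj a * y \<noteq> 0" using one_minus_cnj_nonzero[OF a1] x by auto
    have "blaschke a x - blaschke a y = ((x - a) * (1 - cnj a * y) - (y - a) * (1 - cnj a * x)) / ((1 - cnj a * x) * (1 - cnj a * y))"
      using False ne by (simp add: blaschke_def diff_frac_eq)
    also have "(x - a) * (1 - cnj a * y) - (y - a) * (1 - cnj a * x) = (x - y) * (1 - a * cnj a)"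
      by (simp add: algebra_simps)
    finally have "cmod (blaschke a x - blaschke a y) = cmod (x - y) * cmod (1 - a * cnj a) / (cmod (1 - cnj a * x) * cmod (1 - cnj a * y))"
      by (simp only: norm_mult norm_divide)
    also have "\<dots> \<le> cmod (x - y) * 1 / (m * m)"
    proof (intro frac_le mult_mono mult_nonneg_nonneg mult_left_mono)
      have "1 - a * cnj a = of_real (1 - (cmod a)\<^sup>2)"
        by (simp only: of_real_diff of_real_1 complex_norm_square)
      then show "cmod (1 - a * cnj a) \<le> 1" using a1 by (simp only: norm_of_real) (simp add: abs_le_iff power_le_one)
    qed (use low x m in auto)
    finally show "cmod (blaschke a x - blaschke a y) \<le> 1 / m\<^sup>2 * cmod (x - y)"
      by (simp add: power2_eq_square)
  qed (use m in simp)
qed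

lemma holder_bound_mult:
  fixes F G :: "complex \<Rightarrow> complex"
  assumes "\<exists>K. holder_bound \<alpha> K F" "\<exists>K. holder_bound \<alpha> K G"
  shows "\<exists>K. holder_bound \<alpha> K (\<lambda>x. F x * G x)"
proof -
  obtain K L where "holder_bound \<alpha> K F" "holder_bound \<alpha> L G" using assms by blast
  from holder_bound_bilinear[OF bounded_bilinear_mult _ this] show ?thesis by (auto simp: norm_mult)
qed

text \<open>The two pairings are complex conjugates of each other, so it is their real parts that
  agree.\<close>

lemma hermitian_bdot:
  fixes A :: "complex ^ 'n ^ 'n"
  assumes "\<And>i j. A $ i $ j = cnj (A $ j $ i)"
  shows "Re (bdot v (A *v vcnj w)) = Re (bdot w (A *v vcnj v))"
proof -
  have "cnj (bdot v (A *v vcnj w)) = (\<Sum>i\<in>UNIV. \<Sum>j\<in>UNIV. w $ j * (A $ j $ i * cnj (v $ i)))"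
    unfolding bdot_def matrix_vector_mult_def
    by (simp add: sum_distrib_left assms[symmetric] mult_ac)
  also have "\<dots> = bdot w (A *v vcnj v)"
    unfolding bdot_def matrix_vector_mult_def
    by (subst sum.swap) (simp add: sum_distrib_left)
  finally show ?thesis by (metis complex_cnj(1) complex_cnj_cnj cnj.simps(1))
qed

lemma symmetric_bdot:
  fixes A :: "complex ^ 'n ^ 'n"
  assumes "transpose A = A"
  shows "bdot v (A *v w) = bdot w (A *v v)"
proof -
  have a: "A $ i $ j = A $ j $ i" for i j by (metis assms transpose_def vec_lambda_beta)
  have "bdot v (A *v w) = (\<Sum>i\<in>UNIV. \<Sum>j\<in>UNIV. w $ j * (A $ j $ i * v $ i))"
    unfolding bdot_def matrix_vector_mult_def
    by (simp add: sum_distrib_left a mult_ac)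
  also have "\<dots> = bdot w (A *v v)"
    unfolding bdot_def matrix_vector_mult_def
    by (subst sum.swap) (simp add: sum_distrib_left)
  finally show ?thesis .
qed

section \<open>Pairings with two poles\<close>

lemma partial_fractions_Cauchy:
  assumes "a \<noteq> b" "x \<noteq> a" "x \<noteq> (b :: complex)"
  shows "y / ((x - a) * (x - b)) = (y / (x - a) - y / (x - b)) / (a - b)"
proof -
  have "y / (x - a) - y / (x - b) = y * (a - b) / ((x - a) * (x - b))"
    using assms by (simp add: divide_simps) (simp add: algebra_simps)
  then show ?thesis using assms by simp
qed

lemma partial_fractions_Szego:
  assumes "a \<noteq> b" "1 - a * x \<noteq> 0" "1 - b * x \<noteq> (0 :: complex)"
  shows "y / ((1 - a * x) * (1 - b * x)) = (a * (y / (1 - a * x)) - b * (y / (1 - b * x))) / (a - b)"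
proof -
  have "a * (y / (1 - a * x)) - b * (y / (1 - b * x)) = y * (a - b) / ((1 - a * x) * (1 - b * x))"
    using assms by (simp add: divide_simps) (simp add: algebra_simps)
  then show ?thesis using assms by simp
qed

lemma cint_cmult: "cint f \<Longrightarrow> cint (\<lambda>x. c * f x)" for c :: complex
  by (rule cint_linear[OF bounded_linear_mult_right])

text \<open>Distinctness of \<open>a\<close> and \<open>b\<close> enters here: partial fractions
  leave two simple poles, each with mean 0. At \<open>x = a\<close> and \<open>x = b\<close> both
  sides of the splitting are 0, since \<open>q\<close> vanishes there.\<close>

lemma cmean_double_pole:
  assumes \<alpha>: "0 < \<alpha>" "\<alpha> < 1" and q: "continuous_on (cball 0 1) q" "q holomorphic_on ball 0 1"
    and ab: "a \<in> cball 0 1" "b \<in> cball 0 1" "a \<noteq> b" "q a = 0" "q b = 0"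
    and C: "\<And>c x. c \<in> {a, b} \<Longrightarrow> cmod c = 1 \<Longrightarrow> x \<in> sphere 0 1 \<Longrightarrow> cmod (q x) \<le> C * cmod (x - c) powr \<alpha>"
  shows "cint (\<lambda>x. x * q x / ((x - a) * (x - b)))" "cmean (\<lambda>x. x * q x / ((x - a) * (x - b))) = 0"
proof -
  note A = cmean_cauchy_zero[OF \<alpha> q ab(1,4)] and B = cmean_cauchy_zero[OF \<alpha> q ab(2,5)]
  have a1: "\<exists>C. \<forall>x\<in>sphere 0 1. cmod (q x) \<le> C * cmod (x - a) powr \<alpha>" if "cmod a = 1" using C that by blast
  have b1: "\<exists>C. \<forall>x\<in>sphere 0 1. cmod (q x) \<le> C * cmod (x - b) powr \<alpha>" if "cmod b = 1" using C that by blast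
  have eq: "x * q x / ((x - a) * (x - b)) = (x * q x / (x - a) - x * q x / (x - b)) / (a - b)" for x
    by (cases "x = a \<or> x = b") (use ab in \<open>auto simp: partial_fractions_Cauchy\<close>)
  note i = cint_diff[OF A(1)[OF a1] B(1)[OF b1]]
  show "cint (\<lambda>x. x * q x / ((x - a) * (x - b)))"
    unfolding eq by (rule cint_linear[OF bounded_linear_divide i])
  show "cmean (\<lambda>x. x * q x / ((x - a) * (x - b))) = 0"
  proof -
    have "cmean (\<lambda>x. (x * q x / (x - a) - x * q x / (x - b)) / (a - b))
        = cmean (\<lambda>x. x * q x / (x - a) - x * q x / (x - b)) / (a - b)"
      by (rule cmean_linear[OF bounded_linear_divide i])
    also have "cmean (\<lambda>x. x * q x / (x - a) - x * q x / (x - b)) = 0"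
      using cmean_diff[OF A(1)[OF a1] B(1)[OF b1]] A(2)[OF a1] B(2)[OF b1] by simp
    finally show ?thesis unfolding eq by simp
  qed
qed

text \<open>The same for poles reflected in the circle, where each simple term contributes a
  multiple of \<open>q 0 = 0\<close>.\<close>

lemma cmean_double_szego:
  assumes \<alpha>: "0 < \<alpha>" "\<alpha> < 1" and q: "continuous_on (cball 0 1) q" "q holomorphic_on ball 0 1" "q 0 = 0"
    and ab: "a \<in> cball 0 1" "b \<in> cball 0 1" "a \<noteq> b"
    and z: "\<And>x. x \<in> {a, b} \<Longrightarrow> cmod x = 1 \<Longrightarrow> q x = 0"
    and C: "\<And>c x. c \<in> {a, b} \<Longrightarrow> cmod c = 1 \<Longrightarrow> x \<in> sphere 0 1 \<Longrightarrow> cmod (q x) \<le> C * cmod (x - c) powr \<alpha>"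
  shows "cint (\<lambda>x. q x / ((1 - cnj a * x) * (1 - cnj b * x)))"
    "cmean (\<lambda>x. q x / ((1 - cnj a * x) * (1 - cnj b * x))) = 0"
proof -
  note A = cmean_szego[OF \<alpha> q(1,2) ab(1)] and B = cmean_szego[OF \<alpha> q(1,2) ab(2)]
  have a1: "\<exists>C. \<forall>x\<in>sphere 0 1. cmod (q x) \<le> C * cmod (x - a) powr \<alpha>" if "cmod a = 1" using C that by blast
  have b1: "\<exists>C. \<forall>x\<in>sphere 0 1. cmod (q x) \<le> C * cmod (x - b) powr \<alpha>" if "cmod b = 1" using C that by blast
  have pole: "cmod c = 1 \<and> x = c" if "c \<in> cball 0 1" "x \<in> sphere 0 1" "1 - cnj c * x = 0" for c x
  proof -
    have c1: "cmod c = 1" using one_minus_cnj_nonzero[of c x] that by force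
    then have "c * cnj c = 1" by (simp add: complex_norm_square[symmetric])
    moreover have "c * (cnj c * x) = c" using that(3) by simp
    ultimately show ?thesis using c1 by (simp add: mult.assoc[symmetric])
  qed
  have eq: "q x / ((1 - cnj a * x) * (1 - cnj b * x))
      = (cnj a * (q x / (1 - cnj a * x)) - cnj b * (q x / (1 - cnj b * x))) / (cnj a - cnj b)"
    if x: "x \<in> sphere 0 1" for x
  proof (cases "1 - cnj a * x = 0 \<or> 1 - cnj b * x = 0")
    case True
    then have "q x = 0" using pole ab x z by blast
    then show ?thesis by simp
  next
    case False
    have "cnj a \<noteq> cnj b" using ab(3) by simp
    with False show ?thesis by (simp only: partial_fractions_Szego de_Morgan_disj not_False_eq_True)
  qed
  note i1 = cint_cmult[OF A(1)[OF a1], of "cnj a"] and i2 = cint_cmult[OF B(1)[OF b1], of "cnj b"]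
  note i = cint_diff[OF i1 i2]
  have m1: "cmean (\<lambda>x. cnj a * (q x / (1 - cnj a * x))) = 0"
    using cmean_linear[OF bounded_linear_mult_right[of "cnj a"] A(1)[OF a1]] A(2)[OF a1] q(3) by simp
  have m2: "cmean (\<lambda>x. cnj b * (q x / (1 - cnj b * x))) = 0"
    using cmean_linear[OF bounded_linear_mult_right[of "cnj b"] B(1)[OF b1]] B(2)[OF b1] q(3) by simp
  let ?g = "\<lambda>x. (cnj a * (q x / (1 - cnj a * x)) - cnj b * (q x / (1 - cnj b * x))) / (cnj a - cnj b)"
  have "cint ?g" by (rule cint_linear[OF bounded_linear_divide i])
  then show "cint (\<lambda>x. q x / ((1 - cnj a * x) * (1 - cnj b * x)))"
    using cint_cong[OF eq] by simp
  have "cmean ?g = cmean (\<lambda>x. cnj a * (q x / (1 - cnj a * x)) - cnj b * (q x / (1 - cnj b * x))) / (cnj a - cnj b)"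
    by (rule cmean_linear[OF bounded_linear_divide i])
  also have "cmean (\<lambda>x. cnj a * (q x / (1 - cnj a * x)) - cnj b * (q x / (1 - cnj b * x))) = 0"
    using cmean_diff[OF i1 i2] unfolding m1 m2 by simp
  finally have "cmean ?g = 0" by simp
  then show "cmean (\<lambda>x. q x / ((1 - cnj a * x) * (1 - cnj b * x))) = 0"
    using cmean_cong[OF eq] by simp
qed

text \<open>Uniqueness is obtained by duality.  Dividing \<open>h\<close> by its two zeros gives a function \<open>v\<close> that is merely
  integrable on the circle if a zero lies there, but that formally solves the homogeneous equation
  for \<open>H\<close> and \<open>\<omega> S\<close> with \<open>\<bar>\<omega>\<bar> = 1\<close>.  The real bilinear form of that equation is
  symmetric, so \<open>v\<close> is orthogonal to every right-hand side \<open>F\<close> for which it is solvable in the Hoelder class, and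
  pairing \<open>v\<close> with a suitable such \<open>F\<close> yields the mean of \<open>\<bar>h\<bar>\<^sup>2\<close>.\<close>

theorem two_zeros_imp_zero:
  fixes H S :: "complex \<Rightarrow> complex ^ 'n ^ 'n"
  assumes \<alpha>: "0 < \<alpha>" "\<alpha> < 1" and \<epsilon>: "0 < \<epsilon>"
    and H: "holder_bound \<alpha> L H" and S: "holder_bound \<alpha> L S"
    and herm: "\<And>x i j. x \<in> sphere 0 1 \<Longrightarrow> H x $ i $ j = cnj (H x $ j $ i)"
    and symm: "\<And>x. x \<in> sphere 0 1 \<Longrightarrow> transpose (S x) = S x"
    and pos: "\<And>x v. x \<in> sphere 0 1 \<Longrightarrow>
       \<epsilon> * (norm v)\<^sup>2 \<le> Re (bdot v (H x *v vcnj v)) - cmod (bdot v (S x *v v))"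
    and h: "holo_disc h" "holder_bound \<alpha> K h" "h a = 0" "h b = 0"
    and p: "holo_disc p" "holder_bound \<alpha> K' p"
    and ab: "a \<in> cball 0 1" "b \<in> cball 0 1" "a \<noteq> b"
    and eq: "\<And>x. x \<in> sphere 0 1 \<Longrightarrow> H x *v vcnj ((1 / x) *s h x) + S x *v ((1 / x) *s h x) = p x"
    and z: "z \<in> cball 0 1"
  shows "h z = 0"
proof -
  have inv_sphere: "1 / x = cnj x" "x * cnj x = 1" "x \<noteq> 0" if "x \<in> sphere 0 1" for x :: complex
  proof -
    show *: "x * cnj x = 1" using that by (simp add: complex_norm_square[symmetric])
    show "x \<noteq> 0" using that by auto
    then show "1 / x = cnj x" using * by (simp add: divide_eq_eq mult.commute)
  qed
  \<comment> \<open>For \<open>v = x h / ((x - a) (x - b))\<close> and \<open>P\<close> as below,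
    \<open>vcnj v\<close> equals \<open>vcnj (h / x) / P\<close>, while \<open>v\<close> is
    \<open>h / x\<close> divided by \<open>om * P\<close>. Multiplying \<open>S\<close> by
    \<open>om\<close> restores a common denominator, and \<open>cmod om = 1\<close> leaves the
    ellipticity intact.\<close>
  define om where "om x = blaschke a x * blaschke b x * (cnj x * cnj x)" for x
  have om1: "cmod (om x) = 1" if "x \<in> sphere 0 1" for x
    using norm_blaschke[OF ab(1) that] norm_blaschke[OF ab(2) that] that by (simp add: om_def norm_mult)
  have hcnj: "\<exists>K. holder_bound \<alpha> K cnj"
    by (rule holder_bound_lipschitz[OF \<alpha>, of 1]) (simp_all add: complex_cnj_diff[symmetric] del: complex_cnj_diff)
  have hom: "\<exists>K. holder_bound \<alpha> K om"
    unfolding om_def by (intro holder_bound_mult holder_blaschke \<alpha> ab hcnj)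
  define So where "So x = cscale (om x) (S x)" for x
  obtain Ko where "holder_bound \<alpha> Ko om" using hom by blast
  then have So: "holder_bound \<alpha> (2 * Ko * L) So"
    unfolding So_def by (intro holder_bound_bilinear[OF bounded_bilinear_cscale _ _ S]) (simp_all add: norm_cscale)
  have HL: "holder_bound \<alpha> (max L (2 * Ko * L)) H" "holder_bound \<alpha> (max L (2 * Ko * L)) So"
    using H So by (auto elim: holder_bound_mono)
  have en: "energy \<epsilon> H So"
    unfolding energy_def
  proof (intro ballI allI)
    fix x :: complex and v :: "complex ^ 'n" assume x: "x \<in> sphere 0 1"
    have "cmod (bdot v (So x *v v)) = cmod (bdot v (S x *v v))"
      unfolding So_def cscale_mult bdot_scale norm_mult om1[OF x] by simp
    then show "\<epsilon> * (norm v)\<^sup>2 \<le> Re (bdot v (H x *v vcnj v + So x *v v))"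
      using pos[OF x, of v] abs_Re_le_cmod[of "bdot v (So x *v v)"] unfolding bdot_add_right by simp
  qed
  \<comment> \<open>Chosen so that its pairing with the singular \<open>v\<close> is
    \<open>(norm (h x))\<^sup>2\<close>, while \<open>F\<close> itself is Hoelder.\<close>
  define F where "F x = (cnj x * ((x - a) * (x - b))) *s vcnj (h x)" for x
  have hlin: "\<exists>K. holder_bound \<alpha> K (\<lambda>x. x - c)" for c
    by (rule holder_bound_lipschitz[OF \<alpha>, of 1]) simp_all
  have "\<exists>K. holder_bound \<alpha> K (\<lambda>x. cnj x * ((x - a) * (x - b)))"
    by (intro holder_bound_mult hcnj hlin)
  then obtain Kc where "holder_bound \<alpha> Kc (\<lambda>x. cnj x * ((x - a) * (x - b)))" by blast
  then have F: "holder_bound \<alpha> (2 * Kc * K) F"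
    unfolding F_def
    by (intro holder_bound_bilinear[OF bounded_bilinear_vector_scale _ _ holder_bound_vcnj[OF h(2)]])
       (simp_all add: norm_vector_scale)
  obtain w X where w: "holo_disc w" "holo_disc X" "w 0 = 0"
    "\<And>x. x \<in> sphere 0 1 \<Longrightarrow> H x *v vcnj (w x) + So x *v w x + F x = X x"
    using solvable_energy[OF \<alpha> \<epsilon> en HL] F unfolding solvable_def by blast
  have bounded: "\<exists>B\<ge>0. \<forall>x\<in>sphere 0 1. norm (g x) \<le> B" if "holo_disc g" for g :: "complex \<Rightarrow> complex ^ 'n"
  proof -
    have "compact (g ` sphere 0 1)" by (intro compact_continuous_image holo_disc_sphere that) simp
    then obtain B where "\<forall>y\<in>g ` sphere 0 1. norm y \<le> B" using compact_imp_bounded bounded_iff by blast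
    then show ?thesis by (intro exI[of _ "max B 0"]) auto
  qed
  have vanish: "cmod (bdot u (g x)) \<le> C * B * cmod (x - c) powr \<alpha> \<and> cmod (bdot (g x) u) \<le> C * B * cmod (x - c) powr \<alpha>"
    if "holder_bound \<alpha> C g" "norm u \<le> B" "c \<in> sphere 0 1" "g c = 0" "x \<in> sphere 0 1"
    for u :: "complex ^ 'n" and g B C c x
  proof -
    have "norm (g x - g c) \<le> C * norm (x - c) powr \<alpha>"
      using that(1,3,5) unfolding holder_bound_def by blast
    then have "norm (g x) * norm u \<le> (C * norm (x - c) powr \<alpha>) * B"
      using that(2,4) by (intro mult_mono) (auto intro: order_trans[OF norm_ge_zero])
    then show ?thesis using norm_bdot_le[of u "g x"] norm_bdot_le[of "g x" u] by (simp add: mult_ac)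
  qed
  define q1 where "q1 x = bdot (h x) (X x)" for x
  define q2 where "q2 x = bdot (w x) (p x)" for x
  define P where "P x = (1 - cnj a * x) * (1 - cnj b * x)" for x
  \<comment> \<open>At a zero on the circle the equation gives \<open>p = 0\<close>; the Hoelder
    bound of \<open>p\<close> then provides the decay that the pole of \<open>1 / P\<close>
    requires.\<close>
  have p0: "p x = 0" if "x \<in> {a, b}" "cmod x = 1" for x
  proof -
    have "h x = 0" using that(1) h(3,4) by auto
    then show ?thesis using eq[of x] that(2) by simp
  qed
  obtain BX where BX: "0 \<le> BX" "\<And>x. x \<in> sphere 0 1 \<Longrightarrow> norm (X x) \<le> BX" using bounded[OF w(2)] by blast
  obtain BW where BW: "0 \<le> BW" "\<And>x. x \<in> sphere 0 1 \<Longrightarrow> norm (w x) \<le> BW" using bounded[OF w(1)] by blast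
  have Q1: "cint (\<lambda>x. x * q1 x / ((x - a) * (x - b)))" "cmean (\<lambda>x. x * q1 x / ((x - a) * (x - b))) = 0"
  proof -
    have 1: "q1 a = 0" "q1 b = 0" using h(3,4) by (simp_all add: q1_def bdot_def)
    have 2: "cmod (q1 x) \<le> K * BX * cmod (x - c) powr \<alpha>" if "c \<in> {a, b}" "cmod c = 1" "x \<in> sphere 0 1" for c x
      using vanish[OF h(2) BX(2)[OF that(3)], of c x] that h(3,4) unfolding q1_def by auto
    have c: "continuous_on (cball 0 1) q1" "q1 holomorphic_on ball 0 1"
      using holo_bdot[OF h(1) w(2)] unfolding q1_def by auto
    show "cint (\<lambda>x. x * q1 x / ((x - a) * (x - b)))" "cmean (\<lambda>x. x * q1 x / ((x - a) * (x - b))) = 0"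
      by (rule cmean_double_pole[OF \<alpha> c ab 1 2]; assumption)+
  qed
  have Q2: "cint (\<lambda>x. q2 x / P x)" "cmean (\<lambda>x. q2 x / P x) = 0"
  proof -
    have 1: "q2 x = 0" if "x \<in> {a, b}" "cmod x = 1" for x using p0[OF that] by (simp add: q2_def bdot_def)
    have 2: "cmod (q2 x) \<le> K' * BW * cmod (x - c) powr \<alpha>" if "c \<in> {a, b}" "cmod c = 1" "x \<in> sphere 0 1" for c x
      using vanish[OF p(2) BW(2)[OF that(3)], of c x] that p0[of c] unfolding q2_def by auto
    have c: "continuous_on (cball 0 1) q2" "q2 holomorphic_on ball 0 1" "q2 0 = 0"
      using holo_bdot[OF w(1) p(1)] w(3) unfolding q2_def by (auto simp: bdot_def)
    show "cint (\<lambda>x. q2 x / P x)" "cmean (\<lambda>x. q2 x / P x) = 0"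
      unfolding P_def by (rule cmean_double_szego[OF \<alpha> c ab 1 2]; assumption)+
  qed
  \<comment> \<open>By symmetry of the real form, \<open>v\<close> and \<open>w\<close> can be
    exchanged in the equation for \<open>w\<close>, and \<open>v\<close> solves its own equation
    with right-hand side \<open>p / P\<close>. Both terms have mean 0: the numerator
    \<open>q1\<close> vanishes at \<open>a\<close> and \<open>b\<close>, and \<open>q2\<close> at
    0.\<close>
  have key: "(norm (h x))\<^sup>2 = Re (x * q1 x / ((x - a) * (x - b))) - Re (q2 x / P x)" if x: "x \<in> sphere 0 1" for x
  proof (cases "x = a \<or> x = b")
    case True
    have "q1 x = 0" "h x = 0" using True h(3,4) by (auto simp: q1_def bdot_def)
    moreover have "q2 x = 0" using p0[of x] True x by (auto simp: q2_def bdot_def)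
    ultimately show ?thesis by simp
  next
    case False
    define c where "c = x / ((x - a) * (x - b))"
    define v where "v = c *s h x"
    note ix = inv_sphere[OF x]
    have fac: "(x - a) * (x - b) = om x * (x * x) * P x"
    proof -
      have "(x - a) * (x - b) = (blaschke a x * (1 - cnj a * x)) * (blaschke b x * (1 - cnj b * x))"
        using blaschke_factor[OF ab(1) x] blaschke_factor[OF ab(2) x] by simp
      also have "\<dots> = blaschke a x * blaschke b x * ((x * cnj x) * (x * cnj x)) * P x"
        unfolding ix(2) P_def by simp
      also have "\<dots> = om x * (x * x) * P x" by (simp add: om_def)
      finally show ?thesis .
    qed
    have P0: "P x \<noteq> 0" "om x \<noteq> 0" using fac False by auto
    have cc: "cnj c = x / P x"
    proof -
      have "cnj c = cnj x / ((cnj x * (1 - cnj a * x)) * (cnj x * (1 - cnj b * x)))"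
        unfolding c_def complex_cnj_divide complex_cnj_mult cnj_diff_sphere[OF x] ..
      also have "\<dots> = 1 / (cnj x * P x)" using ix(3) by (simp add: P_def)
      also have "\<dots> = x / P x" using ix by (metis divide_divide_eq_right divide_divide_eq_left mult.commute mult_1 nonzero_divide_eq_eq times_divide_eq_left)
      finally show ?thesis .
    qed
    have oc: "om x * c = 1 / (x * P x)"
      unfolding c_def fac using P0 ix(3) by simp
    have v1: "vcnj v = (1 / P x) *s vcnj ((1 / x) *s h x)"
      unfolding v_def vec_eq_iff using cc ix by (simp add: inverse_eq_divide)
    have v2: "om x *s v = (1 / P x) *s ((1 / x) *s h x)"
      unfolding v_def vec_eq_iff using oc by (simp add: mult.assoc[symmetric])
    have e1: "H x *v vcnj v + So x *v v = (1 / P x) *s p x"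
    proof -
      have "So x *v v = S x *v (om x *s v)" by (simp add: So_def cscale_mult vector_scalar_commute)
      then have "H x *v vcnj v + So x *v v = (1 / P x) *s (H x *v vcnj ((1 / x) *s h x)) + (1 / P x) *s (S x *v ((1 / x) *s h x))"
        unfolding v1 v2 by (simp only: vector_scalar_commute)
      then show ?thesis unfolding eq[OF x, symmetric] by (simp only: vector_add_ldistrib)
    qed
    have "bdot v (F x) = of_real ((norm (h x))\<^sup>2)"
    proof -
      have "bdot v (F x) = (c * (cnj x * ((x - a) * (x - b)))) * bdot (h x) (vcnj (h x))"
        unfolding v_def F_def bdot_scale by simp
      also have "c * (cnj x * ((x - a) * (x - b))) = 1" using False ix(2) by (simp add: c_def)
      also have "bdot (h x) (vcnj (h x)) = of_real ((norm (h x))\<^sup>2)"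
        by (simp add: bdot_def norm_vec_def L2_set_def sum_nonneg complex_norm_square[symmetric])
      finally show ?thesis by simp
    qed
    moreover have "bdot v (X x) = x * q1 x / ((x - a) * (x - b))"
      unfolding v_def bdot_scale q1_def c_def by simp
    moreover have "Re (bdot v (X x)) = Re (bdot (w x) (H x *v vcnj v + So x *v v)) + Re (bdot v (F x))"
    proof -
      have "transpose (So x) = So x"
        using symm[OF x] by (simp add: So_def cscale_def transpose_def vec_eq_iff)
      then show ?thesis
        unfolding w(4)[OF x, symmetric] bdot_add_right
        using hermitian_bdot[of "H x" v "w x", OF herm[OF x]] symmetric_bdot[of "So x" v "w x"] by simp
    qed
    moreover have "bdot (w x) (H x *v vcnj v + So x *v v) = q2 x / P x"
      unfolding e1 bdot_scale q2_def by simp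
    ultimately show ?thesis by simp
  qed
  note hs = holo_disc_sphere[OF h(1)]
  have "cmean (\<lambda>x. (norm (h x))\<^sup>2) = cmean (\<lambda>x. Re (x * q1 x / ((x - a) * (x - b))) - Re (q2 x / P x))"
    by (rule cmean_cong[OF key])
  also have "\<dots> = 0"
    unfolding cmean_diff[OF cint_linear[OF bounded_linear_Re Q1(1)] cint_linear[OF bounded_linear_Re Q2(1)]]
      cmean_linear[OF bounded_linear_Re Q1(1)] cmean_linear[OF bounded_linear_Re Q2(1)] Q1(2) Q2(2) by simp
  finally have "integral {0..1} (\<lambda>t. (norm (h (cis (2 * pi * t))))\<^sup>2) = 0" unfolding cmean_def .
  moreover have "continuous_on {0..1} (\<lambda>t. (norm (h (cis (2 * pi * t))))\<^sup>2)"
    by (intro continuous_intros continuous_on_compose2[OF hs]) auto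
  ultimately have zero: "\<forall>t\<in>{0..1}. (norm (h (cis (2 * pi * t))))\<^sup>2 = 0"
    by (subst (asm) integral_eq_0_iff) auto
  have "norm (h x) \<le> 0" if "x \<in> sphere 0 1" for x
    using that
  proof (rule sphere_cisE)
    fix s assume "s \<in> {0..1}" "x = cis (2 * pi * s)"
    then show ?thesis using zero by simp
  qed
  from holo_disc_max[OF h(1) this z] show ?thesis by simp
qed

section \<open>Higher regularity\<close>

lemma holder_circle_0_iff:
  fixes F :: "complex \<Rightarrow> 'a::real_normed_vector"
  shows
  "holder_circle 0 \<alpha> F \<longleftrightarrow> (\<exists>C. \<forall>s t. norm (F (cis s) - F (cis t)) \<le> C * \<bar>s - t\<bar> powr \<alpha>)"
proof
  assume "\<exists>C. \<forall>s t. norm (F (cis s) - F (cis t)) \<le> C * \<bar>s - t\<bar> powr \<alpha>"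
  then show "holder_circle 0 \<alpha> F"
    unfolding holder_circle_def by (intro exI[of _ "\<lambda>_ t. F (cis t)"]) simp
next
  assume "holder_circle 0 \<alpha> F"
  then obtain D :: "nat \<Rightarrow> real \<Rightarrow> 'a" where "D 0 = (\<lambda>t. F (cis t))" "\<exists>C. \<forall>s t. norm (D 0 s - D 0 t) \<le> C * \<bar>s - t\<bar> powr \<alpha>"
    unfolding holder_circle_def by blast
  then show "\<exists>C. \<forall>s t. norm (F (cis s) - F (cis t)) \<le> C * \<bar>s - t\<bar> powr \<alpha>" by simp
qed

lemma has_vector_derivative_cis_periodic:
  assumes d: "\<And>t. ((\<lambda>t. F (cis t)) has_vector_derivative D t) (at t)" and c: "cis s = cis t"
  shows "D s = D t"
proof -
  have e: "F (cis (u + (t - s))) = F (cis u)" for u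
    using c by (simp add: cis_mult[symmetric] cis_divide[symmetric] field_simps)
  have g: "((\<lambda>u. u + (t - s)) has_vector_derivative 1) (at s)"
    by (auto intro!: derivative_eq_intros)
  have "((\<lambda>t. F (cis t)) has_vector_derivative D t) (at (s + (t - s)))" using d by simp
  from vector_diff_chain_at[OF g this]
  have "((\<lambda>t. F (cis t)) has_vector_derivative D t) (at s)" by (simp add: o_def e)
  then show ?thesis using d[of s] vector_derivative_unique_at by blast
qed

text \<open>Opens \<open>holder_circle\<close> to induction on \<open>m\<close>: the derivative in
  the angle is periodic, hence again a function on the circle.\<close>

lemma holder_circle_Suc_iff:
  "holder_circle (Suc m) \<alpha> F \<longleftrightarrow>
    (\<exists>F'. (\<forall>t. ((\<lambda>t. F (cis t)) has_vector_derivative F' (cis t)) (at t)) \<and> holder_circle m \<alpha> F')"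
proof
  assume "holder_circle (Suc m) \<alpha> F"
  then obtain D C where D: "D 0 = (\<lambda>t. F (cis t))"
    "\<And>k t. k < Suc m \<Longrightarrow> (D k has_vector_derivative D (Suc k) t) (at t)"
    "\<And>s t. norm (D (Suc m) s - D (Suc m) t) \<le> C * \<bar>s - t\<bar> powr \<alpha>"
    unfolding holder_circle_def by blast
  define F' where "F' z = D 1 (Arg z)" for z
  have d0: "((\<lambda>t. F (cis t)) has_vector_derivative D 1 t) (at t)" for t
    using D(2)[of 0 t] D(1) by simp
  have F': "F' (cis t) = D 1 t" for t
    unfolding F'_def by (rule has_vector_derivative_cis_periodic[OF d0]) (simp add: cis_Arg_unique cis_Arg sgn_div_norm)
  have "holder_circle m \<alpha> F'"
    unfolding holder_circle_def
    by (rule exI[of _ "\<lambda>k. D (Suc k)"]) (use D(2,3) in \<open>auto simp: F'\<close>)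
  then show "\<exists>F'. (\<forall>t. ((\<lambda>t. F (cis t)) has_vector_derivative F' (cis t)) (at t)) \<and> holder_circle m \<alpha> F'"
    by (intro exI[of _ F']) (use d0 F' in auto)
next
  assume "\<exists>F'. (\<forall>t. ((\<lambda>t. F (cis t)) has_vector_derivative F' (cis t)) (at t)) \<and> holder_circle m \<alpha> F'"
  then obtain F' D C where F': "\<And>t. ((\<lambda>t. F (cis t)) has_vector_derivative F' (cis t)) (at t)"
    and D: "D 0 = (\<lambda>t. F' (cis t))" "\<And>k t. k < m \<Longrightarrow> (D k has_vector_derivative D (Suc k) t) (at t)"
    "\<And>s t. norm (D m s - D m t) \<le> C * \<bar>s - t\<bar> powr \<alpha>"
    unfolding holder_circle_def by blast
  define E where "E k = (case k of 0 \<Rightarrow> (\<lambda>t. F (cis t)) | Suc j \<Rightarrow> D j)" for k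
  have E: "(E k has_vector_derivative E (Suc k) t) (at t)" if "k < Suc m" for k t
    using that F' D by (cases k) (auto simp: E_def)
  show "holder_circle (Suc m) \<alpha> F"
    unfolding holder_circle_def
    by (rule exI[of _ E]) (use E D(3) in \<open>auto simp: E_def\<close>)
qed

lemma sphere_pairE:
  assumes "x \<in> sphere 0 1" "y \<in> sphere 0 (1::real)"
  obtains s t where "x = cis s" "y = cis t" "\<bar>s - t\<bar> \<le> 2 * cmod (x - y)"
proof -
  define s u where "s = Arg x" and "u = Arg (y / x)"
  have nz: "x \<noteq> 0" "y / x \<noteq> 0" using assms by auto
  have x: "x = cis s" using assms(1) nz cis_Arg[of x] by (simp add: s_def sgn_div_norm)
  have "cis u = y / x" unfolding u_def using assms nz cis_Arg[of "y / x"] by (simp add: sgn_div_norm norm_divide)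
  then have y: "y = cis (s + u)" using x nz by (simp add: cis_mult[symmetric])
  have "\<bar>s - (s + u)\<bar> \<le> pi" using mpi_less_Arg[of "y / x"] Arg_le_pi[of "y / x"] by (simp add: u_def)
  then have "\<bar>s - (s + u)\<bar> \<le> 2 * cmod (cis s - cis (s + u))" by (rule norm_cis_diff_ge)
  then have "\<bar>s - (s + u)\<bar> \<le> 2 * cmod (x - y)" unfolding x[symmetric] y[symmetric] .
  then show ?thesis by (rule that[OF x y])
qed

text \<open>Arc and chord are comparable for angles at most \<open>pi\<close> apart, and the
  seminorm together with the value at 1 bounds the supremum.\<close>

lemma holder_circle_0_iff_bound:
  assumes \<alpha>: "0 < \<alpha>"
  shows "holder_circle 0 \<alpha> F \<longleftrightarrow> (\<exists>K. holder_bound \<alpha> K F)"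
proof
  assume "\<exists>K. holder_bound \<alpha> K F"
  then obtain K where K: "holder_bound \<alpha> K F" ..
  have "norm (F (cis s) - F (cis t)) \<le> K * \<bar>s - t\<bar> powr \<alpha>" for s t
  proof -
    have "norm (F (cis s) - F (cis t)) \<le> K * norm (cis s - cis t) powr \<alpha>"
      using K unfolding holder_bound_def by simp
    also have "\<dots> \<le> K * \<bar>s - t\<bar> powr \<alpha>"
      using norm_cis_diff_le[of s t] holder_bound_nonneg[OF K] \<alpha> by (intro mult_left_mono powr_mono2) auto
    finally show ?thesis .
  qed
  then show "holder_circle 0 \<alpha> F" unfolding holder_circle_0_iff by blast
next
  assume "holder_circle 0 \<alpha> F"
  then obtain C where C: "\<And>s t. norm (F (cis s) - F (cis t)) \<le> C * \<bar>s - t\<bar> powr \<alpha>"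
    unfolding holder_circle_0_iff by blast
  have C0: "0 \<le> C"
  proof -
    have "0 \<le> C * \<bar>1 - 0 :: real\<bar> powr \<alpha>" using C[of 1 0] by (rule order_trans[OF norm_ge_zero])
    then show ?thesis by simp
  qed
  define M where "M = C * 2 powr \<alpha>"
  have M0: "0 \<le> M" using C0 by (simp add: M_def)
  have M: "norm (F x - F y) \<le> M * norm (x - y) powr \<alpha>" if xy: "x \<in> sphere 0 1" "y \<in> sphere 0 1" for x y
  proof -
    obtain s t where st: "x = cis s" "y = cis t" "\<bar>s - t\<bar> \<le> 2 * cmod (x - y)" using xy by (rule sphere_pairE)
    have "norm (F x - F y) \<le> C * \<bar>s - t\<bar> powr \<alpha>" using C st by simp
    also have "\<dots> \<le> C * (2 * cmod (x - y)) powr \<alpha>" using st(3) C0 \<alpha> by (intro mult_left_mono powr_mono2) auto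
    finally show ?thesis by (simp add: M_def powr_mult)
  qed
  from \<alpha> M0 M show "\<exists>K. holder_bound \<alpha> K F" by (rule holder_bound_exists)
qed

lemma holder_circle_Suc_imp:
  assumes \<alpha>: "0 < \<alpha>" "\<alpha> < 1"
  shows "holder_circle (Suc m) \<alpha> F \<Longrightarrow> holder_circle m \<alpha> F"
proof (induction m arbitrary: F)
  case 0
  then obtain F' where d: "\<And>t. ((\<lambda>t. F (cis t)) has_vector_derivative F' (cis t)) (at t)"
    and "holder_circle 0 \<alpha> F'" unfolding holder_circle_Suc_iff by blast
  then obtain K where K: "holder_bound \<alpha> K F'" using holder_circle_0_iff_bound[OF \<alpha>(1)] by blast
  note K0 = holder_bound_nonneg[OF K]
  have l: "norm (F x - F y) \<le> 2 * K * norm (x - y)" if xy: "x \<in> sphere 0 1" "y \<in> sphere 0 1" for x y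
  proof -
    obtain s t where st: "x = cis s" "y = cis t" "\<bar>s - t\<bar> \<le> 2 * cmod (x - y)" using xy by (rule sphere_pairE)
    have "norm (F (cis s) - F (cis t)) \<le> K * norm (s - t)"
    proof (rule differentiable_bound[of UNIV "\<lambda>t. F (cis t)" "\<lambda>t h. h *\<^sub>R F' (cis t)"])
      show "((\<lambda>t. F (cis t)) has_derivative (\<lambda>h. h *\<^sub>R F' (cis t))) (at t within UNIV)" for t
        using d[of t] by (simp add: has_vector_derivative_def)
      show "onorm (\<lambda>h. h *\<^sub>R F' (cis t)) \<le> K" for t
        proof (rule onorm_bound[OF K0])
        fix h :: real
        have "\<bar>h\<bar> * norm (F' (cis t)) \<le> \<bar>h\<bar> * K"
          using K unfolding holder_bound_def by (intro mult_left_mono) auto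
        then show "norm (h *\<^sub>R F' (cis t)) \<le> K * norm h" by (simp add: mult.commute)
      qed
    qed auto
    also have "\<dots> \<le> K * (2 * cmod (x - y))" using st(3) K0 by (intro mult_left_mono) auto
    finally show ?thesis using st by simp
  qed
  have "\<exists>K. holder_bound \<alpha> K F" by (rule holder_bound_lipschitz[OF \<alpha> _ l]) (use K0 in simp_all)
  then show ?case using holder_circle_0_iff_bound[OF \<alpha>(1)] by blast
next
  case (Suc m)
  from Suc.prems obtain F' where F': "\<forall>t. ((\<lambda>t. F (cis t)) has_vector_derivative F' (cis t)) (at t)"
    "holder_circle (Suc m) \<alpha> F'" unfolding holder_circle_Suc_iff[of "Suc m"] by blast
  from F'(1) Suc.IH[OF F'(2)] show ?case unfolding holder_circle_Suc_iff by blast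
qed

lemma holder_circle_bound:
  assumes \<alpha>: "0 < \<alpha>" "\<alpha> < 1" and "holder_circle m \<alpha> F"
  obtains K where "holder_bound \<alpha> K F"
proof -
  have "holder_circle 0 \<alpha> F"
    using assms(3)
  proof (induction m)
    case (Suc m)
    from Suc.IH[OF holder_circle_Suc_imp[OF \<alpha> Suc.prems]] show ?case .
  qed
  then have "\<exists>K. holder_bound \<alpha> K F" unfolding holder_circle_0_iff_bound[OF \<alpha>(1)] .
  then show ?thesis using that by (elim exE)
qed

lemma holder_circle_cong:
  assumes "\<And>x. x \<in> sphere 0 1 \<Longrightarrow> F x = G x"
  shows "holder_circle m \<alpha> F \<longleftrightarrow> holder_circle m \<alpha> G"
proof -
  have "(\<lambda>t. F (cis t)) = (\<lambda>t. G (cis t))" using assms by simp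
  then show ?thesis unfolding holder_circle_def by simp
qed

lemma holder_circle_const:
  assumes "0 < \<alpha>" shows "holder_circle m \<alpha> (\<lambda>x. c)"
proof (induction m arbitrary: c)
  case 0 show ?case unfolding holder_circle_0_iff by (rule exI[of _ 0]) simp
next
  case (Suc m)
  have "\<forall>t. ((\<lambda>t. c) has_vector_derivative (\<lambda>x. 0) (cis t)) (at t)" by simp
  with Suc.IH[of 0] show ?case unfolding holder_circle_Suc_iff by (intro exI[of _ "\<lambda>x. 0"]) auto
qed

lemma holder_circle_add:
  assumes \<alpha>: "0 < \<alpha>"
  shows "holder_circle m \<alpha> F \<Longrightarrow> holder_circle m \<alpha> G \<Longrightarrow> holder_circle m \<alpha> (\<lambda>x. F x + G x)"
proof (induction m arbitrary: F G)
  case 0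
  then show ?case unfolding holder_circle_0_iff_bound[OF \<alpha>] using holder_bound_add by blast
next
  case (Suc m)
  then obtain F' G' where "\<And>t. ((\<lambda>t. F (cis t)) has_vector_derivative F' (cis t)) (at t)" "holder_circle m \<alpha> F'"
    "\<And>t. ((\<lambda>t. G (cis t)) has_vector_derivative G' (cis t)) (at t)" "holder_circle m \<alpha> G'"
    unfolding holder_circle_Suc_iff by blast
  then show ?case unfolding holder_circle_Suc_iff
    by (intro exI[of _ "\<lambda>x. F' x + G' x"]) (auto intro: has_vector_derivative_add Suc.IH)
qed

lemma holder_circle_linear:
  assumes \<alpha>: "0 < \<alpha>" and h: "bounded_linear h"
  shows "holder_circle m \<alpha> F \<Longrightarrow> holder_circle m \<alpha> (\<lambda>x. h (F x))"
proof (induction m arbitrary: F)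
  case 0
  then obtain K where K: "holder_bound \<alpha> K F" unfolding holder_circle_0_iff_bound[OF \<alpha>] by blast
  obtain B where "0 \<le> B" "\<And>x. norm (h x) \<le> B * norm x"
    using bounded_linear.nonneg_bounded[OF h] by (auto simp: mult.commute)
  from holder_bound_linear[OF K h this(2,1)] show ?case unfolding holder_circle_0_iff_bound[OF \<alpha>] by blast
next
  case (Suc m)
  then obtain F' where "\<And>t. ((\<lambda>t. F (cis t)) has_vector_derivative F' (cis t)) (at t)" "holder_circle m \<alpha> F'"
    unfolding holder_circle_Suc_iff by blast
  then show ?case unfolding holder_circle_Suc_iff
    by (intro exI[of _ "\<lambda>x. h (F' x)"]) (auto intro: bounded_linear.has_vector_derivative[OF h] Suc.IH)
qed

lemma holder_circle_bilinear:
  assumes \<alpha>: "0 < \<alpha>" "\<alpha> < 1" and b: "bounded_bilinear b" "\<And>x y. norm (b x y) \<le> norm x * norm y"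
  shows "holder_circle m \<alpha> F \<Longrightarrow> holder_circle m \<alpha> G \<Longrightarrow> holder_circle m \<alpha> (\<lambda>x. b (F x) (G x))"
proof (induction m arbitrary: F G)
  case 0
  then show ?case unfolding holder_circle_0_iff_bound[OF \<alpha>(1)] using holder_bound_bilinear[OF b] by blast
next
  case (Suc m)
  then obtain F' G' where F: "\<And>t. ((\<lambda>t. F (cis t)) has_vector_derivative F' (cis t)) (at t)" "holder_circle m \<alpha> F'"
    and G: "\<And>t. ((\<lambda>t. G (cis t)) has_vector_derivative G' (cis t)) (at t)" "holder_circle m \<alpha> G'"
    unfolding holder_circle_Suc_iff by blast
  have m: "holder_circle m \<alpha> F" "holder_circle m \<alpha> G"
    by (rule holder_circle_Suc_imp[OF \<alpha> Suc.prems(1)], rule holder_circle_Suc_imp[OF \<alpha> Suc.prems(2)])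
  show ?case unfolding holder_circle_Suc_iff
  proof (intro exI[of _ "\<lambda>x. b (F x) (G' x) + b (F' x) (G x)"] conjI allI)
    show "((\<lambda>t. b (F (cis t)) (G (cis t))) has_vector_derivative b (F (cis t)) (G' (cis t)) + b (F' (cis t)) (G (cis t))) (at t)" for t
      by (rule bounded_bilinear.has_vector_derivative[OF b(1) F(1) G(1)])
    show "holder_circle m \<alpha> (\<lambda>x. b (F x) (G' x) + b (F' x) (G x))"
      by (intro holder_circle_add \<alpha> Suc.IH m F G)
  qed
qed

lemma holder_circle_mult_id:
  assumes \<alpha>: "0 < \<alpha>" "\<alpha> < 1" shows "holder_circle m \<alpha> (\<lambda>x. c * x)"
proof (induction m arbitrary: c)
  case 0
  have "\<exists>K. holder_bound \<alpha> K (\<lambda>x. c * x)"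
    by (rule holder_bound_lipschitz[OF \<alpha>, of "cmod c"]) (auto simp: norm_mult right_diff_distrib[symmetric])
  then show ?case unfolding holder_circle_0_iff_bound[OF \<alpha>(1)] by blast
next
  case (Suc m)
  have "((\<lambda>t. c * cis t) has_vector_derivative (c * \<i>) * cis t) (at t)" for t
  proof -
    have "((\<lambda>t. of_real t * \<i>) has_vector_derivative \<i>) (at t)" by (auto intro!: derivative_eq_intros)
    from field_vector_diff_chain_at[OF this DERIV_exp]
    have "(cis has_vector_derivative \<i> * cis t) (at t)"
      by (simp add: o_def cis_conv_exp[abs_def] mult.commute)
    from has_vector_derivative_mult_right[OF this, of c] show ?thesis by (simp add: mult.assoc)
  qed
  with Suc.IH show ?case unfolding holder_circle_Suc_iff by (intro exI[of _ "\<lambda>x. (c * \<i>) * x"]) auto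
qed

text \<open>Mean value inequality for \<open>F (cis (t + u)) - u *\<^sub>R F' x\<close>, whose
  derivative is an increment of \<open>F'\<close>; the rate is uniform on the circle.\<close>

lemma difference_quotient_bound:
  assumes K: "holder_bound \<alpha> K F'" and \<alpha>: "0 < \<alpha>"
    and d: "\<And>t. ((\<lambda>t. F (cis t)) has_vector_derivative F' (cis t)) (at t)"
    and x: "x \<in> sphere 0 1" and s: "s \<noteq> 0"
  shows "norm ((1 / s) *\<^sub>R (F (cis s * x) - F x) - F' x) \<le> K * \<bar>s\<bar> powr \<alpha>"
proof -
  obtain t where t: "x = cis t"
    using x by (rule sphere_cisE) blast
  define g where "g u = F (cis (t + u)) - u *\<^sub>R F' x" for u
  have dg: "(g has_vector_derivative F' (cis (t + u)) - F' x) (at u)" for u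
  proof -
    have "((\<lambda>u. t + u) has_vector_derivative 1) (at u)" by (auto intro!: derivative_eq_intros)
    from vector_diff_chain_at[OF this d]
    have "((\<lambda>u. F (cis (t + u))) has_vector_derivative F' (cis (t + u))) (at u)" by (simp add: o_def)
    then show ?thesis unfolding g_def by (auto intro!: derivative_eq_intros)
  qed
  have bd: "norm (F' (cis (t + u)) - F' x) \<le> K * \<bar>s\<bar> powr \<alpha>" if "\<bar>u\<bar> \<le> \<bar>s\<bar>" for u
  proof -
    have "norm (F' (cis (t + u)) - F' x) \<le> K * norm (cis (t + u) - cis t) powr \<alpha>"
      using K unfolding holder_bound_def t by simp
    also have "\<dots> \<le> K * \<bar>s\<bar> powr \<alpha>"
      using norm_cis_diff_le[of "t + u" t] that holder_bound_nonneg[OF K] \<alpha>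
      by (intro mult_left_mono powr_mono2) auto
    finally show ?thesis .
  qed
  have "norm (g s - g 0) \<le> (K * \<bar>s\<bar> powr \<alpha>) * norm (s - 0)"
  proof (rule differentiable_bound[of "cball 0 \<bar>s\<bar>" g "\<lambda>u h. h *\<^sub>R (F' (cis (t + u)) - F' x)"])
    fix u :: real assume u: "u \<in> cball 0 \<bar>s\<bar>"
    show "(g has_derivative (\<lambda>h. h *\<^sub>R (F' (cis (t + u)) - F' x))) (at u within cball 0 \<bar>s\<bar>)"
      using dg[of u] unfolding has_vector_derivative_def by (rule has_derivative_at_withinI)
    show "onorm (\<lambda>h. h *\<^sub>R (F' (cis (t + u)) - F' x)) \<le> K * \<bar>s\<bar> powr \<alpha>"
    proof (rule onorm_bound)
      fix h :: real
      show "norm (h *\<^sub>R (F' (cis (t + u)) - F' x)) \<le> K * \<bar>s\<bar> powr \<alpha> * norm h"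
        using mult_left_mono[OF bd[of u], of "\<bar>h\<bar>"] u by (simp add: mult.commute)
    qed (use holder_bound_nonneg[OF K] in simp)
  qed auto
  also have "g s - g 0 = s *\<^sub>R ((1 / s) *\<^sub>R (F (cis s * x) - F x) - F' x)"
    using s by (simp add: g_def t cis_mult scaleR_right_diff_distrib add.commute)
  finally have "\<bar>s\<bar> * norm ((1 / s) *\<^sub>R (F (cis s * x) - F x) - F' x) \<le> \<bar>s\<bar> * (K * \<bar>s\<bar> powr \<alpha>)"
    by (simp add: mult.commute)
  then show ?thesis using s by simp
qed

section \<open>Difference quotients along the circle and their limits\<close>

lemma holo_disc_rotate:
  assumes "holo_disc v" "cmod c = 1" shows "holo_disc (\<lambda>z. v (c * z))"
proof (rule holo_discI)
  fix i
  show "continuous_on (cball 0 1) (\<lambda>z. v (c * z) $ i)"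
    by (rule continuous_on_compose2[OF holo_disc_component(1)[OF assms(1)]])
       (use assms(2) in \<open>auto intro!: continuous_intros simp: norm_mult\<close>)
  have "((\<lambda>z. v z $ i) \<circ> (\<lambda>z. c * z)) holomorphic_on ball 0 1"
    by (rule holomorphic_on_compose_gen[OF _ holo_disc_component(2)[OF assms(1)]])
       (use assms(2) in \<open>auto intro!: holomorphic_intros simp: norm_mult\<close>)
  then show "(\<lambda>z. v (c * z) $ i) holomorphic_on ball 0 1" by (simp add: o_def)
qed

lemma holo_disc_scaleR:
  assumes "holo_disc v" shows "holo_disc (\<lambda>z. r *\<^sub>R v z)"
proof (rule holo_discI)
  fix i
  show "continuous_on (cball 0 1) (\<lambda>z. (r *\<^sub>R v z) $ i)"
    unfolding vector_scaleR_component by (rule continuous_on_scaleR[OF continuous_on_const holo_disc_component(1)[OF assms]])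
  show "(\<lambda>z. (r *\<^sub>R v z) $ i) holomorphic_on ball 0 1"
  proof -
    have "(r *\<^sub>R v z) $ i = of_real r * v z $ i" for z
      unfolding vector_scaleR_component by (rule scaleR_conv_of_real)
    then show ?thesis
      using holomorphic_on_mult[OF holomorphic_on_const holo_disc_component(2)[OF assms]] by simp
  qed
qed

lemma has_vector_derivative_at_0I:
  fixes f :: "real \<Rightarrow> 'a::real_normed_vector"
  assumes "((\<lambda>s. (1 / s) *\<^sub>R (f s - f 0)) \<longlongrightarrow> d) (at 0)"
  shows "(f has_vector_derivative d) (at 0)"
proof -
  have "norm ((1 / s) *\<^sub>R (f s - f 0) - d) = norm (f (0 + s) - f 0 - s *\<^sub>R d) / norm s" if "s \<noteq> 0" for s
  proof -
    have "(1 / s) *\<^sub>R (f s - f 0) - d = (1 / s) *\<^sub>R (f s - f 0 - s *\<^sub>R d)"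
      using that by (simp add: scaleR_right_diff_distrib)
    then show ?thesis by (simp add: divide_inverse mult.commute)
  qed
  then have "\<forall>\<^sub>F s in at 0. norm ((1 / s) *\<^sub>R (f s - f 0) - d) = norm (f (0 + s) - f 0 - s *\<^sub>R d) / norm s"
    by (simp add: eventually_at_filter)
  moreover have "((\<lambda>s. norm ((1 / s) *\<^sub>R (f s - f 0) - d)) \<longlongrightarrow> 0) (at 0)"
    by (rule tendsto_norm_zero[OF LIM_zero[OF assms]])
  ultimately have "((\<lambda>s. norm (f (0 + s) - f 0 - s *\<^sub>R d) / norm s) \<longlongrightarrow> 0) (at 0)"
    by (rule Lim_transform_eventually[rotated])
  then show ?thesis
    unfolding has_vector_derivative_def has_derivative_at by (simp add: bounded_linear_scaleR_left)
qed

lemma holo_disc_add: "holo_disc v \<Longrightarrow> holo_disc w \<Longrightarrow> holo_disc (\<lambda>z. v z + w z)"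
  unfolding holo_disc_def by (auto intro!: continuous_intros holomorphic_intros)

text \<open>The derivative is known along interior circles only. Integrated there and passed to the
  limit by dominated convergence, it exhibits \<open>v\<close> on the boundary as a primitive of the
  continuous \<open>y\<close>.\<close>

lemma boundary_derivative:
  fixes v y :: "complex \<Rightarrow> complex ^ 'n"
  assumes v: "holo_disc v" and y: "holo_disc y"
    and d: "\<And>z. z \<in> ball 0 1 \<Longrightarrow> ((\<lambda>s. v (cis s * z)) has_vector_derivative y z) (at 0)"
  shows "((\<lambda>t. v (cis t)) has_vector_derivative y (cis t)) (at t)"
proof -
  have vc: "continuous_on (cball 0 1) v" and yc: "continuous_on (cball 0 1) y"
    using v y by (auto simp: holo_disc_def)
  have int: "((\<lambda>t. v (of_real r * cis t)) has_vector_derivative y (of_real r * cis t)) (at t)"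
    if r: "0 < r" "r < 1" for r t
  proof -
    have z: "of_real r * cis t \<in> ball 0 1" using r by (simp add: norm_mult)
    have g: "((\<lambda>u. u - t) has_vector_derivative 1) (at t)" by (auto intro!: derivative_eq_intros)
    have "((\<lambda>s. v (cis s * (of_real r * cis t))) has_vector_derivative y (of_real r * cis t)) (at (t - t))"
      using d[OF z] by simp
    from vector_diff_chain_at[OF g this]
    show ?thesis by (simp add: o_def cis_mult[symmetric] cis_divide[symmetric] mult_ac)
  qed
  have circ: "continuous_on A (\<lambda>t. g (of_real r * cis t))"
    if "continuous_on (cball 0 1) g" "0 \<le> r" "r \<le> 1" for g :: "complex \<Rightarrow> complex ^ 'n" and r A
    by (rule continuous_on_compose2[OF that(1)]) (use that in \<open>auto intro!: continuous_intros simp: norm_mult\<close>)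
  have "compact (y ` cball 0 1)" by (intro compact_continuous_image yc compact_cball)
  then obtain B where B: "\<And>z. z \<in> cball 0 1 \<Longrightarrow> norm (y z) \<le> B"
    using compact_imp_bounded bounded_iff by (metis image_eqI)
  \<comment> \<open>Two successors, so that already \<open>r 0 = 1 / 2\<close> is positive.\<close>
  define r where "r k = 1 - 1 / real (Suc (Suc k))" for k
  have r: "0 < r k" "r k < 1" for k by (auto simp: r_def)
  have rlim: "r \<longlonglongrightarrow> 1"
    unfolding r_def using tendsto_diff[OF tendsto_const LIMSEQ_Suc[OF LIMSEQ_inverse_real_of_nat], of 1]
    by (simp add: inverse_eq_divide)
  have lim: "(\<lambda>k. g (of_real (r k) * cis t)) \<longlonglongrightarrow> g (cis t)"
    if g: "continuous_on (cball 0 1) g" for g :: "complex \<Rightarrow> complex ^ 'n" and t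
  proof -
    have "filterlim r (at_left 1) sequentially"
      using rlim r(2) by (simp add: filterlim_at eventually_sequentially) (metis less_irrefl)
    from filterlim_compose[OF radial_limit[OF g, of "cis t"] this] show ?thesis by simp
  qed
  have eq: "v (cis b) - v (cis a) = integral {a..b} (\<lambda>t. y (cis t))" if "a \<le> b" for a b
  proof -
    have hi: "((\<lambda>t. y (of_real (r k) * cis t)) has_integral v (of_real (r k) * cis b) - v (of_real (r k) * cis a)) {a..b}" for k
      by (rule fundamental_theorem_of_calculus[OF that]) (rule has_vector_derivative_at_within[OF int[OF r]])
    have "(\<lambda>k. integral {a..b} (\<lambda>t. y (of_real (r k) * cis t))) \<longlonglongrightarrow> integral {a..b} (\<lambda>t. y (cis t))"
    proof (rule dominated_convergence(2)[where h = "\<lambda>t. B"])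
      show "(\<lambda>t. y (of_real (r k) * cis t)) integrable_on {a..b}" for k using hi[of k] by blast
      show "norm (y (of_real (r k) * cis t)) \<le> B" for k t
        using r[of k] by (intro B) (simp add: norm_mult)
    qed (auto intro: lim[OF yc])
    moreover have "(\<lambda>k. integral {a..b} (\<lambda>t. y (of_real (r k) * cis t))) \<longlonglongrightarrow> v (cis b) - v (cis a)"
      unfolding integral_unique[OF hi] by (intro tendsto_diff lim[OF vc])
    ultimately show ?thesis by (rule LIMSEQ_unique[symmetric])
  qed
  let ?I = "{t - 1..t + 1}"
  have yt: "continuous_on ?I (\<lambda>t. y (cis t))" using circ[OF yc, of 1] by simp
  have "((\<lambda>u. integral {t - 1..u} (\<lambda>t. y (cis t))) has_vector_derivative y (cis t)) (at t within ?I)"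
    by (rule integral_has_vector_derivative[OF yt]) simp
  then have "((\<lambda>u. v (cis (t - 1)) + integral {t - 1..u} (\<lambda>t. y (cis t))) has_vector_derivative 0 + y (cis t)) (at t within ?I)"
    by (intro has_vector_derivative_add has_vector_derivative_const)
  then have "((\<lambda>u. v (cis u)) has_vector_derivative y (cis t)) (at t within ?I)"
    unfolding add_0_left
  proof (rule has_vector_derivative_transform[rotated 2])
    fix u assume "u \<in> ?I"
    then have "t - 1 \<le> u" by simp
    from eq[OF this, symmetric] show "v (cis u) = v (cis (t - 1)) + integral {t - 1..u} (\<lambda>t. y (cis t))"
      by simp
  qed simp
  moreover have "at t within ?I = at t" by (rule at_within_interior) simp
  ultimately show ?thesis by simp
qed

text \<open>\<open>y\<close> solves the equation that the angular derivative of \<open>v\<close> has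
  to satisfy; inside the disc that derivative is \<open>\<i> * z * v' z\<close>, whence the
  normalisation \<open>y 0 = 0\<close>. The induction hypothesis gives the regularity of
  \<open>y\<close>. To identify it, the mean of the difference quotient minus \<open>y\<close> is
  shown to tend to 0: this yields convergence in the open disc, and
  \<open>boundary_derivative\<close> reaches the circle.\<close>

theorem holder_regularity:
  fixes H S :: "complex \<Rightarrow> complex ^ 'n ^ 'n"
  assumes \<alpha>: "0 < \<alpha>" "\<alpha> < 1" and \<epsilon>: "0 < \<epsilon>" and e: "energy \<epsilon> H S"
  shows "\<lbrakk>holder_circle m \<alpha> H; holder_circle m \<alpha> S; holder_circle m \<alpha> F; holo_disc v; v 0 = 0; holo_disc p;
    \<And>x. x \<in> sphere 0 1 \<Longrightarrow> H x *v vcnj (v x) + S x *v v x + F x = p x\<rbrakk> \<Longrightarrow> holder_circle m \<alpha> v"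
proof (induction m arbitrary: F v p)
  case 0
  obtain LH LS K where LH: "holder_bound \<alpha> LH H" and LS: "holder_bound \<alpha> LS S" and K: "holder_bound \<alpha> K F"
    using 0(1-3) unfolding holder_circle_0_iff_bound[OF \<alpha>(1)] by blast
  define L where "L = max LH LS"
  have L: "holder_bound \<alpha> L H" "holder_bound \<alpha> L S" "0 \<le> L"
    using LH LS holder_bound_nonneg[OF LH] by (auto simp: L_def elim: holder_bound_mono)
  obtain C where "\<And>(H :: complex \<Rightarrow> complex ^ 'n ^ 'n) S F v p K.
      \<lbrakk>holder_bound \<alpha> L H; holder_bound \<alpha> L S; energy \<epsilon> H S; holo_disc v; v 0 = 0; holo_disc p;
       holder_bound \<alpha> K F; \<And>x. x \<in> sphere 0 1 \<Longrightarrow> H x *v vcnj (v x) + S x *v v x + F x = p x\<rbrakk>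
      \<Longrightarrow> holder_bound \<alpha> (C * K) v"
    by (rule apriori_estimate[OF \<alpha> \<epsilon> L(3), where 'n='n]) blast
  from this[OF L(1,2) e 0(4,5,6) K 0(7)] show ?case
    unfolding holder_circle_0_iff_bound[OF \<alpha>(1)] by blast
next
  case (Suc m)
  note mono = holder_circle_Suc_imp[OF \<alpha>]
  have hv: "holder_circle m \<alpha> v"
    by (rule Suc.IH[OF mono[OF Suc.prems(1)] mono[OF Suc.prems(2)] mono[OF Suc.prems(3)] Suc.prems(4-7)])
  obtain H' S' F' where
    H': "\<And>t. ((\<lambda>t. H (cis t)) has_vector_derivative H' (cis t)) (at t)" "holder_circle m \<alpha> H'" and
    S': "\<And>t. ((\<lambda>t. S (cis t)) has_vector_derivative S' (cis t)) (at t)" "holder_circle m \<alpha> S'" and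
    F': "\<And>t. ((\<lambda>t. F (cis t)) has_vector_derivative F' (cis t)) (at t)" "holder_circle m \<alpha> F'"
    using Suc.prems(1-3) unfolding holder_circle_Suc_iff by blast
  \<comment> \<open>What the product rule leaves besides the terms with the derivative of
    \<open>v\<close>.\<close>
  define F1 where "F1 x = F' x + (H' x *v vcnj (v x) + S' x *v v x)" for x
  have hmv: "holder_circle m \<alpha> (\<lambda>x. A x *v u x)" if "holder_circle m \<alpha> A" "holder_circle m \<alpha> u"
    for A :: "complex \<Rightarrow> complex ^ 'n ^ 'n" and u
    by (rule holder_circle_bilinear[OF \<alpha> bounded_bilinear_matrix_vector _ that]) (rule norm_matrix_vector_le)
  have hF1: "holder_circle m \<alpha> F1"
    unfolding F1_def
    by (intro holder_circle_add \<alpha> hmv H' S' F' hv holder_circle_linear[OF \<alpha>(1) bounded_linear_vcnj])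
  obtain LH where LH: "holder_bound \<alpha> LH H" by (rule holder_circle_bound[OF \<alpha> Suc.prems(1)])
  obtain LS where LS: "holder_bound \<alpha> LS S" by (rule holder_circle_bound[OF \<alpha> Suc.prems(2)])
  have "holder_bound \<alpha> (max LH LS) H" "holder_bound \<alpha> (max LH LS) S"
    using LH LS by (auto elim: holder_bound_mono)
  then have sol: "solvable \<alpha> H S" by (rule solvable_energy[OF \<alpha> \<epsilon> e])
  obtain K1 where "holder_bound \<alpha> K1 F1" by (rule holder_circle_bound[OF \<alpha> hF1])
  with sol obtain y q where y: "holo_disc y" "holo_disc q" "y 0 = 0"
    "\<And>x. x \<in> sphere 0 1 \<Longrightarrow> H x *v vcnj (y x) + S x *v y x + F1 x = q x"
    unfolding solvable_def by blast
  have hy: "holder_circle m \<alpha> y"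
    by (rule Suc.IH[OF mono[OF Suc.prems(1)] mono[OF Suc.prems(2)] hF1 y(1,3,2,4)])
  obtain KH where KH: "holder_bound \<alpha> KH H'" by (rule holder_circle_bound[OF \<alpha> H'(2)])
  obtain KS where KS: "holder_bound \<alpha> KS S'" by (rule holder_circle_bound[OF \<alpha> S'(2)])
  obtain KF where KF: "holder_bound \<alpha> KF F'" by (rule holder_circle_bound[OF \<alpha> F'(2)])
  obtain Kv where Kv: "holder_bound \<alpha> Kv v" by (rule holder_circle_bound[OF \<alpha> hv])
  define E where "E = KF + 2 * (KH * Kv) + 2 * (KS * Kv)"
  have mean: "cmean (\<lambda>x. norm ((1 / s) *\<^sub>R (v (cis s * x) - v x) - y x)) \<le> E * \<bar>s\<bar> powr \<alpha> / \<epsilon>" if s: "s \<noteq> 0" for s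
  proof -
    define D where "D g x = (1 / s) *\<^sub>R (g (cis s * x) - g x)" for g :: "complex \<Rightarrow> complex ^ 'n" and x
    define DM where "DM A x = (1 / s) *\<^sub>R (A (cis s * x) - A x)" for A :: "complex \<Rightarrow> complex ^ 'n ^ 'n" and x
    define d where "d x = D v x - y x" for x
    define pd where "pd x = D p x - q x" for x
    \<comment> \<open>The defect of the difference quotient: \<open>d\<close> solves the equation
      with data \<open>er\<close> and holomorphic right-hand side \<open>pd\<close>, so the size of
      \<open>er\<close> bounds its mean.\<close>
    define er where "er x = pd x - (H x *v vcnj (d x) + S x *v d x)" for x
    have hd: "holo_disc d" "holo_disc pd"
      unfolding d_def pd_def D_def
      by (intro holo_disc_diff holo_disc_scaleR holo_disc_rotate Suc.prems(4,6) y(1,2); simp)+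
    have d0: "d 0 = 0" using Suc.prems(5) y(3) by (simp add: d_def D_def)
    have er: "er x = (D F x - F' x) + ((DM H x - H' x) *v vcnj (v (cis s * x)) + H' x *v (vcnj (v (cis s * x)) - vcnj (v x)))
        + ((DM S x - S' x) *v v (cis s * x) + S' x *v (v (cis s * x) - v x))" if x: "x \<in> sphere 0 1" for x
    proof -
      have x': "cis s * x \<in> sphere 0 1" using x by (simp add: norm_mult)
      interpret mv: bounded_bilinear "(*v) :: complex ^ 'n ^ 'n \<Rightarrow> complex ^ 'n \<Rightarrow> complex ^ 'n"
        by (rule bounded_bilinear_matrix_vector)
      show ?thesis
        unfolding er_def pd_def d_def D_def DM_def Suc.prems(7)[OF x, symmetric] Suc.prems(7)[OF x', symmetric]
          y(4)[OF x, symmetric] F1_def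
        by (simp add: algebra_simps mv.scaleR_left mv.scaleR_right mv.add_left mv.add_right mv.diff_left mv.diff_right)
    qed
    have erb: "norm (er x) \<le> E * \<bar>s\<bar> powr \<alpha>" if x: "x \<in> sphere 0 1" for x
    proof -
      have x': "cis s * x \<in> sphere 0 1" using x by (simp add: norm_mult)
      have nv: "norm (v (cis s * x)) \<le> Kv" "norm (v x) \<le> Kv" using Kv x x' unfolding holder_bound_def by auto
      have dv: "norm (v (cis s * x) - v x) \<le> Kv * \<bar>s\<bar> powr \<alpha>"
      proof -
        have "norm (v (cis s * x) - v x) \<le> Kv * norm (cis s * x - x) powr \<alpha>"
          using Kv x x' unfolding holder_bound_def by blast
        also have "cis s * x - x = (cis s - cis 0) * x" by (simp add: algebra_simps)
        also have "norm \<dots> = norm (cis s - cis 0)" using x by (simp add: norm_mult)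
        also have "Kv * norm (cis s - cis 0) powr \<alpha> \<le> Kv * \<bar>s\<bar> powr \<alpha>"
          using norm_cis_diff_le[of s 0] holder_bound_nonneg[OF Kv] \<alpha> by (intro mult_left_mono powr_mono2) auto
        finally show ?thesis .
      qed
      have b1: "norm (D F x - F' x) \<le> KF * \<bar>s\<bar> powr \<alpha>"
        unfolding D_def by (rule difference_quotient_bound[OF KF \<alpha>(1) F'(1) x s])
      have b2: "norm (DM H x - H' x) \<le> KH * \<bar>s\<bar> powr \<alpha>"
        unfolding DM_def by (rule difference_quotient_bound[OF KH \<alpha>(1) H'(1) x s])
      have b3: "norm (DM S x - S' x) \<le> KS * \<bar>s\<bar> powr \<alpha>"
        unfolding DM_def by (rule difference_quotient_bound[OF KS \<alpha>(1) S'(1) x s])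
      have n': "norm (H' x) \<le> KH" "norm (S' x) \<le> KS" using KH KS x unfolding holder_bound_def by auto
      have mvb: "norm (A *v u) \<le> a * b" if "norm A \<le> a" "norm u \<le> b" for A :: "complex ^ 'n ^ 'n" and u a b
        using norm_matrix_vector_le[of A u] mult_mono[OF that order_trans[OF norm_ge_zero that(1)] norm_ge_zero]
        by linarith
      have "norm (er x) \<le> KF * \<bar>s\<bar> powr \<alpha> + (KH * \<bar>s\<bar> powr \<alpha> * Kv + KH * (Kv * \<bar>s\<bar> powr \<alpha>))
          + (KS * \<bar>s\<bar> powr \<alpha> * Kv + KS * (Kv * \<bar>s\<bar> powr \<alpha>))"
        unfolding er[OF x]
        by (intro norm_triangle_mono mvb b1 b2 b3 n' dv nv)
           (simp_all add: nv dv vcnj_simps(5)[symmetric] del: vcnj_simps(5))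
      then show ?thesis by (simp add: E_def algebra_simps)
    qed
    have "cmean (\<lambda>x. norm (d x)) \<le> (E * \<bar>s\<bar> powr \<alpha>) / \<epsilon>"
    proof (rule mean_estimate[OF e \<epsilon> hd(1) d0 hd(2) _ erb])
      show "continuous_on (sphere 0 1) er"
        unfolding er_def
        by (intro continuous_intros holo_disc_sphere hd holder_bound_continuous[OF \<alpha>(1) LH] holder_bound_continuous[OF \<alpha>(1) LS])
    qed (simp_all add: er_def)
    then show ?thesis by (simp add: d_def D_def)
  qed
  have "((\<lambda>s. v (cis s * z)) has_vector_derivative y z) (at 0)" if z: "z \<in> ball 0 1" for z
  proof -
    have "((\<lambda>s. (1 / s) *\<^sub>R (v (cis s * z) - v z) - y z) \<longlongrightarrow> 0) (at 0)"
    proof (rule Lim_null_comparison)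
      show "\<forall>\<^sub>F s in at 0. norm ((1 / s) *\<^sub>R (v (cis s * z) - v z) - y z) \<le> real CARD('n) * (E * \<bar>s\<bar> powr \<alpha> / \<epsilon> / (1 - cmod z))"
        unfolding eventually_at_filter
      proof (intro always_eventually allI impI)
        fix s :: real assume s: "s \<noteq> 0"
        show "norm ((1 / s) *\<^sub>R (v (cis s * z) - v z) - y z) \<le> real CARD('n) * (E * \<bar>s\<bar> powr \<alpha> / \<epsilon> / (1 - cmod z))"
          by (rule holo_disc_interior_bound[OF _ mean[OF s]])
             (use z in \<open>auto intro!: holo_disc_diff holo_disc_scaleR holo_disc_rotate Suc.prems y(1)\<close>)
      qed
      have "((\<lambda>s::real. \<bar>s\<bar> powr \<alpha>) \<longlongrightarrow> \<bar>0\<bar> powr \<alpha>) (at 0)" using \<alpha> by (intro tendsto_intros) auto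
      then have "((\<lambda>s::real. real CARD('n) * (E * \<bar>s\<bar> powr \<alpha> / \<epsilon> / (1 - cmod z))) \<longlongrightarrow> real CARD('n) * (E * \<bar>0\<bar> powr \<alpha> / \<epsilon> / (1 - cmod z))) (at 0)"
        using \<epsilon> z by (intro tendsto_mult tendsto_divide tendsto_const) auto
      then show "((\<lambda>s::real. real CARD('n) * (E * \<bar>s\<bar> powr \<alpha> / \<epsilon> / (1 - cmod z))) \<longlongrightarrow> 0) (at 0)" by simp
    qed
    then have "((\<lambda>s. (1 / s) *\<^sub>R (v (cis s * z) - v z)) \<longlongrightarrow> y z) (at 0)" by (rule LIM_zero_cancel)
    then show ?thesis by (intro has_vector_derivative_at_0I) simp
  qed
  from boundary_derivative[OF Suc.prems(4) y(1) this] hy show ?case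
    unfolding holder_circle_Suc_iff by blast
qed

section \<open>Interpolation at two points\<close>

text \<open>A positive continuous function has a positive minimum on the circle times the unit
  sphere, and both terms are homogeneous of degree 2 under real scalars.\<close>

lemma energy_constant:
  fixes H S :: "complex \<Rightarrow> complex ^ 'n ^ 'n"
  assumes c: "continuous_on (sphere 0 1) H" "continuous_on (sphere 0 1) S"
    and pos: "\<And>x v. x \<in> sphere 0 1 \<Longrightarrow> v \<noteq> 0 \<Longrightarrow> cmod (bdot v (S x *v v)) < Re (bdot v (H x *v vcnj v))"
  obtains \<epsilon> where "0 < \<epsilon>"
    "\<And>x v. x \<in> sphere 0 1 \<Longrightarrow> \<epsilon> * (norm v)\<^sup>2 \<le> Re (bdot v (H x *v vcnj v)) - cmod (bdot v (S x *v v))"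
proof -
  define f where "f = (\<lambda>(x, v). Re (bdot v (H x *v vcnj v)) - cmod (bdot v (S x *v v)))"
  let ?K = "sphere (0 :: complex) 1 \<times> sphere (0 :: complex ^ 'n) (1::real)"
  have "compact ?K" by (intro compact_Times compact_sphere)
  moreover have "?K \<noteq> {}" by simp
  moreover have "continuous_on ?K f"
  proof -
    have H: "continuous_on ?K (\<lambda>p. H (fst p))"
      by (rule continuous_on_compose2[OF c(1) continuous_on_fst[OF continuous_on_id]]) auto
    have S: "continuous_on ?K (\<lambda>p. S (fst p))"
      by (rule continuous_on_compose2[OF c(2) continuous_on_fst[OF continuous_on_id]]) auto
    show ?thesis unfolding f_def case_prod_unfold by (intro continuous_intros H S)
  qed
  ultimately obtain q where q: "q \<in> ?K" "\<forall>p\<in>?K. f q \<le> f p"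
    using continuous_attains_inf[of ?K f] by blast
  have q': "fst q \<in> sphere 0 1" "snd q \<noteq> 0" using q(1) by auto
  have "0 < f q" using pos[OF q'] by (simp add: f_def case_prod_unfold)
  moreover have "f q * (norm v)\<^sup>2 \<le> Re (bdot v (H x *v vcnj v)) - cmod (bdot v (S x *v v))"
    if x: "x \<in> sphere 0 1" for x v
  proof (cases "v = 0")
    case True then show ?thesis by (simp add: bdot_def)
  next
    case False
    interpret mv: bounded_bilinear "(*v) :: complex ^ 'n ^ 'n \<Rightarrow> complex ^ 'n \<Rightarrow> complex ^ 'n"
      by (rule bounded_bilinear_matrix_vector)
    interpret bd: bounded_bilinear "bdot :: complex ^ 'n \<Rightarrow> complex ^ 'n \<Rightarrow> complex"
      by (rule bounded_bilinear_bdot)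
    define u where "u = (1 / norm v) *\<^sub>R v"
    have vv: "k v = k (norm v *\<^sub>R u)" for k :: "complex ^ 'n \<Rightarrow> complex"
      using False by (simp add: u_def)
    have "f q \<le> f (x, u)" using False x by (intro bspec[OF q(2)]) (simp add: u_def)
    then have "(norm v)\<^sup>2 * f q \<le> (norm v)\<^sup>2 * f (x, u)" by (rule mult_left_mono) simp
    also have "\<dots> = (norm v)\<^sup>2 * Re (bdot u (H x *v vcnj u)) - (norm v)\<^sup>2 * cmod (bdot u (S x *v u))"
      by (simp add: f_def right_diff_distrib)
    also have "(norm v)\<^sup>2 * Re (bdot u (H x *v vcnj u)) = Re (bdot v (H x *v vcnj v))"
    proof -
      have "bdot v (H x *v vcnj v) = (norm v)\<^sup>2 *\<^sub>R bdot u (H x *v vcnj u)"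
        using vv[of "\<lambda>v. bdot v (H x *v vcnj v)"]
        by (simp add: mv.scaleR_right bd.scaleR_right bd.scaleR_left power2_eq_square)
      then show ?thesis by simp
    qed
    also have "(norm v)\<^sup>2 * cmod (bdot u (S x *v u)) = cmod (bdot v (S x *v v))"
    proof -
      have "bdot v (S x *v v) = (norm v)\<^sup>2 *\<^sub>R bdot u (S x *v u)"
        using vv[of "\<lambda>v. bdot v (S x *v v)"]
        by (simp add: mv.scaleR_right bd.scaleR_right bd.scaleR_left power2_eq_square)
      then show ?thesis by simp
    qed
    finally show ?thesis by (simp add: mult.commute)
  qed
  ultimately show ?thesis by (rule that)
qed

definition solves :: "(complex \<Rightarrow> complex ^ 'n ^ 'n) \<Rightarrow> (complex \<Rightarrow> complex ^ 'n ^ 'n) \<Rightarrow>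
    (complex \<Rightarrow> complex ^ 'n) \<Rightarrow> (complex \<Rightarrow> complex ^ 'n) \<Rightarrow> bool" where
  "solves H S F v \<longleftrightarrow> holo_disc v \<and> v 0 = 0 \<and>
     (\<exists>p. holo_disc p \<and> (\<forall>x\<in>sphere 0 1. H x *v vcnj (v x) + S x *v v x + F x = p x))"

text \<open>Real \<open>r\<close>, since the equation contains \<open>vcnj v\<close>.\<close>

lemma solves_combine:
  assumes "solves H S F v" "solves H S G w"
  shows "solves H S (\<lambda>x. F x + r *\<^sub>R G x) (\<lambda>x. v x + r *\<^sub>R w x)"
proof -
  interpret mv: bounded_bilinear "(*v) :: complex ^ 'a ^ 'a \<Rightarrow> complex ^ 'a \<Rightarrow> complex ^ 'a"
    by (rule bounded_bilinear_matrix_vector)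
  obtain p q where p: "holo_disc p" "\<And>x. x \<in> sphere 0 1 \<Longrightarrow> H x *v vcnj (v x) + S x *v v x + F x = p x"
    and q: "holo_disc q" "\<And>x. x \<in> sphere 0 1 \<Longrightarrow> H x *v vcnj (w x) + S x *v w x + G x = q x"
    using assms unfolding solves_def by blast
  have "H x *v vcnj (v x + r *\<^sub>R w x) + S x *v (v x + r *\<^sub>R w x) + (F x + r *\<^sub>R G x) = p x + r *\<^sub>R q x"
    if x: "x \<in> sphere 0 1" for x
    unfolding p(2)[OF x, symmetric] q(2)[OF x, symmetric]
    by (simp add: mv.add_right mv.scaleR_right scaleR_add_right)
  moreover have "holo_disc (\<lambda>x. p x + r *\<^sub>R q x)" "holo_disc (\<lambda>x. v x + r *\<^sub>R w x)"
    using assms p(1) q(1) unfolding solves_def by (auto intro!: holo_disc_add holo_disc_scaleR)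
  ultimately show ?thesis using assms unfolding solves_def by auto
qed

text \<open>The mean estimate with \<open>K = 0\<close>. The interior bound reaches the open disc;
  continuity adds the circle later.\<close>

lemma solves_zero:
  fixes H S :: "complex \<Rightarrow> complex ^ 'n ^ 'n"
  assumes e: "energy \<epsilon> H S" "0 < \<epsilon>" and s: "solves H S F v"
    and F: "\<And>x. x \<in> sphere 0 1 \<Longrightarrow> F x = 0" and z: "z \<in> ball 0 1"
  shows "v z = 0"
proof -
  obtain p where v: "holo_disc v" "v 0 = 0" and p: "holo_disc p"
    "\<And>x. x \<in> sphere 0 1 \<Longrightarrow> H x *v vcnj (v x) + S x *v v x + F x = p x"
    using s unfolding solves_def by blast
  have p': "H x *v vcnj (v x) + S x *v v x + 0 = p x" if "x \<in> sphere 0 1" for x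
    using p(2)[OF that] F[OF that] by simp
  have "cmean (\<lambda>x. norm (v x)) \<le> 0 / \<epsilon>"
    by (rule mean_estimate[OF e v p(1) continuous_on_const _ p']) auto
  then have "cmean (\<lambda>x. norm (v x)) \<le> 0" by simp
  from holo_disc_interior_bound[OF v(1) this, of z] z show ?thesis by simp
qed

section \<open>From the equation for \<open>v\<close> back to \<open>g\<close>\<close>

definition stationary_datum where
  "stationary_datum H S f g = (\<lambda>\<zeta>. H \<zeta> *v vcnj (\<chi> i. g \<zeta> $ i / \<zeta>) + S \<zeta> *v (\<chi> i. g \<zeta> $ i / \<zeta>) + f \<zeta>)"

definition stationary where
  "stationary m \<alpha> H S f g \<longleftrightarrow> holo_disc g \<and> holder_circle m \<alpha> g \<and> in_O m \<alpha> (stationary_datum H S f g)"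

lemma vec_divide: "(\<chi> i. (v :: complex ^ 'n) $ i / c) = (1 / c) *s v"
  by (simp add: vec_eq_iff)

lemma holder_circle_inverse:
  assumes "0 < \<alpha>" "\<alpha> < 1" shows "holder_circle m \<alpha> (\<lambda>x::complex. 1 / x)"
proof -
  have "1 / x = cnj (1 * x)" if "x \<in> sphere 0 1" for x :: complex
  proof -
    have "x * cnj x = 1" "x \<noteq> 0" using that by (auto simp: complex_norm_square[symmetric])
    then show ?thesis by (simp add: divide_eq_eq mult.commute)
  qed
  then have "holder_circle m \<alpha> (\<lambda>x::complex. 1 / x) \<longleftrightarrow> holder_circle m \<alpha> (\<lambda>x. cnj (1 * x))"
    by (rule holder_circle_cong)
  then show ?thesis
    using holder_circle_linear[OF assms(1) bounded_linear_cnj holder_circle_mult_id[OF assms, of m 1]] by simp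
qed

lemma holder_circle_vector_scale:
  assumes "0 < \<alpha>" "\<alpha> < 1" "holder_circle m \<alpha> c" "holder_circle m \<alpha> v"
  shows "holder_circle m \<alpha> (\<lambda>x. c x *s (v x :: complex ^ 'n))"
  by (rule holder_circle_bilinear[OF assms(1,2) bounded_bilinear_vector_scale _ assms(3,4)])
     (simp add: norm_vector_scale)

lemma holder_circle_stationary_datum:
  assumes \<alpha>: "0 < \<alpha>" "\<alpha> < 1"
    and "holder_circle m \<alpha> H" "holder_circle m \<alpha> S" "holder_circle m \<alpha> f" "holder_circle m \<alpha> g"
  shows "holder_circle m \<alpha> (stationary_datum H S f g)"
proof -
  have u: "holder_circle m \<alpha> (\<lambda>x. (1 / x) *s g x)"
    by (intro holder_circle_vector_scale \<alpha> holder_circle_inverse assms)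
  show ?thesis
    unfolding stationary_datum_def vec_divide
    by (intro holder_circle_add \<alpha>
        holder_circle_bilinear[OF \<alpha> bounded_bilinear_matrix_vector norm_matrix_vector_le]
        holder_circle_linear[OF \<alpha>(1) bounded_linear_vcnj] u assms)
qed

text \<open>The strict inequality of the theorem enters in the uniform form supplied by
  \<open>energy_constant\<close>.\<close>

locale elliptic_problem =
  fixes m :: nat and \<alpha> \<epsilon> :: real and H S :: "complex \<Rightarrow> complex ^ 'n ^ 'n"
  assumes \<alpha>: "0 < \<alpha>" "\<alpha> < 1" and \<epsilon>: "0 < \<epsilon>"
    and H: "holder_circle m \<alpha> H" and S: "holder_circle m \<alpha> S"
    and herm: "\<And>x i j. x \<in> sphere 0 1 \<Longrightarrow> H x $ i $ j = cnj (H x $ j $ i)"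
    and symm: "\<And>x. x \<in> sphere 0 1 \<Longrightarrow> transpose (S x) = S x"
    and pos: "\<And>x v. x \<in> sphere 0 1 \<Longrightarrow>
       \<epsilon> * (norm v)\<^sup>2 \<le> Re (bdot v (H x *v vcnj v)) - cmod (bdot v (S x *v v))"
begin

lemma energy: "energy \<epsilon> H S"
  unfolding energy_def
proof (intro ballI allI)
  fix x :: complex and v :: "complex ^ 'n" assume x: "x \<in> sphere 0 1"
  show "\<epsilon> * (norm v)\<^sup>2 \<le> Re (bdot v (H x *v vcnj v + S x *v v))"
    using pos[OF x, of v] abs_Re_le_cmod[of "bdot v (S x *v v)"] unfolding bdot_add_right by simp
qed

lemma common_bound: obtains L where "holder_bound \<alpha> L H" "holder_bound \<alpha> L S"
proof -
  obtain LH where LH: "holder_bound \<alpha> LH H" by (rule holder_circle_bound[OF \<alpha> H])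
  obtain LS where LS: "holder_bound \<alpha> LS S" by (rule holder_circle_bound[OF \<alpha> S])
  show ?thesis by (rule that[of "max LH LS"]) (use LH LS in \<open>auto elim: holder_bound_mono\<close>)
qed

lemma solves_exists:
  assumes F: "holder_circle m \<alpha> F"
  shows "\<exists>v. solves H S F v"
proof -
  obtain L where L: "holder_bound \<alpha> L H" "holder_bound \<alpha> L S" by (rule common_bound)
  obtain K where "holder_bound \<alpha> K F" by (rule holder_circle_bound[OF \<alpha> F])
  then show ?thesis
    using solvable_energy[OF \<alpha> \<epsilon> energy L] unfolding solvable_def solves_def by blast
qed

text \<open>Division by \<open>x\<close> turns \<open>x *s v x\<close> into \<open>v x\<close>, so
  the datum of the sum is that of the affine part plus the terms in \<open>v\<close>. The Hoelder
  class of \<open>v\<close> comes from \<open>holder_regularity\<close>.\<close>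

lemma stationaryI:
  assumes f: "holder_circle m \<alpha> f"
    and v: "solves H S (\<lambda>x. stationary_datum H S f (\<lambda>x. a + x *s b) x) v"
  shows "stationary m \<alpha> H S f (\<lambda>x. a + x *s b + x *s v x)"
proof -
  let ?A = "\<lambda>x. a + x *s b" and ?g = "\<lambda>x. a + x *s b + x *s v x"
  have id: "holder_circle m \<alpha> (\<lambda>x::complex. x)" using holder_circle_mult_id[OF \<alpha>, of m 1] by simp
  have hA: "holder_circle m \<alpha> ?A"
    by (intro holder_circle_add \<alpha> holder_circle_vector_scale id holder_circle_const)
  have hF: "holder_circle m \<alpha> (\<lambda>x. stationary_datum H S f ?A x)"
    by (rule holder_circle_stationary_datum[OF \<alpha> H S f hA])
  obtain p where p: "holo_disc v" "v 0 = 0" "holo_disc p"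
    "\<And>x. x \<in> sphere 0 1 \<Longrightarrow> H x *v vcnj (v x) + S x *v v x + stationary_datum H S f ?A x = p x"
    using v unfolding solves_def by blast
  have hv: "holder_circle m \<alpha> v"
    by (rule holder_regularity[OF \<alpha> \<epsilon> energy H S hF p])
  have hg: "holder_circle m \<alpha> ?g"
    by (intro holder_circle_add \<alpha> holder_circle_vector_scale id hA hv)
  have dg: "holo_disc ?g"
    by (rule holo_discI)
       (auto intro!: continuous_intros holomorphic_intros holo_disc_component[OF p(1)] simp: p(1)[unfolded holo_disc_def])
  have "p x = stationary_datum H S f ?g x" if x: "x \<in> sphere 0 1" for x
  proof -
    have "x \<noteq> 0" using x by auto
    then have u: "(1 / x) *s ?g x = (1 / x) *s ?A x + v x" by (simp add: vec_eq_iff field_simps)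
    show ?thesis
      unfolding p(4)[OF x, symmetric] stationary_datum_def vec_divide u
      by (simp add: matrix_vector_right_distrib)
  qed
  moreover have "holder_circle m \<alpha> (stationary_datum H S f ?g)"
    by (rule holder_circle_stationary_datum[OF \<alpha> H S f hg])
  ultimately have "in_O m \<alpha> (stationary_datum H S f ?g)" unfolding in_O_def using p(3) by blast
  then show ?thesis using dg hg unfolding stationary_def by blast
qed

text \<open>In the difference of two solutions \<open>f\<close> cancels, and what remains vanishes
  at \<open>a\<close> and \<open>b\<close>.\<close>

lemma stationary_unique:
  assumes g: "stationary m \<alpha> H S f g" and g': "stationary m \<alpha> H S f g'"
    and ab: "a \<in> cball 0 1" "b \<in> cball 0 1" "a \<noteq> b" and eq: "g a = g' a" "g b = g' b"
    and z: "z \<in> cball 0 1"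
  shows "g z = g' z"
proof -
  obtain L where L: "holder_bound \<alpha> L H" "holder_bound \<alpha> L S" by (rule common_bound)
  obtain p where p: "holo_disc p" "\<forall>x\<in>sphere 0 1. p x = stationary_datum H S f g x"
    using g unfolding stationary_def in_O_def by blast
  obtain p' where p': "holo_disc p'" "\<forall>x\<in>sphere 0 1. p' x = stationary_datum H S f g' x"
    using g' unfolding stationary_def in_O_def by blast
  have hc: "holder_circle m \<alpha> g" "holder_circle m \<alpha> g'"
      "holder_circle m \<alpha> (stationary_datum H S f g)" "holder_circle m \<alpha> (stationary_datum H S f g')"
    using g g' unfolding stationary_def in_O_def by auto
  obtain K1 where K1: "holder_bound \<alpha> K1 g" by (rule holder_circle_bound[OF \<alpha> hc(1)])
  obtain K2 where K2: "holder_bound \<alpha> K2 g'" by (rule holder_circle_bound[OF \<alpha> hc(2)])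
  obtain K3 where K3: "holder_bound \<alpha> K3 (stationary_datum H S f g)" by (rule holder_circle_bound[OF \<alpha> hc(3)])
  obtain K4 where K4: "holder_bound \<alpha> K4 (stationary_datum H S f g')" by (rule holder_circle_bound[OF \<alpha> hc(4)])
  have pb: "holder_bound \<alpha> (K3 + K4) (\<lambda>x. p x - p' x)"
    using holder_bound_diff[OF K3 K4] p(2) p'(2) unfolding holder_bound_def by simp
  have d: "holo_disc (\<lambda>x. g x - g' x)" "holo_disc (\<lambda>x. p x - p' x)"
    using g g' p(1) p'(1) unfolding stationary_def by (auto intro: holo_disc_diff)
  have "H x *v vcnj ((1 / x) *s (g x - g' x)) + S x *v ((1 / x) *s (g x - g' x)) = p x - p' x"
    if x: "x \<in> sphere 0 1" for x
  proof -
    have 1: "(1 / x) *s (g x - g' x) = (1 / x) *s g x - (1 / x) *s g' x"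
      by (simp add: vec_eq_iff diff_divide_distrib)
    have 2: "p x = stationary_datum H S f g x" "p' x = stationary_datum H S f g' x" using p(2) p'(2) x by auto
    show ?thesis
      unfolding 1 2 stationary_datum_def vec_divide by (simp add: matrix_vector_mult_diff_distrib)
  qed
  from two_zeros_imp_zero[OF \<alpha> \<epsilon> L herm symm pos d(1) holder_bound_diff[OF K1 K2] _ _ d(2) pb ab this z]
  show ?thesis using eq by simp
qed

text \<open>The pair of free coefficients and the pair of prescribed values range over the same
  finite-dimensional real space, so uniqueness yields surjectivity.\<close>

lemma evaluation_surjective:
  assumes ab: "a \<in> cball 0 1" "b \<in> cball 0 1" "a \<noteq> b"
  shows "\<exists>g. stationary m \<alpha> H S (\<lambda>x. 0) g \<and> g a = z \<and> g b = w"
proof -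
  let ?D = "\<lambda>q. stationary_datum H S (\<lambda>x. 0) (\<lambda>x. fst q + x *s snd q)"
  have id: "holder_circle m \<alpha> (\<lambda>x::complex. x)" using holder_circle_mult_id[OF \<alpha>, of m 1] by simp
  have h0: "holder_circle m \<alpha> (\<lambda>x. 0 :: complex ^ 'n)" by (rule holder_circle_const[OF \<alpha>(1)])
  have hD: "holder_circle m \<alpha> (?D q)" for q
    by (rule holder_circle_stationary_datum[OF \<alpha> H S h0])
       (intro holder_circle_add \<alpha> holder_circle_vector_scale id holder_circle_const)
  have "\<forall>q. \<exists>v. solves H S (?D q) v" using solves_exists[OF hD] by blast
  from choice[OF this] obtain V where V: "\<And>q. solves H S (?D q) (V q)" by blast
  define G where "G q x = fst q + x *s snd q + x *s V q x" for q x
  have G: "stationary m \<alpha> H S (\<lambda>x. 0) (G q)" for q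
    using stationaryI[OF h0 V[of q]] unfolding G_def[abs_def] .
  \<comment> \<open>The defect of linearity is written with the factor \<open>- 1\<close>, the shape
    that \<open>solves_combine\<close> produces; \<open>solves_zero\<close> then makes the chosen
    solutions \<open>V\<close> linear in \<open>q\<close>.\<close>
  have Dlin: "?D (q + r *\<^sub>R q') x + (- 1) *\<^sub>R (?D q x + r *\<^sub>R ?D q' x) = 0" for q q' r x
  proof -
    interpret mv: bounded_bilinear "(*v) :: complex ^ 'n ^ 'n \<Rightarrow> complex ^ 'n \<Rightarrow> complex ^ 'n"
      by (rule bounded_bilinear_matrix_vector)
    interpret sc: bounded_bilinear "(*s) :: complex \<Rightarrow> complex ^ 'n \<Rightarrow> complex ^ 'n"
      by (rule bounded_bilinear_vector_scale)
    show ?thesis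
      unfolding stationary_datum_def vec_divide
      by (simp add: mv.add_right mv.scaleR_right sc.add_right sc.scaleR_right scaleR_add_right)
  qed
  have Vlin: "V (q + r *\<^sub>R q') x = V q x + r *\<^sub>R V q' x" if x: "x \<in> cball 0 1" for q q' r x
  proof -
    let ?d = "\<lambda>x. V (q + r *\<^sub>R q') x + (- 1) *\<^sub>R (V q x + r *\<^sub>R V q' x)"
    have s: "solves H S (\<lambda>x. ?D (q + r *\<^sub>R q') x + (- 1) *\<^sub>R (?D q x + r *\<^sub>R ?D q' x)) ?d"
      by (intro solves_combine V)
    have "?d x = 0"
    \<comment> \<open>Vanishing is known in the open disc; radial limits add the circle, where
      \<open>a\<close> or \<open>b\<close> may lie.\<close>
    proof (rule tendsto_unique[OF trivial_limit_at_left_real])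
      show "((\<lambda>r. ?d (of_real r * x)) \<longlongrightarrow> ?d x) (at_left 1)"
        using s x by (intro radial_limit) (auto simp: solves_def holo_disc_def)
      have "\<forall>\<^sub>F r in at_left 1. 0 = ?d (of_real r * x)"
        using eventually_at_left_1
      proof eventually_elim
        case (elim t)
        have "t * cmod x \<le> t" using x elim by (simp add: mult_left_le)
        then have "t * cmod x < 1" using elim by linarith
        then have "of_real t * x \<in> ball 0 1" using elim by (simp add: norm_mult)
        from solves_zero[OF energy \<epsilon> s Dlin this] show ?case by (rule sym)
      qed
      then show "((\<lambda>r. ?d (of_real r * x)) \<longlongrightarrow> 0) (at_left 1)"
        by (rule Lim_transform_eventually[OF tendsto_const])
    qed
    then have "V (q + r *\<^sub>R q') x - (V q x + r *\<^sub>R V q' x) = 0" by (simp add: algebra_simps)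
    then show ?thesis by (simp only: right_minus_eq)
  qed
  have Glin: "G (q + r *\<^sub>R q') x = G q x + r *\<^sub>R G q' x" if x: "x \<in> cball 0 1" for q q' r x
    unfolding G_def Vlin[OF x] by (simp add: vec_eq_iff algebra_simps)
  define E where "E q = (G q a, G q b)" for q
  have "linear E"
  proof (rule linearI)
    show "E (q + q') = E q + E q'" for q q'
      using Glin[OF ab(1), of q 1 q'] Glin[OF ab(2), of q 1 q'] by (simp add: E_def)
    have G0: "G 0 a = 0" "G 0 b = 0"
      using Glin[OF ab(1), of 0 1 0] Glin[OF ab(2), of 0 1 0] by simp_all
    show "E (r *\<^sub>R q) = r *\<^sub>R E q" for r q
      using Glin[OF ab(1), of 0 r q] Glin[OF ab(2), of 0 r q] G0 by (simp add: E_def)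
  qed
  moreover have "inj E"
  proof -
    have "q = 0" if "E q = 0" for q
    proof -
      have s0: "stationary m \<alpha> H S (\<lambda>x. 0) (\<lambda>x. 0)"
      proof -
        have "stationary_datum H S (\<lambda>x. 0) (\<lambda>x. 0 :: complex ^ 'n) = (\<lambda>x. 0)"
          unfolding stationary_datum_def vec_divide by simp
        moreover have "holo_disc (\<lambda>x. 0 :: complex ^ 'n)" by (simp add: holo_disc_def)
        ultimately show ?thesis using h0 unfolding stationary_def in_O_def by auto
      qed
      have Gz: "G q x = 0" if "x \<in> cball 0 1" for x
        by (rule stationary_unique[OF G s0 ab _ _ that]) (use \<open>E q = 0\<close> in \<open>auto simp: E_def zero_prod_def\<close>)
      \<comment> \<open>\<open>G q\<close> vanishes identically on the closed disc: its value at 0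
        is \<open>fst q\<close>, and after division by \<open>x\<close> its limit at 0 is
        \<open>snd q\<close>, as \<open>V q 0 = 0\<close>.\<close>
      have f0: "fst q = 0" using Gz[of 0] by (simp add: G_def)
      have hV: "holo_disc (V q)" "V q 0 = 0" using V[of q] by (auto simp: solves_def)
      have z0: "snd q + V q x = 0" if "x \<in> cball 0 1" "x \<noteq> 0" for x
      proof -
        have "x *s (snd q + V q x) = 0" using Gz[OF that(1)] f0 by (simp add: G_def vector_add_ldistrib)
        then show ?thesis using that(2) unfolding vector_mul_eq_0 by blast
      qed
      have "((\<lambda>x. snd q + V q x) \<longlongrightarrow> snd q + V q 0) (at 0)"
      proof -
        have "continuous_on (ball 0 1) (V q)" using hV(1) unfolding holo_disc_def by (auto elim: continuous_on_subset)
        then have "isCont (V q) 0" by (simp add: continuous_on_eq_continuous_at)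
        then show ?thesis by (intro tendsto_add tendsto_const) (simp add: isCont_def)
      qed
      moreover have "\<forall>\<^sub>F x in at 0. 0 = snd q + V q x"
      proof -
        have "\<forall>\<^sub>F x in at (0::complex). x \<in> ball 0 1 - {0}"
          using eventually_at_ball'[of 1 "0::complex" UNIV] by simp
        then show ?thesis
        proof eventually_elim
          case (elim x)
          then show ?case using z0[of x] by simp
        qed
      qed
      then have "((\<lambda>x. snd q + V q x) \<longlongrightarrow> 0) (at 0)"
        by (rule Lim_transform_eventually[OF tendsto_const])
      ultimately have "snd q + V q 0 = 0" by (rule LIM_unique)
      then show ?thesis using f0 hV(2) by (simp add: prod_eq_iff)
    qed
    then show ?thesis unfolding linear_injective_0[OF \<open>linear E\<close>] by blast
  qed
  ultimately have "surj E" by (rule linear_injective_imp_surjective) (rule refl)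
  from surjD[OF this, of "(z, w)"] obtain q where "(z, w) = E q" ..
  then show ?thesis using G[of q] by (auto simp: E_def)
qed

text \<open>A particular solution, here with both free coefficients 0, is corrected by a solution
  for \<open>f = 0\<close> that takes the remaining values.\<close>

lemma stationary_exists:
  assumes f: "holder_circle m \<alpha> f" and ab: "a \<in> cball 0 1" "b \<in> cball 0 1" "a \<noteq> b"
  shows "\<exists>g. stationary m \<alpha> H S f g \<and> g a = z \<and> g b = w"
proof -
  have "holder_circle m \<alpha> (\<lambda>x. stationary_datum H S f (\<lambda>x. 0 + x *s 0) x)"
    by (rule holder_circle_stationary_datum[OF \<alpha> H S f]) (simp add: holder_circle_const[OF \<alpha>(1)])
  from solves_exists[OF this] obtain v where v: "solves H S (\<lambda>x. stationary_datum H S f (\<lambda>x. 0 + x *s 0) x) v" ..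
  define g0 where "g0 = (\<lambda>x. 0 + x *s 0 + x *s v x)"
  have g0: "stationary m \<alpha> H S f g0" unfolding g0_def by (rule stationaryI[OF f v])
  obtain g1 where g1: "stationary m \<alpha> H S (\<lambda>x. 0) g1" "g1 a = z - g0 a" "g1 b = w - g0 b"
    using evaluation_surjective[OF ab] by blast
  obtain p where p: "holo_disc p" "\<forall>x\<in>sphere 0 1. p x = stationary_datum H S f g0 x"
    using g0 unfolding stationary_def in_O_def by blast
  obtain q where q: "holo_disc q" "\<forall>x\<in>sphere 0 1. q x = stationary_datum H S (\<lambda>x. 0) g1 x"
    using g1 unfolding stationary_def in_O_def by blast
  let ?g = "\<lambda>x. g0 x + g1 x"
  have hg: "holder_circle m \<alpha> ?g" "holo_disc ?g"
    using g0 g1 unfolding stationary_def by (auto intro: holder_circle_add[OF \<alpha>(1)] holo_disc_add)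
  have "stationary_datum H S f ?g x = stationary_datum H S f g0 x + stationary_datum H S (\<lambda>x. 0) g1 x" for x
    unfolding stationary_datum_def vec_divide vector_add_ldistrib
    by (simp add: matrix_vector_right_distrib)
  then have "in_O m \<alpha> (stationary_datum H S f ?g)"
    unfolding in_O_def using holder_circle_stationary_datum[OF \<alpha> H S f hg(1)] p q
    by (auto intro!: exI[of _ "\<lambda>x. p x + q x"] holo_disc_add)
  then have "stationary m \<alpha> H S f ?g" using hg unfolding stationary_def by blast
  moreover have "?g a = z" "?g b = w" using g1 by auto
  ultimately show ?thesis by blast
qed

end

text \<open>Uniqueness means equality on the closed disc, the values elsewhere being
  arbitrary.\<close>

theorem theorem2p3:
  fixes m :: nat and \<alpha> :: real
    and H S :: "complex \<Rightarrow> complex ^ 'n ^ 'n"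
    and f :: "complex \<Rightarrow> complex ^ 'n"
    and \<zeta>0 \<xi>0 :: complex and z0 w0 :: "complex ^ 'n"
  assumes "0 < \<alpha>" and "\<alpha> < 1"
    and "holder_circle m \<alpha> H" and "holder_circle m \<alpha> S"
    and "\<forall>\<zeta>\<in>sphere 0 1. \<forall>i j. H \<zeta> $ i $ j = cnj (H \<zeta> $ j $ i)"
    and "\<forall>\<zeta>\<in>sphere 0 1. transpose (S \<zeta>) = S \<zeta>"
    and "\<forall>\<zeta>\<in>sphere 0 1. \<forall>v :: complex ^ 'n. v \<noteq> 0 \<longrightarrow>
           cmod (\<Sum>i\<in>UNIV. \<Sum>j\<in>UNIV. v $ i * S \<zeta> $ i $ j * v $ j)
             < Re (\<Sum>i\<in>UNIV. \<Sum>j\<in>UNIV. v $ i * H \<zeta> $ i $ j * cnj (v $ j))"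
    and "holder_circle m \<alpha> f"
    and "\<zeta>0 \<in> cball 0 1" and "\<xi>0 \<in> cball 0 1" and "\<zeta>0 \<noteq> \<xi>0"
  shows "\<exists>g :: complex \<Rightarrow> complex ^ 'n.
           holo_disc g \<and> holder_circle m \<alpha> g \<and> g \<zeta>0 = z0 \<and> g \<xi>0 = w0 \<and>
           in_O m \<alpha> (\<lambda>\<zeta>. H \<zeta> *v vcnj (\<chi> i. g \<zeta> $ i / \<zeta>) + S \<zeta> *v (\<chi> i. g \<zeta> $ i / \<zeta>) + f \<zeta>) \<and>
           (\<forall>g' :: complex \<Rightarrow> complex ^ 'n.
              holo_disc g' \<and> holder_circle m \<alpha> g' \<and> g' \<zeta>0 = z0 \<and> g' \<xi>0 = w0 \<and>
              in_O m \<alpha> (\<lambda>\<zeta>. H \<zeta> *v vcnj (\<chi> i. g' \<zeta> $ i / \<zeta>) + S \<zeta> *v (\<chi> i. g' \<zeta> $ i / \<zeta>) + f \<zeta>)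
              \<longrightarrow> (\<forall>z\<in>cball 0 1. g' z = g z))"
proof -
  have bS: "bdot v (A *v v) = (\<Sum>i\<in>UNIV. \<Sum>j\<in>UNIV. v $ i * A $ i $ j * v $ j)" for v and A :: "complex ^ 'n ^ 'n"
    by (simp add: bdot_def matrix_vector_mult_def sum_distrib_left mult.assoc)
  have bH: "bdot v (A *v vcnj v) = (\<Sum>i\<in>UNIV. \<Sum>j\<in>UNIV. v $ i * A $ i $ j * cnj (v $ j))" for v and A :: "complex ^ 'n ^ 'n"
    by (simp add: bdot_def matrix_vector_mult_def sum_distrib_left mult.assoc)
  obtain LH where LH: "holder_bound \<alpha> LH H" by (rule holder_circle_bound[OF assms(1-3)])
  obtain LS where LS: "holder_bound \<alpha> LS S" by (rule holder_circle_bound[OF assms(1,2,4)])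
  have "cmod (bdot v (S x *v v)) < Re (bdot v (H x *v vcnj v))" if "x \<in> sphere 0 1" "v \<noteq> 0" for x v
    unfolding bS bH using assms(7) that by blast
  then obtain \<epsilon> where \<epsilon>: "0 < \<epsilon>"
    "\<And>x v. x \<in> sphere 0 1 \<Longrightarrow> \<epsilon> * (norm v)\<^sup>2 \<le> Re (bdot v (H x *v vcnj v)) - cmod (bdot v (S x *v v))"
    by (rule energy_constant[OF holder_bound_continuous[OF assms(1) LH] holder_bound_continuous[OF assms(1) LS]]) blast+
  interpret elliptic_problem m \<alpha> \<epsilon> H S
    by unfold_locales (fact assms(1-4) \<epsilon> | rule assms(5)[rule_format] assms(6)[rule_format], assumption)+
  obtain g where g: "stationary m \<alpha> H S f g" "g \<zeta>0 = z0" "g \<xi>0 = w0"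
    using stationary_exists[OF assms(8-11)] by blast
  have "g' z = g z" if g': "stationary m \<alpha> H S f g'" "g' \<zeta>0 = z0" "g' \<xi>0 = w0" and z: "z \<in> cball 0 1" for g' z
    by (rule stationary_unique[OF g'(1) g(1) assms(9-11) _ _ z]) (simp_all add: g g')
  then show ?thesis
    using g unfolding stationary_def stationary_datum_def by blast
qed

end
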